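(* Let $d\ge1$ and $q\ge2$, and let $\mathfrak A$ be a $d$-colored ordinal having the least order type in its $\equiv_q$-equivalence class of $d$-colored ordinals. Put $k=|\rho_{q-1}(\mathfrak A)|$. Then: if $k\le 2^{q-1}-1$, then $\operatorname{otp}(A)=k$; and if $k>2^{q-1}-1$, then $\operatorname{otp}(A)\le\omega^{k-2^{q-1}+1}$.
   Context: A $d$-colored ordinal is a structure $\mathfrak A=(A,<,C_0,\dots,C_{d-1})$ where $(A,<)$ is an ordinal (well-order) and the unary predicates $C_i$ partition $A$; empty domains and empty color classes are allowed. $\operatorname{otp}(A)$ is the order type of $(A,<)$. $\mathfrak A\equiv_q\mathfrak B$ means agreement on all first-order sentences of quantifier rank at most $q$. $[[\mathfrak A]]^q$ denotes the $q$-characteristic sentence of $\mathfrak A$, so $[[\mathfrak A]]^q$ and $[[\mathfrak B]]^q$ are identified iff $\mathfrak A\equiv_q\mathfrak B$. For $a\in A$ of color $i$, the $q$-character of $a$ is $\rho_q^{\mathfrak A}(a)=(i,[[\mathfrak A_{<a}]]^q,[[\mathfrak A_{>a}]]^q)$, where $\mathfrak A_{<a},\mathfrak A_{>a}$ are the substructures on $\{b:b<a\}$ and $\{b:b>a\}$; and $\rho_q(\mathfrak A)=\{\rho_q^{\mathfrak A}(a):a\in A\}$. *)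

theory Defs
  imports Main "HOL-Library.Disjoint_Sets"
begin

unbundle cardinal_syntax

section \<open>Colored ordinals\<close>

text \<open>
  As in the library's theory of well-orders, \<open>le A\<close> is the reflexive order and the domain is its
  field (so the empty relation is the empty ordinal). Order types are compared with the library
  relations \<open>=o\<close> and \<open>\<le>o\<close>, which relate well-orders on possibly different types.
\<close>

record 'a cstruct =
  le :: "'a rel"
  clr :: "nat \<Rightarrow> 'a set"

abbreviation dom_of :: "('a, 'z) cstruct_scheme \<Rightarrow> 'a set" where
  "dom_of A \<equiv> Field (le A)"

definition colored_ordinal :: "nat \<Rightarrow> 'a cstruct \<Rightarrow> bool" where
  "colored_ordinal d A \<longleftrightarrow>
     Well_order (le A) \<and> disjoint_family_on (clr A) {..<d} \<and> (\<Union>i<d. clr A i) = dom_of A"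

definition substr :: "'a cstruct \<Rightarrow> 'a set \<Rightarrow> 'a cstruct" where
  "substr A S = \<lparr>le = Restr (le A) S, clr = (\<lambda>i. clr A i \<inter> S)\<rparr>"

definition color_of :: "nat \<Rightarrow> 'a cstruct \<Rightarrow> 'a \<Rightarrow> nat" where
  "color_of d A a = (THE i. i < d \<and> a \<in> clr A i)"


section \<open>First-order logic\<close>

text \<open>
  \<open>Tru\<close> is primitive because in a relational language with possibly empty structures the empty
  conjunction must be available at quantifier rank 0.
\<close>

datatype fm =
    Tru
  | Eq nat nat
  | Less nat nat
  | Col nat nat
  | Neg fm
  | And fm fm
  | Ex nat fm

abbreviation Or :: "fm \<Rightarrow> fm \<Rightarrow> fm" where
  "Or \<phi> \<psi> \<equiv> Neg (And (Neg \<phi>) (Neg \<psi>))"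

abbreviation All :: "nat \<Rightarrow> fm \<Rightarrow> fm" where
  "All x \<phi> \<equiv> Neg (Ex x (Neg \<phi>))"

primrec sat :: "'a cstruct \<Rightarrow> (nat \<Rightarrow> 'a) \<Rightarrow> fm \<Rightarrow> bool" where
  "sat A v Tru \<longleftrightarrow> True"
| "sat A v (Eq x y) \<longleftrightarrow> v x = v y"
| "sat A v (Less x y) \<longleftrightarrow> (v x, v y) \<in> le A \<and> v x \<noteq> v y"
| "sat A v (Col i x) \<longleftrightarrow> v x \<in> clr A i"
| "sat A v (Neg \<phi>) \<longleftrightarrow> \<not> sat A v \<phi>"
| "sat A v (And \<phi> \<psi>) \<longleftrightarrow> sat A v \<phi> \<and> sat A v \<psi>"
| "sat A v (Ex x \<phi>) \<longleftrightarrow> (\<exists>a\<in>dom_of A. sat A (v(x := a)) \<phi>)"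

primrec qr :: "fm \<Rightarrow> nat" where
  "qr Tru = 0"
| "qr (Eq x y) = 0"
| "qr (Less x y) = 0"
| "qr (Col i x) = 0"
| "qr (Neg \<phi>) = qr \<phi>"
| "qr (And \<phi> \<psi>) = max (qr \<phi>) (qr \<psi>)"
| "qr (Ex x \<phi>) = Suc (qr \<phi>)"

primrec fv :: "fm \<Rightarrow> nat set" where
  "fv Tru = {}"
| "fv (Eq x y) = {x, y}"
| "fv (Less x y) = {x, y}"
| "fv (Col i x) = {x}"
| "fv (Neg \<phi>) = fv \<phi>"
| "fv (And \<phi> \<psi>) = fv \<phi> \<union> fv \<psi>"
| "fv (Ex x \<phi>) = fv \<phi> - {x}"

primrec colors_in :: "fm \<Rightarrow> nat set" where
  "colors_in Tru = {}"
| "colors_in (Eq x y) = {}"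
| "colors_in (Less x y) = {}"
| "colors_in (Col i x) = {i}"
| "colors_in (Neg \<phi>) = colors_in \<phi>"
| "colors_in (And \<phi> \<psi>) = colors_in \<phi> \<union> colors_in \<psi>"
| "colors_in (Ex x \<phi>) = colors_in \<phi>"

definition sentence :: "nat \<Rightarrow> fm \<Rightarrow> bool" where
  "sentence d \<phi> \<longleftrightarrow> fv \<phi> = {} \<and> colors_in \<phi> \<subseteq> {..<d}"

text \<open>
  For sentences the valuation is irrelevant. Quantifying over all total valuations (rather than
  valuations into the domain) keeps this meaningful for the empty structure.
\<close>

definition models :: "'a cstruct \<Rightarrow> fm \<Rightarrow> bool" where
  "models A \<phi> \<longleftrightarrow> (\<forall>v. sat A v \<phi>)"

definition equiv_q :: "nat \<Rightarrow> nat \<Rightarrow> 'a cstruct \<Rightarrow> 'b cstruct \<Rightarrow> bool" where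
  "equiv_q d q A B \<longleftrightarrow> (\<forall>\<phi>. sentence d \<phi> \<and> qr \<phi> \<le> q \<longrightarrow> models A \<phi> \<longleftrightarrow> models B \<phi>)"

lemma sat_cong: "(\<And>x. x \<in> fv \<phi> \<Longrightarrow> v x = w x) \<Longrightarrow> sat A v \<phi> \<longleftrightarrow> sat A w \<phi>"
proof (induction \<phi> arbitrary: v w)
  case (Neg \<phi>)
  then show ?case by (metis fv.simps(5) sat.simps(5))
next
  case (And \<phi> \<psi>)
  then show ?case by (metis UnCI fv.simps(6) sat.simps(6))
next
  case (Ex x \<phi>)
  have "sat A (v(x := a)) \<phi> \<longleftrightarrow> sat A (w(x := a)) \<phi>" for a
    by (rule Ex.IH) (use Ex.prems in auto)
  then show ?case by simp
qed auto

lemma models_sentence: "fv \<phi> = {} \<Longrightarrow> models A \<phi> \<longleftrightarrow> sat A v \<phi>"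
  unfolding models_def using sat_cong[of \<phi>] by blast


section \<open>Characteristic sentences\<close>

text \<open>
  The conjunction of a finite set of formulas, in an order that depends only on the set.
\<close>

definition Conjs :: "fm set \<Rightarrow> fm" where
  "Conjs S = foldr And (SOME \<phi>s. set \<phi>s = S) Tru"

definition Disjs :: "fm set \<Rightarrow> fm" where
  "Disjs S = Neg (Conjs (Neg ` S))"

definition atoms :: "nat \<Rightarrow> nat \<Rightarrow> fm set" where
  "atoms d n = (\<lambda>(x, y). Eq x y) ` ({..<n} \<times> {..<n}) \<union> (\<lambda>(x, y). Less x y) ` ({..<n} \<times> {..<n})
     \<union> (\<lambda>(i, x). Col i x) ` ({..<d} \<times> {..<n})"

text \<open>
  \<open>charfm d A q n v\<close> is the rank-\<open>q\<close> characteristic (Hintikka) formula, with free variables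
  \<open>0, \<dots>, n - 1\<close>, of the tuple \<open>(v 0, \<dots>, v (n - 1))\<close> in \<open>A\<close>.
\<close>

primrec charfm :: "nat \<Rightarrow> 'a cstruct \<Rightarrow> nat \<Rightarrow> nat \<Rightarrow> (nat \<Rightarrow> 'a) \<Rightarrow> fm" where
  "charfm d A 0 n v =
     Conjs ({\<phi> \<in> atoms d n. sat A v \<phi>} \<union> Neg ` {\<phi> \<in> atoms d n. \<not> sat A v \<phi>})"
| "charfm d A (Suc q) n v =
     (let S = (\<lambda>a. charfm d A q (Suc n) (v(n := a))) ` dom_of A
      in And (Conjs (Ex n ` S)) (All n (Disjs S)))"

definition charsent :: "nat \<Rightarrow> nat \<Rightarrow> 'a cstruct \<Rightarrow> fm" where
  "charsent d q A = charfm d A q 0 (\<lambda>_. undefined)"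

lemma sat_Conjs: "finite S \<Longrightarrow> sat A v (Conjs S) \<longleftrightarrow> (\<forall>\<phi>\<in>S. sat A v \<phi>)"
  and qr_Conjs: "finite S \<Longrightarrow> qr (Conjs S) \<le> q \<longleftrightarrow> (\<forall>\<phi>\<in>S. qr \<phi> \<le> q)"
  and fv_Conjs: "finite S \<Longrightarrow> fv (Conjs S) = (\<Union>\<phi>\<in>S. fv \<phi>)"
  and colors_in_Conjs: "finite S \<Longrightarrow> colors_in (Conjs S) = (\<Union>\<phi>\<in>S. colors_in \<phi>)"
proof -
  assume "finite S"
  define \<phi>s where "\<phi>s = (SOME \<phi>s. set \<phi>s = S)"
  have S: "S = set \<phi>s"
    unfolding \<phi>s_def using finite_list[OF \<open>finite S\<close>] by (metis (mono_tags, lifting) someI_ex)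
  have C: "Conjs S = foldr And \<phi>s Tru"
    unfolding Conjs_def \<phi>s_def ..
  show "sat A v (Conjs S) \<longleftrightarrow> (\<forall>\<phi>\<in>S. sat A v \<phi>)"
    unfolding C unfolding S by (induction \<phi>s) auto
  show "qr (Conjs S) \<le> q \<longleftrightarrow> (\<forall>\<phi>\<in>S. qr \<phi> \<le> q)"
    unfolding C unfolding S by (induction \<phi>s) auto
  show "fv (Conjs S) = (\<Union>\<phi>\<in>S. fv \<phi>)"
    unfolding C unfolding S by (induction \<phi>s) auto
  show "colors_in (Conjs S) = (\<Union>\<phi>\<in>S. colors_in \<phi>)"
    unfolding C unfolding S by (induction \<phi>s) auto
qed

lemma sat_Disjs: "finite S \<Longrightarrow> sat A v (Disjs S) \<longleftrightarrow> (\<exists>\<phi>\<in>S. sat A v \<phi>)"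
  and qr_Disjs: "finite S \<Longrightarrow> qr (Disjs S) \<le> q \<longleftrightarrow> (\<forall>\<phi>\<in>S. qr \<phi> \<le> q)"
  and fv_Disjs: "finite S \<Longrightarrow> fv (Disjs S) = (\<Union>\<phi>\<in>S. fv \<phi>)"
  and colors_in_Disjs: "finite S \<Longrightarrow> colors_in (Disjs S) = (\<Union>\<phi>\<in>S. colors_in \<phi>)"
  by (auto simp: Disjs_def sat_Conjs qr_Conjs fv_Conjs colors_in_Conjs)

lemma finite_atoms: "finite (atoms d n)"
  by (auto simp: atoms_def)

lemma finite_charfm: "finite {charfm d A q n v | (A :: 'a cstruct) v. True}"
proof (induction q arbitrary: n)
  case 0
  have "{charfm d A 0 n v | (A :: 'a cstruct) v. True}
      \<subseteq> (\<lambda>(S, T). Conjs (S \<union> Neg ` T)) ` (Pow (atoms d n) \<times> Pow (atoms d n))"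
    by auto
  then show ?case
    by (rule finite_subset) (simp add: finite_atoms)
next
  case (Suc q)
  have "{charfm d A (Suc q) n v | (A :: 'a cstruct) v. True}
      \<subseteq> (\<lambda>S. And (Conjs (Ex n ` S)) (All n (Disjs S)))
           ` Pow {charfm d A q (Suc n) v | (A :: 'a cstruct) v. True}"
    by (auto simp: Let_def)
  then show ?case
    by (rule finite_subset) (use Suc.IH[of "Suc n"] in simp)
qed

lemma finite_charfm_image:
  fixes A :: "'a cstruct"
  shows "finite ((\<lambda>a. charfm d A q n (f a)) ` X)"
  by (rule finite_subset[OF _ finite_charfm[where 'a = 'a and d = d and q = q and n = n]]) auto

lemma charfm_props:
  "qr (charfm d A q n v) \<le> q \<and> fv (charfm d A q n v) \<subseteq> {..<n}
     \<and> colors_in (charfm d A q n v) \<subseteq> {..<d} \<and> sat A v (charfm d A q n v)"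
proof (induction q arbitrary: n v)
  case 0
  define U where "U = {\<phi> \<in> atoms d n. sat A v \<phi>} \<union> Neg ` {\<phi> \<in> atoms d n. \<not> sat A v \<phi>}"
  have fin: "finite U"
    by (simp add: U_def finite_atoms)
  have at: "qr \<alpha> \<le> 0 \<and> fv \<alpha> \<subseteq> {..<n} \<and> colors_in \<alpha> \<subseteq> {..<d}" if "\<alpha> \<in> atoms d n" for \<alpha>
    using that by (auto simp: atoms_def)
  have U: "qr \<alpha> \<le> 0 \<and> fv \<alpha> \<subseteq> {..<n} \<and> colors_in \<alpha> \<subseteq> {..<d} \<and> sat A v \<alpha>" if "\<alpha> \<in> U" for \<alpha>
    using that at unfolding U_def by (elim UnE CollectE imageE; simp; blast)
  have "qr (Conjs U) \<le> 0"
    using U by (subst qr_Conjs[OF fin]) blast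
  then show ?case
    using U unfolding charfm.simps U_def[symmetric] sat_Conjs[OF fin] fv_Conjs[OF fin] colors_in_Conjs[OF fin]
    by blast
next
  case (Suc q)
  note fin = finite_charfm_image[of d A q "Suc n" "\<lambda>a. v(n := a)" "dom_of A"]
  note IH = Suc.IH[of "Suc n"]
  have "fv (charfm d A q (Suc n) w) - {n} \<subseteq> {..<n}" for w
    using IH[of w] by (auto simp: less_Suc_eq)
  then show ?case
    using IH fin
    by (auto simp: Let_def sat_Conjs qr_Conjs fv_Conjs colors_in_Conjs
        sat_Disjs qr_Disjs fv_Disjs colors_in_Disjs simp del: fun_upd_apply; blast)
qed

lemma sat_charfm_imp:
  fixes A :: "'a cstruct" and B :: "'b cstruct"
  assumes "sat B w (charfm d A q n v)" "v ` {..<n} \<subseteq> dom_of A"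
    and "qr \<phi> \<le> q" "\<forall>x\<in>fv \<phi>. \<sigma> x < n" "colors_in \<phi> \<subseteq> {..<d}"
  shows "sat A (v \<circ> \<sigma>) \<phi> \<longleftrightarrow> sat B (w \<circ> \<sigma>) \<phi>"
  using assms
proof (induction q arbitrary: n v w \<phi> \<sigma>)
  case 0
  have at: "sat A v \<alpha> \<longleftrightarrow> sat B w \<alpha>" if "\<alpha> \<in> atoms d n" for \<alpha>
  proof -
    have fin: "finite ({\<phi> \<in> atoms d n. sat A v \<phi>} \<union> Neg ` {\<phi> \<in> atoms d n. \<not> sat A v \<phi>})"
      by (simp add: finite_atoms)
    show ?thesis
      using 0(1) that unfolding charfm.simps sat_Conjs[OF fin]
      by (cases "sat A v \<alpha>") (simp_all add: ball_Un)
  qed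
  show ?case
    using 0(3-)
  proof (induction \<phi>)
    case (Eq x y)
    then show ?case using at[of "Eq (\<sigma> x) (\<sigma> y)"] by (auto simp: atoms_def)
  next
    case (Less x y)
    then show ?case using at[of "Less (\<sigma> x) (\<sigma> y)"] by (auto simp: atoms_def)
  next
    case (Col i x)
    then show ?case using at[of "Col i (\<sigma> x)"] by (auto simp: atoms_def)
  qed auto
next
  case (Suc q)
  let ?c = "\<lambda>a. charfm d A q (Suc n) (v(n := a))"
  note fin = finite_charfm_image[of d A q "Suc n" "\<lambda>a. v(n := a)" "dom_of A"]
  have forth: "\<exists>b\<in>dom_of B. sat B (w(n := b)) (?c a)" if "a \<in> dom_of A" for a
    using Suc.prems(1) that fin by (auto simp: Let_def sat_Conjs)
  have backw: "\<exists>a\<in>dom_of A. sat B (w(n := b)) (?c a)" if "b \<in> dom_of B" for b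
    using Suc.prems(1) that fin by (auto simp: Let_def sat_Disjs)
  have step: "sat A (v(n := a) \<circ> \<tau>) \<psi> \<longleftrightarrow> sat B (w(n := b) \<circ> \<tau>) \<psi>"
    if "sat B (w(n := b)) (?c a)" "a \<in> dom_of A" "qr \<psi> \<le> q" "\<forall>x\<in>fv \<psi>. \<tau> x < Suc n"
      "colors_in \<psi> \<subseteq> {..<d}" for a b \<psi> \<tau>
    by (rule Suc.IH[OF that(1)]) (use that Suc.prems(2) in \<open>auto simp: less_Suc_eq\<close>)
  have low: "sat A (v \<circ> \<sigma>) \<psi> \<longleftrightarrow> sat B (w \<circ> \<sigma>) \<psi>"
    if \<psi>: "qr \<psi> \<le> q" "\<forall>x\<in>fv \<psi>. \<sigma> x < n" "fv \<psi> \<noteq> {}" "colors_in \<psi> \<subseteq> {..<d}" for \<psi>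
  proof -
    obtain x where "x \<in> fv \<psi>"
      using \<psi>(3) by blast
    then have "0 < n"
      using \<psi>(2) by fastforce
    then have "v 0 \<in> dom_of A"
      using Suc.prems(2) by blast
    then obtain b where "sat B (w(n := b)) (?c (v 0))"
      using forth by blast
    from step[OF this \<open>v 0 \<in> dom_of A\<close> \<psi>(1) _ \<psi>(4), of \<sigma>]
    have "sat A (v(n := v 0) \<circ> \<sigma>) \<psi> \<longleftrightarrow> sat B (w(n := b) \<circ> \<sigma>) \<psi>"
      using \<psi>(2) less_SucI by blast
    moreover have "sat A (v(n := v 0) \<circ> \<sigma>) \<psi> \<longleftrightarrow> sat A (v \<circ> \<sigma>) \<psi>"
      by (rule sat_cong) (use \<psi>(2) in force)
    moreover have "sat B (w(n := b) \<circ> \<sigma>) \<psi> \<longleftrightarrow> sat B (w \<circ> \<sigma>) \<psi>"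
      by (rule sat_cong) (use \<psi>(2) in force)
    ultimately show ?thesis by blast
  qed
  show ?case
    using Suc.prems(3-)
  proof (induction \<phi>)
    case (Eq x y)
    show ?case by (rule low) (use Eq in auto)
  next
    case (Less x y)
    show ?case by (rule low) (use Less in auto)
  next
    case (Col i x)
    show ?case by (rule low) (use Col in auto)
  next
    case (Ex x \<psi>)
    have eq: "sat A ((v \<circ> \<sigma>)(x := a)) \<psi> \<longleftrightarrow> sat B ((w \<circ> \<sigma>)(x := b)) \<psi>"
      if "sat B (w(n := b)) (?c a)" "a \<in> dom_of A" for a b
    proof -
      have "sat A (v(n := a) \<circ> \<sigma>(x := n)) \<psi> \<longleftrightarrow> sat B (w(n := b) \<circ> \<sigma>(x := n)) \<psi>"
        by (rule step[OF that]) (use Ex.prems in \<open>auto simp: less_Suc_eq\<close>)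
      moreover have "sat A (v(n := a) \<circ> \<sigma>(x := n)) \<psi> \<longleftrightarrow> sat A ((v \<circ> \<sigma>)(x := a)) \<psi>"
        by (rule sat_cong) (use Ex.prems(2) in force)
      moreover have "sat B (w(n := b) \<circ> \<sigma>(x := n)) \<psi> \<longleftrightarrow> sat B ((w \<circ> \<sigma>)(x := b)) \<psi>"
        by (rule sat_cong) (use Ex.prems(2) in force)
      ultimately show ?thesis by blast
    qed
    show ?case
      unfolding sat.simps using eq forth backw by blast
  qed auto
qed

lemma charfm_eqI:
  fixes A :: "'a cstruct" and B :: "'b cstruct"
  assumes "\<And>\<phi>. \<lbrakk>qr \<phi> \<le> q; fv \<phi> \<subseteq> {..<n}; colors_in \<phi> \<subseteq> {..<d}\<rbrakk> \<Longrightarrow> sat A v \<phi> \<longleftrightarrow> sat B w \<phi>"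
    and "v ` {..<n} \<subseteq> dom_of A" "w ` {..<n} \<subseteq> dom_of B"
  shows "charfm d A q n v = charfm d B q n w"
  using assms
proof (induction q arbitrary: n v w)
  case 0
  have "sat A v \<alpha> \<longleftrightarrow> sat B w \<alpha>" if "\<alpha> \<in> atoms d n" for \<alpha>
    by (rule 0(1)) (use that in \<open>auto simp: atoms_def\<close>)
  then have "{\<phi> \<in> atoms d n. sat A v \<phi>} = {\<phi> \<in> atoms d n. sat B w \<phi>}"
    "{\<phi> \<in> atoms d n. \<not> sat A v \<phi>} = {\<phi> \<in> atoms d n. \<not> sat B w \<phi>}"
    by auto
  then show ?case by simp
next
  case (Suc q)
  let ?cA = "\<lambda>a. charfm d A q (Suc n) (v(n := a))"
  let ?cB = "\<lambda>b. charfm d B q (Suc n) (w(n := b))"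
  have fvs: "fv \<phi> - {n} \<subseteq> {..<n}" if "fv \<phi> \<subseteq> {..<Suc n}" for \<phi>
    using that by (auto simp: less_Suc_eq)
  have ext: "sat A v (Ex n \<phi>) \<longleftrightarrow> sat B w (Ex n \<phi>)"
    if "qr \<phi> \<le> q" "fv \<phi> \<subseteq> {..<Suc n}" "colors_in \<phi> \<subseteq> {..<d}" for \<phi>
    by (rule Suc.prems(1)) (use that fvs in simp_all)
  have dA: "(v(n := a)) ` {..<Suc n} \<subseteq> dom_of A" if "a \<in> dom_of A" for a
    using that Suc.prems(2) by (auto simp: less_Suc_eq)
  have dB: "(w(n := b)) ` {..<Suc n} \<subseteq> dom_of B" if "b \<in> dom_of B" for b
    using that Suc.prems(3) by (auto simp: less_Suc_eq)
  have 1: "\<exists>b\<in>dom_of B. ?cA a = ?cB b" if a: "a \<in> dom_of A" for a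
  proof -
    have "sat A v (Ex n (?cA a))"
      using a charfm_props[of d A q "Suc n" "v(n := a)"] by auto
    then obtain b where b: "b \<in> dom_of B" and c: "sat B (w(n := b)) (?cA a)"
      using ext[of "?cA a"] charfm_props[of d A q "Suc n" "v(n := a)"] by auto
    have "?cA a = ?cB b"
      by (rule Suc.IH[OF _ dA[OF a] dB[OF b]])
        (use sat_charfm_imp[OF c dA[OF a], where \<sigma> = id] in \<open>auto simp del: fun_upd_apply\<close>)
    with b show ?thesis by blast
  qed
  have 2: "\<exists>a\<in>dom_of A. ?cA a = ?cB b" if b: "b \<in> dom_of B" for b
  proof -
    have "sat B w (Ex n (?cB b))"
      using b charfm_props[of d B q "Suc n" "w(n := b)"] by auto
    then obtain a where a: "a \<in> dom_of A" and c: "sat A (v(n := a)) (?cB b)"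
      using ext[of "?cB b"] charfm_props[of d B q "Suc n" "w(n := b)"] by auto
    have "?cA a = ?cB b"
      by (rule Suc.IH[OF _ dA[OF a] dB[OF b]])
        (use sat_charfm_imp[OF c dB[OF b], where \<sigma> = id] in \<open>auto simp del: fun_upd_apply\<close>)
    with a show ?thesis by blast
  qed
  have "?cA ` dom_of A = ?cB ` dom_of B"
  proof (intro subset_antisym image_subsetI)
    show "?cA a \<in> ?cB ` dom_of B" if "a \<in> dom_of A" for a
      using 1[OF that] by blast
    show "?cB b \<in> ?cA ` dom_of A" if "b \<in> dom_of B" for b
      using 2[OF that] by (auto simp del: fun_upd_apply simp: image_iff) (metis (full_types))
  qed
  then show ?case by simp
qed

theorem charsent_eq_iff:
  fixes A :: "'a cstruct" and B :: "'b cstruct"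
  shows "charsent d q A = charsent d q B \<longleftrightarrow> equiv_q d q A B"
proof
  let ?u = "\<lambda>_. undefined"
  assume eq: "charsent d q A = charsent d q B"
  have "sat B ?u (charfm d A q 0 ?u)"
    using eq charfm_props[of d B q 0 ?u] by (simp add: charsent_def)
  from sat_charfm_imp[OF this, where \<sigma> = id]
  have "sat A ?u \<phi> \<longleftrightarrow> sat B ?u \<phi>" if "sentence d \<phi>" "qr \<phi> \<le> q" for \<phi>
    using that by (auto simp: sentence_def comp_def)
  then show "equiv_q d q A B"
    using models_sentence by (metis (no_types, lifting) equiv_q_def sentence_def)
next
  assume "equiv_q d q A B"
  then show "charsent d q A = charsent d q B"
    unfolding charsent_def
    by (intro charfm_eqI) (auto simp: equiv_q_def sentence_def simp flip: models_sentence)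
qed


section \<open>Characters and minimality\<close>

definition qchar :: "nat \<Rightarrow> nat \<Rightarrow> 'a cstruct \<Rightarrow> 'a \<Rightarrow> nat \<times> fm \<times> fm" where
  "qchar d q A a =
     (color_of d A a,
      charsent d q (substr A (underS (le A) a)),
      charsent d q (substr A (aboveS (le A) a)))"

definition qchars :: "nat \<Rightarrow> nat \<Rightarrow> 'a cstruct \<Rightarrow> (nat \<times> fm \<times> fm) set" where
  "qchars d q A = qchar d q A ` dom_of A"

lemma finite_qchars:
  fixes A :: "'a cstruct"
  assumes "colored_ordinal d A"
  shows "finite (qchars d q A)"
proof (rule finite_subset)
  let ?F = "{charfm d A q 0 v | (A :: 'a cstruct) v. True}"
  show "finite ({..<d} \<times> ?F \<times> ?F)"
    by (intro finite_cartesian_product finite_charfm finite_lessThan)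
  have "color_of d A a < d" if a: "a \<in> dom_of A" for a
  proof -
    obtain i where i: "i < d" "a \<in> clr A i"
      using assms a unfolding colored_ordinal_def by blast
    have "j = i" if "j < d \<and> a \<in> clr A j" for j
    proof (rule ccontr)
      assume "j \<noteq> i"
      then have "clr A j \<inter> clr A i = {}"
        using assms i that by (simp add: colored_ordinal_def disjoint_family_on_def)
      with i that show False by blast
    qed
    then have "color_of d A a = i"
      unfolding color_of_def using i by (intro the_equality conjI)
    with i show ?thesis by simp
  qed
  note col = this
  show "qchars d q A \<subseteq> {..<d} \<times> ?F \<times> ?F"
    unfolding qchars_def
  proof (intro image_subsetI)
    fix a assume "a \<in> dom_of A"
    moreover have "charsent d q (B :: 'a cstruct) \<in> ?F" for B
      unfolding charsent_def by (rule CollectI, intro exI, rule conjI[OF refl TrueI])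
    ultimately show "qchar d q A a \<in> {..<d} \<times> ?F \<times> ?F"
      using col unfolding qchar_def by (intro SigmaI) simp_all
  qed
qed

text \<open>
  Competitors range over structures on the same type only; by \<open>least_otp_le\<close> below
  this is no restriction, since an ordinal shorter than \<open>A\<close> embeds into the type of \<open>A\<close>.
\<close>

definition least_otp :: "nat \<Rightarrow> nat \<Rightarrow> 'a cstruct \<Rightarrow> bool" where
  "least_otp d q A \<longleftrightarrow> colored_ordinal d A \<and>
     (\<forall>B :: 'a cstruct. colored_ordinal d B \<and> equiv_q d q A B \<longrightarrow> le A \<le>o le B)"

lemma sat_image:
  fixes B :: "'b cstruct" and f :: "'b \<Rightarrow> 'a"
  assumes "inj_on f (dom_of B)" "\<forall>i<d. clr B i \<subseteq> dom_of B"
    and "v ` fv \<phi> \<subseteq> dom_of B" "colors_in \<phi> \<subseteq> {..<d}"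
  shows "sat \<lparr>le = dir_image (le B) f, clr = (\<lambda>i. f ` clr B i)\<rparr> (f \<circ> v) \<phi> \<longleftrightarrow> sat B v \<phi>"
  using assms(3,4)
proof (induction \<phi> arbitrary: v)
  case (Eq x y)
  then show ?case using assms(1) by (auto simp: inj_on_eq_iff)
next
  case (Less x y)
  then have "(f (v x), f (v y)) \<in> dir_image (le B) f \<longleftrightarrow> (v x, v y) \<in> le B"
    using assms(1) by (auto simp: dir_image_def inj_on_eq_iff FieldI1 FieldI2)
  then show ?case using Less assms(1) by (auto simp: inj_on_eq_iff)
next
  case (Col i x)
  then show ?case using assms(1,2) by (auto simp: inj_on_image_mem_iff)
next
  case (Ex x \<phi>)
  let ?C = "\<lparr>le = dir_image (le B) f, clr = (\<lambda>i. f ` clr B i)\<rparr>"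
  have "sat ?C ((f \<circ> v)(x := f b)) \<phi> \<longleftrightarrow> sat B (v(x := b)) \<phi>" if "b \<in> dom_of B" for b
  proof -
    have "(f \<circ> v)(x := f b) = f \<circ> v(x := b)" by auto
    moreover have "(v(x := b)) ` fv \<phi> \<subseteq> dom_of B"
      using Ex.prems(1) that by auto
    ultimately show ?thesis
      using Ex.IH[of "v(x := b)"] Ex.prems(2) by (simp add: comp_def del: fun_upd_apply)
  qed
  then show ?case
    by (simp only: sat.simps cstruct.select_convs dir_image_Field bex_simps cong: bex_cong)
qed auto

lemma least_otp_le:
  fixes A :: "'a cstruct" and B :: "'b cstruct"
  assumes A: "least_otp d q A" and B: "colored_ordinal d B" "equiv_q d q A B"
  shows "le A \<le>o le B"
proof (rule ccontr)
  assume "\<not> le A \<le>o le B"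
  moreover have wo: "Well_order (le A)" "Well_order (le B)"
    using A B by (auto simp: least_otp_def colored_ordinal_def)
  ultimately have less: "le B <o le A"
    using ordLess_or_ordLeq by blast
  then obtain f where "embed (le B) (le A) f"
    by (auto simp: ordLess_def embedS_def)
  then have inj: "inj_on f (dom_of B)"
    using embed_inj_on wo(2) by blast
  define C where "C = \<lparr>le = dir_image (le B) f, clr = (\<lambda>i. f ` clr B i)\<rparr>"
  have sub: "\<forall>i<d. clr B i \<subseteq> dom_of B"
    using B(1) by (auto simp: colored_ordinal_def)
  have iso: "le B =o le C"
    using dir_image_ordIso[OF wo(2) inj] by (simp add: C_def)
  have "colored_ordinal d C"
    unfolding colored_ordinal_def
  proof (intro conjI)
    show "Well_order (le C)"
      using iso by (simp add: ordIso_def)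
    show "disjoint_family_on (clr C) {..<d}"
      unfolding disjoint_family_on_def
    proof (intro ballI impI)
      fix i j assume ij: "i \<in> {..<d}" "j \<in> {..<d}" "i \<noteq> j"
      have "f ` clr B i \<inter> f ` clr B j = f ` (clr B i \<inter> clr B j)"
        using inj_on_image_Int[OF inj] sub ij by simp
      also have "\<dots> = {}"
        using B(1) ij by (simp add: colored_ordinal_def disjoint_family_on_def)
      finally show "clr C i \<inter> clr C j = {}"
        by (simp add: C_def)
    qed
    show "(\<Union>i<d. clr C i) = dom_of C"
      using B(1) by (simp add: colored_ordinal_def C_def dir_image_Field flip: image_UN)
  qed
  moreover have "models C \<phi> \<longleftrightarrow> models B \<phi>" if "sentence d \<phi>" for \<phi>
    using sat_image[OF inj sub, of "\<lambda>_. undefined" \<phi>] that models_sentence[of \<phi> C "f \<circ> (\<lambda>_. undefined)"]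
      models_sentence[of \<phi> B "\<lambda>_. undefined"]
    by (simp add: C_def sentence_def)
  then have "equiv_q d q A C"
    using B(2) by (simp add: equiv_q_def)
  ultimately have "le A \<le>o le C"
    using A by (simp add: least_otp_def)
  then have "le A \<le>o le B"
    using iso ordIso_symmetric ordLeq_ordIso_trans by blast
  with less show False
    using not_ordLess_ordLeq by blast
qed


section \<open>Finite powers of omega\<close>

text \<open>
  Lists of length \<open>n\<close> ordered lexicographically, most significant entry first: the list
  \<open>[c\<^sub>1, \<dots>, c\<^sub>n]\<close> stands for the ordinal \<open>\<omega>\<^bsup>n - 1\<^esup> c\<^sub>1 + \<dots> + \<omega> c\<^bsub>n - 1\<^esub> + c\<^sub>n\<close> in Cantor normal form.
\<close>

definition omega_pow :: "nat \<Rightarrow> nat list rel" where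
  "omega_pow n = {(xs, ys). length xs = n \<and> length ys = n \<and> (xs = ys \<or> (xs, ys) \<in> lexn less_than n)}"

lemma Field_omega_pow: "Field (omega_pow n) = {xs. length xs = n}"
  by (auto simp: omega_pow_def Field_def)

lemma Well_order_omega_pow: "Well_order (omega_pow n)"
proof -
  have wf: "wf (lexn less_than n)"
    by (rule wf_lexn) simp
  have tr: "trans (lexn less_than n)"
    by (rule lexn_transI) simp
  have irr: "(xs, xs) \<notin> lexn less_than n" for xs
    using wf by (meson wf_not_refl)
  have tot: "(xs, ys) \<in> lexn less_than n \<or> (ys, xs) \<in> lexn less_than n"
    if "length xs = n" "length ys = n" "xs \<noteq> ys" for xs ys
    using that
  proof (induction n arbitrary: xs ys)
    case (Suc n)
    then obtain x xs' y ys' where "xs = x # xs'" "ys = y # ys'" "length xs' = n" "length ys' = n"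
      by (metis length_Suc_conv)
    then show ?case
      using Suc.IH[of xs' ys'] Suc.prems(3) by (auto simp: image_iff Bex_def)
  qed simp
  have "omega_pow n - Id = lexn less_than n"
    using irr by (auto simp: omega_pow_def dest: lexn_length)
  then have "wf (omega_pow n - Id)"
    using wf by simp
  moreover have "refl_on (Field (omega_pow n)) (omega_pow n)"
    by (auto simp: Field_omega_pow refl_on_def) (auto simp: omega_pow_def)
  moreover have "trans (omega_pow n)"
    using tr by (auto simp: omega_pow_def trans_def)
  moreover have "antisym (omega_pow n)"
    using tr irr by (auto simp: omega_pow_def antisym_def dest: transD)
  moreover have "total_on (Field (omega_pow n)) (omega_pow n)"
    using tot by (auto simp: Field_omega_pow total_on_def) (auto simp: omega_pow_def)
  moreover have "omega_pow n \<subseteq> Field (omega_pow n) \<times> Field (omega_pow n)"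
    by (auto simp: Field_def)
  ultimately show ?thesis
    unfolding well_order_on_def linear_order_on_def partial_order_on_def preorder_on_def by blast
qed

end

theory Submission
  imports Defs
begin

text \<open>
  \<open>S \<equiv>\<^sub>q T\<close> holds iff \<open>S\<close> and \<open>T\<close> realize the same \<open>(q - 1)\<close>-characters, because a move of the
  Ehrenfeucht-Fraisse game on a linear order splits it into two independent games. So it is enough to
  find a subset \<open>B\<close> of \<open>A\<close> of small order type whose points keep, within \<open>B\<close>, the \<open>(q - 1)\<close>-characters
  they have in \<open>A\<close>, and which realizes all of these.

  Such a \<open>B\<close> can be chosen such that no point is a limit of points of its own character. Indeed, if \<open>z\<close>
  is such a limit, then for suitable \<open>x < z\<close> of the same character, cutting out \<open>[x, z)\<close> changes no
  character and preserves all intervals \<open>(y, z)\<close> with \<open>y < x\<close> up to \<open>\<equiv>\<^bsub>q-2\<^esub>\<close>. The other limits are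
  approached by an \<open>\<omega>\<close>-sequence of blocks, each of which contains witnesses for all
  \<open>(q - 2)\<close>-characters seen from its left end. In \<open>B\<close>, a point at position \<open>\<omega>\<^sup>m\<close> lies on top of a
  descending chain of limit points of ranks \<open>m, m - 1, \<dots>, 0\<close> with pairwise distinct characters. The
  first \<open>2\<^bsup>q-1\<^esup> - 1\<close> points have further characters, which occur only once, so \<open>m + 1 \<le> k - (2\<^bsup>q-1\<^esup> - 1)\<close>.
\<close>

section \<open>Splitting equivalence of subsets of a colored well-order\<close>

text \<open>The obstacle is the rank. Points of \<open>B\<close> must keep left and right types of
  rank \<open>q - 1\<close>, but cutting out \<open>[x, z)\<close> preserves \<open>(y, z)\<close>
  only up to rank \<open>q - 2\<close>: equal characters of \<open>x\<close> and \<open>z\<close>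
  compare whole initial segments, and splitting these at a point spends a round. So rank
  \<open>q - 2\<close> is carried for an interval alone, and rank \<open>q - 1\<close> for the
  interval together with everything on one side of it, which is what characters are made of. Once a
  point outside the interval has been played, rank \<open>q - 2\<close> inside is enough.

  The blocks need not be cofinal below the limit: an increasing sequence whose blocks contain enough
  witnesses already has the rank \<open>q - 2\<close> type of the whole interval. Hence limits of
  uncountable cofinality need no separate treatment.

  The constant comes from halving: a move leaves two parts, each played with one round less, so rank
  \<open>r\<close> decides whether there are at least \<open>m\<close> points for every
  \<open>m < 2 ^ r\<close>. A point with fewer than \<open>2 ^ (q - 1) - 1\<close> predecessors
  therefore shares its character with no other point.\<close>

context wellorder
begin

text \<open>The Ehrenfeucht-Fraisse game in split form. Rank 0 demands nothing because no point has
  been named whose atomic relations could differ. Subsets of one fixed order stand for structures,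
  so that cuts and sums become intersections and unions.\<close>

primrec eqv :: "('a \<Rightarrow> nat) \<Rightarrow> nat \<Rightarrow> 'a set \<Rightarrow> 'a set \<Rightarrow> bool" where
  "eqv c 0 S T \<longleftrightarrow> True"
| "eqv c (Suc r) S T \<longleftrightarrow>
     (\<forall>s\<in>S. \<exists>t\<in>T. c s = c t \<and> eqv c r (S \<inter> {..<s}) (T \<inter> {..<t}) \<and> eqv c r (S \<inter> {s<..}) (T \<inter> {t<..})) \<and>
     (\<forall>t\<in>T. \<exists>s\<in>S. c s = c t \<and> eqv c r (S \<inter> {..<s}) (T \<inter> {..<t}) \<and> eqv c r (S \<inter> {s<..}) (T \<inter> {t<..}))"

lemma eqv_refl [simp, intro!]: "eqv c r S S"
  by (induction r arbitrary: S) auto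

lemma eqv_sym: "eqv c r S T \<Longrightarrow> eqv c r T S"
proof (induction r arbitrary: S T)
  case (Suc r)
  from Suc.prems show ?case
    unfolding eqv.simps(2) by (metis Suc.IH)
qed simp

lemma eqv_trans [trans]: "eqv c r S T \<Longrightarrow> eqv c r T U \<Longrightarrow> eqv c r S U"
proof (induction r arbitrary: S T U)
  case (Suc r)
  have 1: "\<exists>u\<in>U. c s = c u \<and> eqv c r (S \<inter> {..<s}) (U \<inter> {..<u}) \<and> eqv c r (S \<inter> {s<..}) (U \<inter> {u<..})"
    if s: "s \<in> S" for s
  proof -
    obtain t where t: "t \<in> T" "c s = c t" "eqv c r (S \<inter> {..<s}) (T \<inter> {..<t})" "eqv c r (S \<inter> {s<..}) (T \<inter> {t<..})"
      using Suc.prems(1) s unfolding eqv.simps(2) by blast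
    obtain u where u: "u \<in> U" "c t = c u" "eqv c r (T \<inter> {..<t}) (U \<inter> {..<u})" "eqv c r (T \<inter> {t<..}) (U \<inter> {u<..})"
      using Suc.prems(2) t(1) unfolding eqv.simps(2) by blast
    show ?thesis
      using t u Suc.IH by metis
  qed
  have 2: "\<exists>s\<in>S. c s = c u \<and> eqv c r (S \<inter> {..<s}) (U \<inter> {..<u}) \<and> eqv c r (S \<inter> {s<..}) (U \<inter> {u<..})"
    if u: "u \<in> U" for u
  proof -
    obtain t where t: "t \<in> T" "c t = c u" "eqv c r (T \<inter> {..<t}) (U \<inter> {..<u})" "eqv c r (T \<inter> {t<..}) (U \<inter> {u<..})"
      using Suc.prems(2) u unfolding eqv.simps(2) by blast
    obtain s where s: "s \<in> S" "c s = c t" "eqv c r (S \<inter> {..<s}) (T \<inter> {..<t})" "eqv c r (S \<inter> {s<..}) (T \<inter> {t<..})"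
      using Suc.prems(1) t(1) unfolding eqv.simps(2) by blast
    show ?thesis
      using t s Suc.IH by metis
  qed
  show ?case
    unfolding eqv.simps(2) using 1 2 by blast
qed simp

lemma eqv_Suc_D: "eqv c (Suc r) S T \<Longrightarrow> eqv c r S T"
proof (induction r arbitrary: S T)
  case (Suc r)
  from Suc.prems show ?case
    unfolding eqv.simps(2)[of c "Suc r"] eqv.simps(2)[of c r S T] by (metis Suc.IH)
qed simp

lemma eqv_mono: "eqv c r S T \<Longrightarrow> r' \<le> r \<Longrightarrow> eqv c r' S T"
  by (induction r) (auto simp: le_Suc_eq dest: eqv_Suc_D simp del: eqv.simps(2))

lemma eqv_forthE:
  assumes "eqv c (Suc r) S T" "s \<in> S"
  obtains t where "t \<in> T" "c s = c t" "eqv c r (S \<inter> {..<s}) (T \<inter> {..<t})" "eqv c r (S \<inter> {s<..}) (T \<inter> {t<..})"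
  using assms unfolding eqv.simps(2) by blast

lemma eqv_SucI:
  assumes "\<And>s. s \<in> S \<Longrightarrow> \<exists>t\<in>T. c s = c t \<and> eqv c r (S \<inter> {..<s}) (T \<inter> {..<t}) \<and> eqv c r (S \<inter> {s<..}) (T \<inter> {t<..})"
    and "\<And>t. t \<in> T \<Longrightarrow> \<exists>s\<in>S. c t = c s \<and> eqv c r (T \<inter> {..<t}) (S \<inter> {..<s}) \<and> eqv c r (T \<inter> {t<..}) (S \<inter> {s<..})"
  shows "eqv c (Suc r) S T"
  using assms unfolding eqv.simps(2) by (metis eqv_sym)

text \<open>A move is answered in the summand where it is made; the other summand is kept whole and
  merely gives up one round.\<close>

lemma eqv_Un:
  assumes "eqv c r S1 T1" "eqv c r S2 T2"
    and "\<And>x y. x \<in> S1 \<Longrightarrow> y \<in> S2 \<Longrightarrow> x < y" "\<And>x y. x \<in> T1 \<Longrightarrow> y \<in> T2 \<Longrightarrow> x < y"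
  shows "eqv c r (S1 \<union> S2) (T1 \<union> T2)"
  using assms
proof (induction r arbitrary: S1 S2 T1 T2)
  case (Suc r)
  have half: "\<exists>t\<in>T1 \<union> T2. c s = c t \<and> eqv c r ((S1 \<union> S2) \<inter> {..<s}) ((T1 \<union> T2) \<inter> {..<t}) \<and>
      eqv c r ((S1 \<union> S2) \<inter> {s<..}) ((T1 \<union> T2) \<inter> {t<..})"
    if s: "s \<in> S1 \<union> S2" and e1: "eqv c (Suc r) S1 T1" and e2: "eqv c (Suc r) S2 T2"
      and ls: "\<And>x y. x \<in> S1 \<Longrightarrow> y \<in> S2 \<Longrightarrow> x < y" and lt: "\<And>x y. x \<in> T1 \<Longrightarrow> y \<in> T2 \<Longrightarrow> x < y"
    for s S1 S2 T1 T2
  proof (cases "s \<in> S1")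
    case True
    from e1 True obtain t where t: "t \<in> T1" "c s = c t" "eqv c r (S1 \<inter> {..<s}) (T1 \<inter> {..<t})"
      "eqv c r (S1 \<inter> {s<..}) (T1 \<inter> {t<..})"
      by (rule eqv_forthE)
    have "(S1 \<union> S2) \<inter> {..<s} = S1 \<inter> {..<s}" "(S1 \<union> S2) \<inter> {s<..} = (S1 \<inter> {s<..}) \<union> S2"
      using ls[OF True] by (auto dest: less_asym)
    moreover have "(T1 \<union> T2) \<inter> {..<t} = T1 \<inter> {..<t}" "(T1 \<union> T2) \<inter> {t<..} = (T1 \<inter> {t<..}) \<union> T2"
      using lt[OF t(1)] by (auto dest: less_asym)
    moreover have "eqv c r ((S1 \<inter> {s<..}) \<union> S2) ((T1 \<inter> {t<..}) \<union> T2)"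
      by (rule Suc.IH) (use t(4) e2 ls lt eqv_Suc_D in blast)+
    ultimately show ?thesis
      using t by (intro bexI[of _ t]) simp_all
  next
    case False
    with s have sS: "s \<in> S2" by blast
    from e2 sS obtain t where t: "t \<in> T2" "c s = c t" "eqv c r (S2 \<inter> {..<s}) (T2 \<inter> {..<t})"
      "eqv c r (S2 \<inter> {s<..}) (T2 \<inter> {t<..})"
      by (rule eqv_forthE)
    have "(S1 \<union> S2) \<inter> {..<s} = S1 \<union> (S2 \<inter> {..<s})" "(S1 \<union> S2) \<inter> {s<..} = S2 \<inter> {s<..}"
      using ls[OF _ sS] by (auto dest: less_asym)
    moreover have "(T1 \<union> T2) \<inter> {..<t} = T1 \<union> (T2 \<inter> {..<t})" "(T1 \<union> T2) \<inter> {t<..} = T2 \<inter> {t<..}"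
      using lt[OF _ t(1)] by (auto dest: less_asym)
    moreover have "eqv c r (S1 \<union> (S2 \<inter> {..<s})) (T1 \<union> (T2 \<inter> {..<t}))"
      by (rule Suc.IH) (use t(3) e1 ls lt eqv_Suc_D in blast)+
    ultimately show ?thesis
      using t by (intro bexI[of _ t]) simp_all
  qed
  show ?case
  proof (rule eqv_SucI)
    fix s assume "s \<in> S1 \<union> S2"
    then show "\<exists>t\<in>T1 \<union> T2. c s = c t \<and> eqv c r ((S1 \<union> S2) \<inter> {..<s}) ((T1 \<union> T2) \<inter> {..<t}) \<and>
      eqv c r ((S1 \<union> S2) \<inter> {s<..}) ((T1 \<union> T2) \<inter> {t<..})"
      using Suc.prems by (intro half) blast+
  next
    fix s assume "s \<in> T1 \<union> T2"
    then show "\<exists>t\<in>S1 \<union> S2. c s = c t \<and> eqv c r ((T1 \<union> T2) \<inter> {..<s}) ((S1 \<union> S2) \<inter> {..<t}) \<and>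
      eqv c r ((T1 \<union> T2) \<inter> {s<..}) ((S1 \<union> S2) \<inter> {t<..})"
      using Suc.prems eqv_sym by (intro half) blast+
  qed
qed simp

lemma eqv_singleton: "c a = c b \<Longrightarrow> eqv c r {a} {b}"
proof (cases r)
  case (Suc r')
  assume "c a = c b"
  moreover have "{a} \<inter> {..<a} = {}" "{a} \<inter> {a<..} = {}" "{b} \<inter> {..<b} = {}" "{b} \<inter> {b<..} = {}"
    by auto
  ultimately show ?thesis
    unfolding Suc by simp
qed simp

declare eqv.simps(2) [simp del]

section \<open>Finiteness of the number of types and counting by halving\<close>

definition eqv_class :: "('a \<Rightarrow> nat) \<Rightarrow> nat \<Rightarrow> 'a set \<Rightarrow> 'a set set" where
  "eqv_class c r S = {T. eqv c r S T}"

lemma eqv_class_eq_iff: "eqv_class c r S = eqv_class c r T \<longleftrightarrow> eqv c r S T"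
  unfolding eqv_class_def by (metis (no_types, lifting) Collect_cong eqv_refl eqv_sym eqv_trans mem_Collect_eq)

text \<open>The class at rank \<open>Suc r\<close> is determined by the set \<open>ch S\<close> of
  triples (color, left class, right class) that occur, and finitely many triples have only finitely
  many subsets.\<close>

lemma finite_range_eqv_class:
  assumes "finite (range c)"
  shows "finite (range (eqv_class c r))"
proof (induction r)
  case 0
  have "range (eqv_class c 0) \<subseteq> {UNIV}"
    by (auto simp: eqv_class_def)
  then show ?case
    by (rule finite_subset) simp
next
  case (Suc r)
  define ch where "ch S = (\<lambda>s. (c s, eqv_class c r (S \<inter> {..<s}), eqv_class c r (S \<inter> {s<..}))) ` S" for S
  have eq: "eqv_class c (Suc r) S = eqv_class c (Suc r) T" if "ch S = ch T" for S T
  proof -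
    have half: "\<exists>t\<in>T. c s = c t \<and> eqv c r (S \<inter> {..<s}) (T \<inter> {..<t}) \<and> eqv c r (S \<inter> {s<..}) (T \<inter> {t<..})"
      if "ch S = ch T" "s \<in> S" for s S T
    proof -
      have "(c s, eqv_class c r (S \<inter> {..<s}), eqv_class c r (S \<inter> {s<..})) \<in> ch T"
        using that unfolding ch_def by blast
      then show ?thesis
        unfolding ch_def by (auto simp: eqv_class_eq_iff)
    qed
    show ?thesis
      unfolding eqv_class_eq_iff by (rule eqv_SucI) (rule half; use that in simp)+
  qed
  have "finite (range ch)"
  proof (rule finite_subset)
    show "range ch \<subseteq> Pow (range c \<times> range (eqv_class c r) \<times> range (eqv_class c r))"
      by (auto simp: ch_def)
    show "finite (Pow (range c \<times> range (eqv_class c r) \<times> range (eqv_class c r)))"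
      using assms Suc.IH by blast
  qed
  moreover have "range (eqv_class c (Suc r)) \<subseteq> (\<lambda>h. eqv_class c (Suc r) (SOME S. ch S = h)) ` range ch"
  proof (rule image_subsetI)
    fix S
    have "ch (SOME T. ch T = ch S) = ch S"
      by (rule someI[of _ S]) simp
    then have "eqv_class c (Suc r) S = eqv_class c (Suc r) (SOME T. ch T = ch S)"
      using eq by metis
    then show "eqv_class c (Suc r) S \<in> (\<lambda>h. eqv_class c (Suc r) (SOME S. ch S = h)) ` range ch"
      by blast
  qed
  ultimately show ?case
    using finite_surj by blast
qed

text \<open>Applied with \<open>f\<close> the character of a point: finitely many points then
  provide an answer to every move.\<close>

lemma finite_witnesses:
  assumes "finite (f ` S)"
  obtains W where "finite W" "W \<subseteq> S" "\<And>u. u \<in> S \<Longrightarrow> \<exists>w\<in>W. f w = f u"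
proof -
  obtain W where "W \<subseteq> S" "finite W" "f ` S = f ` W"
    using finite_subset_image[OF assms, of f S] by blast
  then show thesis
    by (intro that[of W]) (auto, metis image_iff)
qed

text \<open>Halving: a middle point of \<open>F\<close> is played, and both halves are small enough
  for the remaining \<open>r\<close> rounds. The thresholds \<open>2 ^ (q - 1) - 1\<close> of the
  theorem originate here.\<close>

lemma eqv_card_ge:
  assumes "eqv c r S T" "m < 2 ^ r" "F \<subseteq> T" "finite F" "card F = m"
  shows "\<exists>E\<subseteq>S. finite E \<and> card E = m"
  using assms
proof (induction r arbitrary: S T m F)
  case (Suc r)
  show ?case
  proof (cases m)
    case (Suc m')
    \<comment> \<open>\<open>m'\<close> points remain besides the middle one. From
      \<open>m' \<le> 2 ^ Suc r - 2\<close>, both the rounded-down half \<open>a\<close> and the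
      rounded-up half \<open>b\<close> are at most \<open>2 ^ r - 1\<close>.\<close>
    define a where "a = m' div 2"
    define b where "b = m' - a"
    have ab: "a < 2 ^ r" "b < 2 ^ r" "a + b = m'"
      using Suc.prems(2) unfolding a_def b_def Suc by auto
    have pos: "\<exists>t\<in>F. card (F \<inter> {..<t}) = a" if "finite F" "a < card F" for F a
      using that
    proof (induction "card F" arbitrary: F)
      case (Suc k)
      have ne: "F \<noteq> {}" using Suc.hyps(2) by auto
      let ?m = "Max F"
      have m: "?m \<in> F" using Max_in Suc.prems(1) ne by blast
      have le: "\<And>x. x \<in> F \<Longrightarrow> x \<le> ?m" using Suc.prems(1) by simp
      have c: "card (F - {?m}) = k" using m Suc.hyps(2) Suc.prems(1) by simp
      show ?case
      proof (cases "a = k")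
        case True
        have "F \<inter> {..<?m} = F - {?m}" using le by (auto simp: less_le)
        then show ?thesis using c True m by metis
      next
        case False
        then have "a < card (F - {?m})" using Suc.prems(2) Suc.hyps(2) c by linarith
        then obtain t where t: "t \<in> F - {?m}" "card ((F - {?m}) \<inter> {..<t}) = a"
          using Suc.hyps(1)[of "F - {?m}"] c Suc.prems(1) by auto
        have "(F - {?m}) \<inter> {..<t} = F \<inter> {..<t}" using le[of t] t(1) by (auto dest: leD)
        then show ?thesis using t by auto
      qed
    qed simp
    obtain t where t: "t \<in> F" "card (F \<inter> {..<t}) = a"
      using pos[OF Suc.prems(4), of a] Suc.prems(5) ab(3) Suc by auto
    have "F = insert t ((F \<inter> {..<t}) \<union> (F \<inter> {t<..}))"
      using t(1) by auto
    then have "card F = card (insert t ((F \<inter> {..<t}) \<union> (F \<inter> {t<..})))" by simp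
    also have "\<dots> = Suc (card (F \<inter> {..<t}) + card (F \<inter> {t<..}))"
    proof (subst card_insert_disjoint)
      show "Suc (card ((F \<inter> {..<t}) \<union> (F \<inter> {t<..}))) = Suc (card (F \<inter> {..<t}) + card (F \<inter> {t<..}))"
        by (subst card_Un_disjoint) (use Suc.prems(4) in \<open>auto dest: less_asym\<close>)
    qed (use Suc.prems(4) in auto)
    finally have cb: "card (F \<inter> {t<..}) = b"
      using t(2) Suc.prems(5) ab(3) Suc by simp
    obtain s where s: "s \<in> S" "eqv c r (S \<inter> {..<s}) (T \<inter> {..<t})" "eqv c r (S \<inter> {s<..}) (T \<inter> {t<..})"
      using Suc.prems(1,3) t(1) unfolding eqv.simps(2) by blast
    obtain E1 where E1: "E1 \<subseteq> S \<inter> {..<s}" "finite E1" "card E1 = a"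
      using Suc.IH[OF s(2) ab(1), of "F \<inter> {..<t}"] Suc.prems(3,4) t(2) by blast
    obtain E2 where E2: "E2 \<subseteq> S \<inter> {s<..}" "finite E2" "card E2 = b"
      using Suc.IH[OF s(3) ab(2), of "F \<inter> {t<..}"] Suc.prems(3,4) cb by blast
    have "E1 \<inter> {s<..} = {}"
      using E1(1) by (auto dest: less_asym)
    then have "E1 \<inter> E2 = {}"
      using E2(1) by blast
    have "card (insert s (E1 \<union> E2)) = Suc (card (E1 \<union> E2))"
      using E1 E2 by (intro card_insert_disjoint) auto
    also have "card (E1 \<union> E2) = a + b"
      using E1 E2 \<open>E1 \<inter> E2 = {}\<close> by (simp add: card_Un_disjoint)
    finally have "card (insert s (E1 \<union> E2)) = m"
      using ab(3) Suc by simp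
    then show ?thesis
      using E1 E2 s(1) by (intro exI[of _ "insert s (E1 \<union> E2)"]) auto
  qed auto
qed auto

section \<open>Gluing equivalences at a cut point\<close>

lemma eqv_Un_at:
  assumes "eqv c r A1 B1" "eqv c r A2 B2" "A = A1 \<union> A2" "B = B1 \<union> B2"
    and "A1 \<subseteq> {..a}" "A2 \<subseteq> {a<..}" "B1 \<subseteq> {..b}" "B2 \<subseteq> {b<..}"
  shows "eqv c r A B"
proof -
  have "x < y" if "x \<in> A1" "y \<in> A2" for x y
    using assms(5,6) that by (meson atMost_iff greaterThan_iff le_less_trans subsetD)
  moreover have "x < y" if "x \<in> B1" "y \<in> B2" for x y
    using assms(7,8) that by (meson atMost_iff greaterThan_iff le_less_trans subsetD)
  ultimately show ?thesis
    unfolding assms(3,4) using assms(1,2) eqv_Un by blast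
qed

lemma eqv_Un_before:
  assumes "eqv c r A1 B1" "eqv c r A2 B2" "A = A1 \<union> A2" "B = B1 \<union> B2"
    and "A1 \<subseteq> {..<a}" "A2 \<subseteq> {a..}" "B1 \<subseteq> {..<b}" "B2 \<subseteq> {b..}"
  shows "eqv c r A B"
proof -
  have "x < y" if "x \<in> A1" "y \<in> A2" for x y
    using assms(5,6) that by (meson lessThan_iff atLeast_iff less_le_trans subsetD)
  moreover have "x < y" if "x \<in> B1" "y \<in> B2" for x y
    using assms(7,8) that by (meson lessThan_iff atLeast_iff less_le_trans subsetD)
  ultimately show ?thesis
    unfolding assms(3,4) using assms(1,2) eqv_Un by blast
qed

lemma eqv_insert:
  assumes "eqv c r A1 B1" "eqv c r A2 B2" "c a = c b" "A = insert a (A1 \<union> A2)" "B = insert b (B1 \<union> B2)"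
    and "A1 \<subseteq> {..<a}" "A2 \<subseteq> {a<..}" "B1 \<subseteq> {..<b}" "B2 \<subseteq> {b<..}"
  shows "eqv c r A B"
proof (rule eqv_Un_before)
  show "eqv c r A1 B1" by (rule assms)
  show "eqv c r ({a} \<union> A2) ({b} \<union> B2)"
    by (rule eqv_Un_at[OF eqv_singleton[OF assms(3)] assms(2) refl refl _ assms(7) _ assms(9)]) auto
qed (use assms in auto)

lemma eqv_insert_eq:
  assumes "eqv c r A1 B1" "eqv c r A2 B2"
    and "A1 \<subseteq> {..<a}" "A2 \<subseteq> {a<..}" "B1 \<subseteq> {..<a}" "B2 \<subseteq> {a<..}"
  shows "eqv c r (insert a (A1 \<union> A2)) (insert a (B1 \<union> B2))"
  by (rule eqv_insert[OF assms(1,2) refl refl refl assms(3-)])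

section \<open>Removing limits of equal characters\<close>

text \<open>Here \<open>s\<close> stands for \<open>q - 2\<close>, so the characters have rank
  \<open>q - 1\<close>. Membership in \<open>D\<close> is part of the relation: an end point outside
  \<open>D\<close> shares its character with nothing.\<close>

definition same_char :: "('a \<Rightarrow> nat) \<Rightarrow> 'a set \<Rightarrow> nat \<Rightarrow> 'a \<Rightarrow> 'a \<Rightarrow> bool" where
  "same_char c D s x y \<longleftrightarrow> x \<in> D \<and> y \<in> D \<and> c x = c y \<and>
     eqv c (Suc s) (D \<inter> {..<x}) (D \<inter> {..<y}) \<and> eqv c (Suc s) (D \<inter> {x<..}) (D \<inter> {y<..})"

text \<open>This says that \<open>v\<close> is not a limit of points of \<open>V\<close> with its
  own character. Admitting \<open>y\<close> as the bound covers a \<open>v\<close> with no point of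
  \<open>V\<close> below it. Characters are taken in the fixed set \<open>D\<close>, not in
  \<open>V\<close>, so that reductions of different intervals can be combined.\<close>

definition reduced_at :: "('a \<Rightarrow> nat) \<Rightarrow> 'a set \<Rightarrow> nat \<Rightarrow> 'a \<Rightarrow> 'a set \<Rightarrow> 'a \<Rightarrow> bool" where
  "reduced_at c D s y V v \<longleftrightarrow> (\<exists>w\<in>insert y V. w < v \<and> (\<forall>x\<in>V. w < x \<longrightarrow> x < v \<longrightarrow> \<not> same_char c D s x v))"

text \<open>
  \<open>reduct c D s y z V\<close>: the interval \<open>(y, z)\<close> of \<open>D\<close> may be replaced by its subset \<open>V\<close>. The rank
  \<open>s = q - 2\<close> is kept inside the interval, whereas rank \<open>s + 1\<close> is only kept in the context of the
  points below \<open>y\<close> or above \<open>z\<close>. The points \<open>y\<close> and \<open>z\<close> need not belong to \<open>D\<close>.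
\<close>

definition reduct :: "('a \<Rightarrow> nat) \<Rightarrow> 'a set \<Rightarrow> nat \<Rightarrow> 'a \<Rightarrow> 'a \<Rightarrow> 'a set \<Rightarrow> bool" where
  "reduct c D s y z V \<longleftrightarrow> V \<subseteq> D \<inter> {y<..<z} \<and> eqv c s V (D \<inter> {y<..<z}) \<and>
     eqv c (Suc s) (D \<inter> {..y} \<union> V) (D \<inter> {..<z}) \<and>
     eqv c (Suc s) (V \<union> D \<inter> {z..}) (D \<inter> {y<..}) \<and>
     (\<forall>v\<in>V. eqv c (Suc s) (D \<inter> {..y} \<union> V \<inter> {..<v}) (D \<inter> {..<v}) \<and>
            eqv c (Suc s) (V \<inter> {v<..} \<union> D \<inter> {z..}) (D \<inter> {v<..})) \<and>
     (\<forall>v\<in>insert z V. reduced_at c D s y V v)"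

lemma same_char_sym: "same_char c D s x y \<Longrightarrow> same_char c D s y x"
  unfolding same_char_def using eqv_sym by metis

lemma same_char_trans: "same_char c D s x y \<Longrightarrow> same_char c D s y z \<Longrightarrow> same_char c D s x z"
  unfolding same_char_def using eqv_trans by metis

lemma reductD:
  assumes "reduct c D s y z V"
  shows "V \<subseteq> D \<inter> {y<..<z}" "eqv c s V (D \<inter> {y<..<z})"
    "eqv c (Suc s) (D \<inter> {..y} \<union> V) (D \<inter> {..<z})"
    "eqv c (Suc s) (V \<union> D \<inter> {z..}) (D \<inter> {y<..})"
    "v \<in> V \<Longrightarrow> eqv c (Suc s) (D \<inter> {..y} \<union> V \<inter> {..<v}) (D \<inter> {..<v})"
    "v \<in> V \<Longrightarrow> eqv c (Suc s) (V \<inter> {v<..} \<union> D \<inter> {z..}) (D \<inter> {v<..})"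
    "v \<in> insert z V \<Longrightarrow> reduced_at c D s y V v"
  using assms unfolding reduct_def by blast+

section \<open>Concatenation of reducts\<close>

lemma reduct_empty:
  assumes "y < z" "D \<inter> {y<..<z} = {}"
  shows "reduct c D s y z {}"
proof -
  have "D \<inter> {..y} = D \<inter> {..<z}" "D \<inter> {z..} = D \<inter> {y<..}"
    using assms by (auto intro: le_less_trans less_le_trans simp: not_le[symmetric])
  then show ?thesis
    unfolding reduct_def reduced_at_def using assms by auto
qed

text \<open>The halves are exchanged one after the other, each in the context left by the other; the
  context clauses of rank \<open>Suc s\<close> are made for this. Reducedness is local: a bound
  found for a point of the right half is at least \<open>x\<close>, so points of \<open>V0\<close>
  cannot interfere.\<close>

lemma reduct_comp:
  assumes 0: "reduct c D s y x V0" and x: "x \<in> D" and 1: "reduct c D s x z V1" and lt: "y < x" "x < z"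
  shows "reduct c D s y z (insert x (V0 \<union> V1))"
proof -
  note a = reductD[OF 0] and b = reductD[OF 1]
  let ?V = "insert x (V0 \<union> V1)"
  have V0: "V0 \<subseteq> {..<x}" "V0 \<subseteq> {y<..}" "V0 \<subseteq> D" and V1: "V1 \<subseteq> {x<..}" "V1 \<subseteq> {..<z}" "V1 \<subseteq> D"
    using a(1) b(1) by auto
  have d0: "u \<in> D \<and> y < u \<and> u < x \<and> u < z" if "u \<in> V0" for u
    using that V0 lt by (meson greaterThan_iff lessThan_iff less_trans subsetD)
  have d1: "u \<in> D \<and> y < u \<and> x < u \<and> u < z" if "u \<in> V1" for u
    using that V1 lt by (meson greaterThan_iff lessThan_iff less_trans subsetD)
  have sub: "?V \<subseteq> D \<inter> {y<..<z}"
    using x lt by (auto dest: d0 d1)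
  have D1: "D \<inter> {y<..<z} = insert x (D \<inter> {y<..<x} \<union> D \<inter> {x<..<z})"
    "D \<inter> {..<z} = insert x (D \<inter> {..<x} \<union> D \<inter> {x<..<z})"
    "D \<inter> {y<..} = insert x (D \<inter> {y<..<x} \<union> D \<inter> {x<..})"
    "D \<inter> {..x} = insert x (D \<inter> {..<x})" "D \<inter> {x..} = insert x (D \<inter> {x<..})"
    using x lt by auto
  have c1: "eqv c s ?V (D \<inter> {y<..<z})"
    unfolding D1 by (rule eqv_insert_eq[OF a(2) b(2)]) (use V0 V1 in auto)
  have "eqv c (Suc s) (insert x ((D \<inter> {..y} \<union> V0) \<union> V1)) (insert x (D \<inter> {..<x} \<union> V1))"
    by (rule eqv_insert_eq[OF a(3) eqv_refl]) (use V0 V1 lt in auto)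
  also have "insert x (D \<inter> {..<x} \<union> V1) = D \<inter> {..x} \<union> V1"
    unfolding D1 by auto
  also note b(3)
  finally have c2: "eqv c (Suc s) (D \<inter> {..y} \<union> ?V) (D \<inter> {..<z})"
    by (simp add: Un_assoc)
  have "eqv c (Suc s) (insert x (V0 \<union> (V1 \<union> D \<inter> {z..}))) (insert x (V0 \<union> (D \<inter> {x<..})))"
    by (rule eqv_insert_eq[OF eqv_refl b(4)]) (use V0 V1 lt in auto)
  also have "insert x (V0 \<union> (D \<inter> {x<..})) = V0 \<union> D \<inter> {x..}"
    unfolding D1 by auto
  also note a(4)
  finally have c3: "eqv c (Suc s) (?V \<union> D \<inter> {z..}) (D \<inter> {y<..})"
    by (simp add: Un_assoc)
  have c4: "eqv c (Suc s) (D \<inter> {..y} \<union> ?V \<inter> {..<v}) (D \<inter> {..<v}) \<and>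
        eqv c (Suc s) (?V \<inter> {v<..} \<union> D \<inter> {z..}) (D \<inter> {v<..}) \<and> reduced_at c D s y ?V v"
    if v: "v \<in> ?V" for v
  proof -
    consider "v \<in> V0" | "v = x" | "v \<in> V1" using v by blast
    then show ?thesis
    proof cases
      case 1
      then have vx: "v < x" using V0 by auto
      have "?V \<inter> {..<v} = V0 \<inter> {..<v}"
        using vx V1 by (auto dest: d0 d1)
      moreover have "?V \<inter> {v<..} = insert x (V0 \<inter> {v<..} \<union> V1)"
        using vx V1 by (auto dest: d0 d1)
      moreover have "eqv c (Suc s) (insert x (V0 \<inter> {v<..} \<union> V1) \<union> D \<inter> {z..}) (D \<inter> {v<..})"
      proof -
        have "eqv c (Suc s) (insert x (V0 \<inter> {v<..} \<union> (V1 \<union> D \<inter> {z..}))) (insert x (V0 \<inter> {v<..} \<union> (D \<inter> {x<..})))"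
          by (rule eqv_insert_eq[OF eqv_refl b(4)]) (use V0 V1 lt in auto)
        also have "insert x (V0 \<inter> {v<..} \<union> (D \<inter> {x<..})) = V0 \<inter> {v<..} \<union> D \<inter> {x..}"
          unfolding D1 by auto
        also note a(6)[OF 1]
        finally show ?thesis by (simp add: Un_assoc)
      qed
      moreover have "reduced_at c D s y ?V v"
      proof -
        obtain w where w: "w \<in> insert y V0" "w < v" "\<forall>u\<in>V0. w < u \<longrightarrow> u < v \<longrightarrow> \<not> same_char c D s u v"
          using a(7)[of v] 1 unfolding reduced_at_def by blast
        have "u \<in> V0" if "u \<in> ?V" "u < v" for u
          using that vx V1 by (auto dest: d0 d1)
        then show ?thesis
          unfolding reduced_at_def using w by blast
      qed
      ultimately show ?thesis
        using a(5)[OF 1] by simp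
    next
      case 2
      have "?V \<inter> {..<v} = V0" "?V \<inter> {v<..} = V1"
        using 2 V0 V1 by auto
      moreover have "reduced_at c D s y ?V v"
      proof -
        obtain w where w: "w \<in> insert y V0" "w < v" "\<forall>u\<in>V0. w < u \<longrightarrow> u < v \<longrightarrow> \<not> same_char c D s u v"
          using a(7)[of v] 2 unfolding reduced_at_def by blast
        have "u \<in> V0" if "u \<in> ?V" "u < v" for u
          using that 2 V1 by (auto dest: d0 d1)
        then show ?thesis
          unfolding reduced_at_def using w by blast
      qed
      ultimately show ?thesis
        using a(3) b(4) 2 by simp
    next
      case 3
      then have vx: "x < v" using V1 by auto
      have "?V \<inter> {v<..} = V1 \<inter> {v<..}"
        using vx V0 by (auto dest: d0 d1)
      moreover have "?V \<inter> {..<v} = insert x (V0 \<union> V1 \<inter> {..<v})"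
        using vx V0 by (auto dest: d0 d1)
      moreover have "eqv c (Suc s) (D \<inter> {..y} \<union> insert x (V0 \<union> V1 \<inter> {..<v})) (D \<inter> {..<v})"
      proof -
        have "eqv c (Suc s) (insert x ((D \<inter> {..y} \<union> V0) \<union> V1 \<inter> {..<v})) (insert x (D \<inter> {..<x} \<union> V1 \<inter> {..<v}))"
          by (rule eqv_insert_eq[OF a(3) eqv_refl]) (use V0 V1 lt in auto)
        also have "insert x (D \<inter> {..<x} \<union> V1 \<inter> {..<v}) = D \<inter> {..x} \<union> V1 \<inter> {..<v}"
          unfolding D1 by auto
        also note b(5)[OF 3]
        finally show ?thesis by (simp add: Un_assoc)
      qed
      moreover have "reduced_at c D s y ?V v"
      proof -
        obtain w where w: "w \<in> insert x V1" "w < v" "\<forall>u\<in>V1. w < u \<longrightarrow> u < v \<longrightarrow> \<not> same_char c D s u v"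
          using b(7)[of v] 3 unfolding reduced_at_def by blast
        have "x \<le> w" using w(1) V1 by auto
        then have "u \<in> V1" if "u \<in> ?V" "w < u" for u
          using that V0 by (auto dest: d0 d1)
        then show ?thesis
          unfolding reduced_at_def using w by blast
      qed
      ultimately show ?thesis
        using b(6)[OF 3] by simp
    qed
  qed
  have c5: "reduced_at c D s y ?V z"
  proof -
    obtain w where w: "w \<in> insert x V1" "w < z" "\<forall>u\<in>V1. w < u \<longrightarrow> u < z \<longrightarrow> \<not> same_char c D s u z"
      using b(7)[of z] unfolding reduced_at_def by blast
    have "x \<le> w" using w(1) V1 by auto
    then have "u \<in> V1" if "u \<in> ?V" "w < u" for u
      using that V0 by (auto dest: d0 d1)
    then show ?thesis
      unfolding reduced_at_def using w by blast
  qed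
  show ?thesis
    unfolding reduct_def using sub c1 c2 c3 c4 c5 by blast
qed

text \<open>The gaps between consecutive points of \<open>F\<close> are reduced separately and
  concatenated, so that points needed as witnesses survive with their rank \<open>s\<close> types
  inside the interval.\<close>

lemma reduct_marked:
  assumes "finite F" "F \<subseteq> D \<inter> {y<..<z}" "y < z"
    and "\<And>y' z'. y' < z' \<Longrightarrow> z' \<le> z \<Longrightarrow> \<exists>V. reduct c D s y' z' V"
  shows "\<exists>V. reduct c D s y z V \<and> F \<subseteq> V \<and>
    (\<forall>w\<in>F. eqv c s (V \<inter> {..<w}) (D \<inter> {y<..<w}) \<and> eqv c s (V \<inter> {w<..}) (D \<inter> {w<..<z}))"
  using assms
proof (induction F arbitrary: z rule: finite_linorder_max_induct)
  case empty
  then show ?case by blast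
next
  case (insert b A)
  have b: "b \<in> D" "y < b" "b < z" using insert.prems(1) by auto
  have "A \<subseteq> D \<inter> {y<..<b}" using insert.hyps(2) insert.prems(1) by auto
  moreover have "\<exists>V. reduct c D s y' z' V" if "y' < z'" "z' \<le> b" for y' z'
    using insert.prems(3) that b(3) by simp
  ultimately obtain V0 where V0: "reduct c D s y b V0" "A \<subseteq> V0"
    "\<And>w. w \<in> A \<Longrightarrow> eqv c s (V0 \<inter> {..<w}) (D \<inter> {y<..<w})"
    "\<And>w. w \<in> A \<Longrightarrow> eqv c s (V0 \<inter> {w<..}) (D \<inter> {w<..<b})"
    using insert.IH[of b] b(2) by blast
  obtain V1 where V1: "reduct c D s b z V1"
    using insert.prems(3) b(3) by blast
  have d0: "u \<in> D \<and> y < u \<and> u < b \<and> u < z" if "u \<in> V0" for u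
    using that reductD(1)[OF V0(1)] b less_trans[of u b z] by auto
  have d1: "u \<in> D \<and> y < u \<and> b < u \<and> u < z" if "u \<in> V1" for u
    using that reductD(1)[OF V1] b less_trans[of y b u] by auto
  let ?V = "insert b (V0 \<union> V1)"
  have "reduct c D s y z ?V"
    by (rule reduct_comp[OF V0(1) b(1) V1 b(2,3)])
  moreover have "insert b A \<subseteq> ?V" using V0(2) by blast
  moreover have "eqv c s (?V \<inter> {..<w}) (D \<inter> {y<..<w}) \<and> eqv c s (?V \<inter> {w<..}) (D \<inter> {w<..<z})"
    if "w \<in> insert b A" for w
  proof (cases "w = b")
    case True
    have "?V \<inter> {..<w} = V0" "?V \<inter> {w<..} = V1"
      using True by (auto dest: d0 d1)
    then show ?thesis
      using reductD(2)[OF V0(1)] reductD(2)[OF V1] True by simp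
  next
    case False
    then have wA: "w \<in> A" using that by blast
    then have wb: "w < b" "y < w" using insert.hyps(2) insert.prems(1) by auto
    have "?V \<inter> {..<w} = V0 \<inter> {..<w}" "?V \<inter> {w<..} = insert b (V0 \<inter> {w<..} \<union> V1)"
      using wb by (auto dest: d0 d1)
    moreover have "D \<inter> {w<..<z} = insert b (D \<inter> {w<..<b} \<union> D \<inter> {b<..<z})"
      using wb b by auto
    moreover have "eqv c s (insert b (V0 \<inter> {w<..} \<union> V1)) (insert b (D \<inter> {w<..<b} \<union> D \<inter> {b<..<z}))"
      by (rule eqv_insert_eq[OF V0(4)[OF wA] reductD(2)[OF V1]]) (auto dest: d0 d1)
    ultimately show ?thesis
      using V0(3)[OF wA] by simp
  qed
  ultimately show ?case by blast
qed

text \<open>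
  Restrict to points \<open>x\<close> of the character of \<open>z\<close> with a fixed type of \<open>[x, z)\<close>. Any \<open>u < x\<close> has a
  counterpart \<open>v < z\<close>, because \<open>x\<close> and \<open>z\<close> have the same left type. As \<open>v\<close> may lie below \<open>y\<close>, it is not
  a legal answer, but by induction its existence shows that \<open>(u, x)\<close> and \<open>(u, z)\<close> are equivalent, so that
  \<open>u\<close> can be answered by itself.
\<close>

lemma cofinal_same_char_cut:
  assumes finite_colors: "finite (range c)"
    and cof: "\<And>w. w < z \<Longrightarrow> \<exists>x. w < x \<and> x < z \<and> same_char c D s x z" and yz: "y < z"
  shows "\<exists>x. y < x \<and> x < z \<and> same_char c D s x z \<and> eqv c s (D \<inter> {y<..<x}) (D \<inter> {y<..<z})"
proof -
  define T where "T x = eqv_class c s (D \<inter> {x..<z})" for x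
  have "range T \<subseteq> range (eqv_class c s)"
    unfolding T_def by blast
  then have finT: "finite (range T)"
    using finite_range_eqv_class[OF finite_colors] by (rule finite_subset)
  define Q where "Q w \<tau> \<longleftrightarrow> (\<exists>x. w < x \<and> x < z \<and> same_char c D s x z \<and> T x = \<tau>)" for w \<tau>
  \<comment> \<open>Pigeonhole: if every type \<open>\<tau>\<close> of a final part
    \<open>[x, z)\<close> ceased to occur beyond some \<open>w \<tau> < z\<close>, none could occur
    beyond the maximum of these finitely many bounds.\<close>
  have "\<exists>\<tau>. \<forall>w. w < z \<longrightarrow> Q w \<tau>"
  proof (rule ccontr)
    assume "\<not> ?thesis"
    then have "\<forall>\<tau>. \<exists>w. w < z \<and> \<not> Q w \<tau>"
      by blast
    from choice[OF this] obtain w where w: "\<And>\<tau>. w \<tau> < z" "\<And>\<tau>. \<not> Q (w \<tau>) \<tau>"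
      by blast
    define M where "M = Max (w ` range T)"
    have fin: "finite (w ` range T)"
      using finT by blast
    have "M < z"
      unfolding M_def using w(1) by (subst Max_less_iff[OF fin]) blast+
    then obtain x where x: "M < x" "x < z" "same_char c D s x z"
      using cof by blast
    have "w (T x) \<le> M"
      unfolding M_def by (rule Max_ge[OF fin]) blast
    then have "w (T x) < x"
      using x(1) by (rule le_less_trans)
    then have "Q (w (T x)) (T x)"
      unfolding Q_def using x by blast
    then show False
      using w(2) by blast
  qed
  then obtain \<tau> where \<tau>: "w < z \<Longrightarrow> \<exists>x. w < x \<and> x < z \<and> same_char c D s x z \<and> T x = \<tau>" for w
    unfolding Q_def by blast
  define C where "C = {x. x < z \<and> same_char c D s x z \<and> T x = \<tau>}"
  have cofC: "\<exists>x\<in>C. w < x" if "w < z" for w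
    using \<tau>[OF that] unfolding C_def by blast
  have C: "x < z" "x \<in> D" "eqv c (Suc s) (D \<inter> {..<x}) (D \<inter> {..<z})" if "x \<in> C" for x
    using that unfolding C_def same_char_def by auto
  have CC: "eqv c s (D \<inter> {x..<z}) (D \<inter> {x'..<z})" if "x \<in> C" "x' \<in> C" for x x'
    using that unfolding C_def eqv_class_eq_iff[symmetric] T_def by simp
  \<comment> \<open>The threshold \<open>b\<close> depends on the left end, which has to stay free:
    after a move at \<open>u\<close>, the remaining interval starts at \<open>u\<close> and not at
    \<open>y\<close>.\<close>
  have claim: "\<exists>b. b < z \<and> (\<forall>x\<in>C. b < x \<longrightarrow> eqv c t (D \<inter> {y<..<x}) (D \<inter> {y<..<z}))"
    if "t \<le> s" "y < z" for t y
    using that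
  proof (induction t arbitrary: y)
    case 0
    then show ?case by auto
  next
    case (Suc t)
    let ?f = "\<lambda>u. (c u, eqv_class c t (D \<inter> {y<..<u}), eqv_class c t (D \<inter> {u<..<z}))"
    have "finite (?f ` (D \<inter> {y<..<z}))"
      by (rule finite_subset[of _ "range c \<times> range (eqv_class c t) \<times> range (eqv_class c t)"])
        (auto intro: finite_colors finite_range_eqv_class)
    then obtain W where W: "finite W" "W \<subseteq> D \<inter> {y<..<z}"
      "\<And>u. u \<in> D \<inter> {y<..<z} \<Longrightarrow> \<exists>w\<in>W. ?f w = ?f u"
      by (rule finite_witnesses) blast
    have "\<forall>w. \<exists>b. w < z \<longrightarrow> b < z \<and> (\<forall>x\<in>C. b < x \<longrightarrow> eqv c t (D \<inter> {w<..<x}) (D \<inter> {w<..<z}))"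
      using Suc.IH Suc_leD[OF Suc.prems(1)] by blast
    from choice[OF this] obtain b where b: "w < z \<Longrightarrow> b w < z"
      "w < z \<Longrightarrow> x \<in> C \<Longrightarrow> b w < x \<Longrightarrow> eqv c t (D \<inter> {w<..<x}) (D \<inter> {w<..<z})" for w x
      by blast
    \<comment> \<open>Beyond \<open>m\<close> lie all witnesses and their thresholds: every
      \<open>w\<close> in \<open>W\<close> belongs to \<open>(y, x)\<close>, and
      \<open>(w, x)\<close> has the rank \<open>t\<close> type of \<open>(w, z)\<close>.\<close>
    define m where "m = Max (insert y (W \<union> b ` W))"
    have fin: "finite (insert y (W \<union> b ` W))" using W(1) by simp
    have mz: "m < z"
      unfolding m_def using fin W(2) b(1) Suc.prems(2) by (subst Max_less_iff) auto
    have ge: "u \<le> m" if "u \<in> insert y (W \<union> b ` W)" for u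
      unfolding m_def using fin that by (rule Max_ge)
    have "eqv c (Suc t) (D \<inter> {y<..<x}) (D \<inter> {y<..<z})" if x: "x \<in> C" "m < x" for x
    proof (rule eqv_SucI)
      note xz = C(1)[OF x(1)]
      fix u assume u: "u \<in> D \<inter> {y<..<x}"
      then have u': "u \<in> D" "y < u" "u < x" "u < z" using xz by auto
      obtain v where v: "v \<in> D \<inter> {..<z}" "eqv c s (D \<inter> {..<x} \<inter> {u<..}) (D \<inter> {..<z} \<inter> {v<..})"
      proof (rule eqv_forthE[OF C(3)[OF x(1)], of u])
        show "u \<in> D \<inter> {..<x}" using u by auto
      qed (use that in blast)
      have vz: "v < z" using v(1) by auto
      \<comment> \<open>Beyond the threshold of \<open>v\<close>, the intervals
        \<open>(v, x2)\<close> and \<open>(v, z)\<close> agree. Appending the equivalent final parts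
        \<open>[x, z)\<close> and \<open>[x2, z)\<close> to \<open>(u, x)\<close> and
        \<open>(v, x2)\<close> shows that \<open>(u, z)\<close> agrees with \<open>(v, z)\<close>,
        and so with \<open>(u, x)\<close>.\<close>
      obtain x2 where x2: "x2 \<in> C" "max v (b v) < x2"
        using cofC[of "max v (b v)"] b(1)[OF vz] vz by auto
      have e1: "eqv c t (D \<inter> {v<..<x2}) (D \<inter> {v<..<z})"
        using b(2)[OF vz x2(1)] x2(2) by simp
      have "D \<inter> {..<x} \<inter> {u<..} = D \<inter> {u<..<x}" "D \<inter> {..<z} \<inter> {v<..} = D \<inter> {v<..<z}"
        by auto
      then have e2: "eqv c t (D \<inter> {u<..<x}) (D \<inter> {v<..<z})"
        using eqv_mono[OF v(2) Suc_leD[OF Suc.prems(1)]] by simp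
      have e3: "eqv c t (D \<inter> {u<..<z}) (D \<inter> {v<..<z})"
      proof (rule eqv_Un_before)
        show "eqv c t (D \<inter> {u<..<x}) (D \<inter> {v<..<x2})"
          using e2 eqv_sym[OF e1] by (rule eqv_trans)
        show "eqv c t (D \<inter> {x..<z}) (D \<inter> {x2..<z})"
          using eqv_mono[OF CC[OF x(1) x2(1)] Suc_leD[OF Suc.prems(1)]] .
        show "D \<inter> {u<..<z} = D \<inter> {u<..<x} \<union> D \<inter> {x..<z}" using u' xz by auto
        show "D \<inter> {v<..<z} = D \<inter> {v<..<x2} \<union> D \<inter> {x2..<z}" using x2 C(1)[OF x2(1)] by auto
      qed auto
      have "D \<inter> {y<..<x} \<inter> {..<u} = D \<inter> {y<..<z} \<inter> {..<u}" "D \<inter> {y<..<x} \<inter> {u<..} = D \<inter> {u<..<x}"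
        "D \<inter> {y<..<z} \<inter> {u<..} = D \<inter> {u<..<z}"
        using u' by auto
      then show "\<exists>t'\<in>D \<inter> {y<..<z}. c u = c t' \<and> eqv c t (D \<inter> {y<..<x} \<inter> {..<u}) (D \<inter> {y<..<z} \<inter> {..<t'}) \<and>
          eqv c t (D \<inter> {y<..<x} \<inter> {u<..}) (D \<inter> {y<..<z} \<inter> {t'<..})"
        using u' eqv_trans[OF e2 eqv_sym[OF e3]] by (intro bexI[of _ u]) auto
    next
      fix u assume "u \<in> D \<inter> {y<..<z}"
      then obtain w where w: "w \<in> W" "c w = c u" "eqv c t (D \<inter> {y<..<w}) (D \<inter> {y<..<u})"
        "eqv c t (D \<inter> {w<..<z}) (D \<inter> {u<..<z})"
        using W(3)[of u] by (auto simp: eqv_class_eq_iff)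
      have w': "w \<in> D" "y < w" "w < z" "w < x" "b w < x"
        using w(1) W(2) ge[of w] ge[of "b w"] x(2) by auto
      have "eqv c t (D \<inter> {w<..<x}) (D \<inter> {w<..<z})"
        by (rule b(2)[OF w'(3) x(1) w'(5)])
      then have "eqv c t (D \<inter> {w<..<x}) (D \<inter> {u<..<z})"
        using w(4) by (rule eqv_trans)
      moreover have "D \<inter> {y<..<x} \<inter> {..<w} = D \<inter> {y<..<w}" "D \<inter> {y<..<x} \<inter> {w<..} = D \<inter> {w<..<x}"
        using w' by auto
      moreover have "D \<inter> {y<..<z} \<inter> {..<u} = D \<inter> {y<..<u}" "D \<inter> {y<..<z} \<inter> {u<..} = D \<inter> {u<..<z}"
        using \<open>u \<in> D \<inter> {y<..<z}\<close> by auto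
      ultimately show "\<exists>s\<in>D \<inter> {y<..<x}. c u = c s \<and> eqv c t (D \<inter> {y<..<z} \<inter> {..<u}) (D \<inter> {y<..<x} \<inter> {..<s}) \<and>
          eqv c t (D \<inter> {y<..<z} \<inter> {u<..}) (D \<inter> {y<..<x} \<inter> {s<..})"
        using w w' by (intro bexI[of _ w]) (auto intro: eqv_sym)
    qed
    then show ?case using mz by blast
  qed
  obtain b where b: "b < z" "\<And>x. x \<in> C \<Longrightarrow> b < x \<Longrightarrow> eqv c s (D \<inter> {y<..<x}) (D \<inter> {y<..<z})"
    using claim[OF le_refl yz] by blast
  obtain x where x: "x \<in> C" "max b y < x"
    using cofC[of "max b y"] b(1) yz by auto
  show ?thesis
    using x b(2)[OF x(1)] unfolding C_def by auto
qed

text \<open>Equal characters allow the context of the interval to be moved from \<open>x\<close> to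
  \<open>z\<close>: the initial segments below them and the final segments from them on agree at
  rank \<open>Suc s\<close>. Inside, only rank \<open>s\<close> is demanded, and that is the
  hypothesis \<open>e\<close>.\<close>

lemma reduct_cut:
  assumes g: "reduct c D s y x V" and sm: "same_char c D s x z" and lt: "x < z"
    and e: "eqv c s (D \<inter> {y<..<x}) (D \<inter> {y<..<z})"
  shows "reduct c D s y z V"
proof -
  note a = reductD[OF g]
  have V: "V \<subseteq> {..<x}" using a(1) by auto
  have V': "V \<subseteq> {..<z}" using V lt by (auto dest: subsetD less_trans)
  have xz: "x \<in> D" "z \<in> D" "c z = c x" "eqv c (Suc s) (D \<inter> {..<x}) (D \<inter> {..<z})"
    "eqv c (Suc s) (D \<inter> {z<..}) (D \<inter> {x<..})"
    using sm eqv_sym unfolding same_char_def by auto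
  have u: "eqv c (Suc s) (D \<inter> {z..}) (D \<inter> {x..})"
    by (rule eqv_insert[OF eqv_refl[of _ _ "{}"] xz(5) xz(3)]) (use xz in auto)
  have app: "eqv c (Suc s) (S \<union> D \<inter> {z..}) (S \<union> D \<inter> {x..})" if "S \<subseteq> V" for S
    by (rule eqv_Un_before[OF eqv_refl u refl refl]) (use that V V' lt in \<open>auto intro: less_le_trans le_less_trans less_imp_le\<close>)
  \<comment> \<open>A point with the character of \<open>z\<close> also has that of
    \<open>x\<close>, and \<open>V\<close> has no points from \<open>x\<close> on, so the bound for
    \<open>x\<close> serves for \<open>z\<close>.\<close>
  have "reduced_at c D s y V z"
  proof -
    obtain w where w: "w \<in> insert y V" "w < x" "\<forall>u\<in>V. w < u \<longrightarrow> u < x \<longrightarrow> \<not> same_char c D s u x"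
      using a(7)[of x] unfolding reduced_at_def by blast
    have "\<not> same_char c D s u z" if "u \<in> V" "w < u" for u
      using w(3) that V same_char_trans[OF _ same_char_sym[OF sm]] by blast
    then show ?thesis
      unfolding reduced_at_def using w(1,2) lt by (meson less_trans)
  qed
  moreover have "V \<subseteq> D \<inter> {y<..<z}"
  proof
    fix u assume "u \<in> V"
    then show "u \<in> D \<inter> {y<..<z}"
      using subsetD[OF a(1), of u] subsetD[OF V', of u] by auto
  qed
  ultimately show ?thesis
    unfolding reduct_def
    using eqv_trans[OF a(2) e] eqv_trans[OF a(3) xz(4)] eqv_trans[OF app[OF subset_refl] a(4)]
      a(5) eqv_trans[OF app a(6)] a(7) by blast
qed

text \<open>A move in the union of the blocks falls into a finite piece, which is a reduct by
  concatenation; a move in \<open>D\<close> is answered by a witness in the next block. Either way a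
  tail of the same kind remains, so induction on the rank applies. The supremum of the
  \<open>r n\<close> may lie strictly below \<open>z\<close>.\<close>

lemma reduct_omega:
  fixes r :: "nat \<Rightarrow> 'a" and V :: "nat \<Rightarrow> 'a set"
  assumes r: "\<And>n. r n < r (Suc n)" "\<And>n. r n < z" "\<And>n. r (Suc n) \<in> D"
    and g: "\<And>n. reduct c D s (r n) (r (Suc n)) (V n)"
    and wit: "\<And>n u. u \<in> D \<inter> {r n<..<z} \<Longrightarrow> \<exists>x\<in>V n. c x = c u \<and>
      eqv c s (V n \<inter> {..<x}) (D \<inter> {r n<..<u}) \<and>
      eqv c s (V n \<inter> {x<..} \<union> D \<inter> {r (Suc n)..<z}) (D \<inter> {u<..<z})"
    and nosim: "\<And>x. x \<in> D \<Longrightarrow> r 1 < x \<Longrightarrow> x < z \<Longrightarrow> \<not> same_char c D s x z"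
  shows "reduct c D s (r 0) z (\<Union>n. insert (r (Suc n)) (V n))"
proof -
  define B where "B = (\<Union>n. insert (r (Suc n)) (V n))"
  have rle: "r n \<le> r m" if "n \<le> m" for n m
    using that by (induction rule: dec_induct) (auto intro: order_trans less_imp_le r(1))
  have rless: "r n < r m" if "n < m" for n m
    using rle[of "Suc n" m] r(1)[of n] that by (meson Suc_leI less_le_trans)
  have rless_iff: "r n < r m \<longleftrightarrow> n < m" for n m
    using rless[of n m] rle[of m n] by (cases "n < m") (auto simp: linorder_class.not_less)
  have Vd: "u \<in> D \<and> r n < u \<and> u < r (Suc n)" if "u \<in> V n" for u n
    using reductD(1)[OF g, of n] that by auto
  have Bex: "\<exists>n. u = r (Suc n) \<or> u \<in> V n" if "u \<in> B" for u
    using that unfolding B_def by auto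
  have rB: "r m \<in> B" "r m \<in> D" if "0 < m" for m
    using that r(3)[of "m - 1"] unfolding B_def by (auto intro!: exI[of _ "m - 1"])
  have BD: "u \<in> D \<and> r 0 < u \<and> u < z" if uB: "u \<in> B" for u
  proof -
    obtain n where "u = r (Suc n) \<or> u \<in> V n"
      using Bex[OF uB] by (rule exE)
    then show ?thesis
      using Vd[of u n] r(3)[of n] r(2)[of "Suc n"] rless[of 0 "Suc n"] rle[of 0 n]
      by (auto intro: less_trans le_less_trans)
  qed
  have Bn: "B \<inter> {r n<..<r (Suc n)} = V n" for n
  proof
    show "B \<inter> {r n<..<r (Suc n)} \<subseteq> V n"
    proof
      fix u assume u: "u \<in> B \<inter> {r n<..<r (Suc n)}"
      obtain k where k: "u = r (Suc k) \<or> u \<in> V k"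
        using Bex[of u] u by auto
      have "u \<noteq> r (Suc k)"
        using u rless_iff by auto
      then have uk: "u \<in> V k" using k by blast
      have "r n < r (Suc k)" "r k < r (Suc n)"
        using u Vd[OF uk] by (auto intro: less_trans)
      then have "k = n" using rless_iff by auto
      then show "u \<in> V n" using uk by simp
    qed
    show "V n \<subseteq> B \<inter> {r n<..<r (Suc n)}"
      using Vd unfolding B_def by auto
  qed
  have seg: "reduct c D s (r n) (r m) (B \<inter> {r n<..<r m})" if "n < m" for n m
    using that
  proof (induction rule: strict_inc_induct)
    case (base i)
    show ?case using g[of i] base by (simp add: Bn)
  next
    case (step i)
    have e: "B \<inter> {r i<..<r m} = insert (r (Suc i)) (V i \<union> B \<inter> {r (Suc i)<..<r m})"
      unfolding Bn[symmetric] using rB(1)[of "Suc i"] r(1)[of i] rless[of "Suc i" m] step.hyps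
      by (auto intro: less_trans)
    show ?case
      unfolding e using step.hyps step.IH
      by (intro reduct_comp) (auto intro: g r rless)
  qed
  have esc: "\<exists>m>n. v < r m" if vB: "v \<in> B" and nv: "r n < v" for n v
  proof -
    obtain k where "v = r (Suc k) \<or> v \<in> V k"
      using Bex[OF vB] by (rule exE)
    then have "v < r (Suc (Suc k))"
      using Vd[of v k] r(1)[of "Suc k"] by (auto intro: less_trans)
    moreover from this have "r n < r (Suc (Suc k))"
      using less_trans[OF nv] by blast
    then have "n < Suc (Suc k)" using rless_iff by blast
    ultimately show ?thesis by blast
  qed
  have Tsplit: "B \<inter> {v<..} = insert (r m) (B \<inter> {v<..<r m} \<union> B \<inter> {r m<..})" if "v < r m" "0 < m" for v m
    using rB(1)[OF that(2)] that(1) by (auto intro: less_trans)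
  \<comment> \<open>Even a \<open>u\<close> above every \<open>r n\<close> has its answer between
    \<open>r n\<close> and \<open>r (Suc n)\<close>. Beyond that block, \<open>wit\<close> still
    speaks of the rest of \<open>D\<close>, which \<open>IH\<close> exchanges for the rest of
    \<open>B\<close>.\<close>
  have fwd: "\<exists>x\<in>B \<inter> {r n<..}. c x = c u \<and> eqv c t (B \<inter> {r n<..<x}) (D \<inter> {r n<..<u}) \<and>
      eqv c t (B \<inter> {x<..}) (D \<inter> {u<..<z})"
    if IH: "\<And>n. eqv c t (B \<inter> {r n<..}) (D \<inter> {r n<..<z})" and ts: "t \<le> s" and u: "u \<in> D \<inter> {r n<..<z}" for t n u
  proof -
    obtain x where x: "x \<in> V n" "c x = c u" "eqv c s (V n \<inter> {..<x}) (D \<inter> {r n<..<u})"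
      "eqv c s (V n \<inter> {x<..} \<union> D \<inter> {r (Suc n)..<z}) (D \<inter> {u<..<z})"
      using wit[OF u] by blast
    have x': "r n < x" "x < r (Suc n)" "x \<in> B"
      using Vd[OF x(1)] x(1) unfolding B_def by auto
    have 1: "V n \<inter> {..<x} = B \<inter> {r n<..<x}"
      unfolding Bn[symmetric] using x' by (auto intro: less_trans)
    have 2: "B \<inter> {x<..} = insert (r (Suc n)) (V n \<inter> {x<..} \<union> B \<inter> {r (Suc n)<..})"
      unfolding Bn[symmetric] using rB(1)[of "Suc n"] x' by (auto intro: less_trans)
    have "eqv c t (insert (r (Suc n)) (V n \<inter> {x<..} \<union> B \<inter> {r (Suc n)<..}))
        (insert (r (Suc n)) (V n \<inter> {x<..} \<union> D \<inter> {r (Suc n)<..<z}))"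
      by (rule eqv_insert_eq[OF eqv_refl IH]) (use Vd in auto)
    also have "insert (r (Suc n)) (V n \<inter> {x<..} \<union> D \<inter> {r (Suc n)<..<z}) = V n \<inter> {x<..} \<union> D \<inter> {r (Suc n)..<z}"
      using r(2)[of "Suc n"] r(3)[of n] by auto
    also note eqv_mono[OF x(4) ts]
    finally have "eqv c t (B \<inter> {x<..}) (D \<inter> {u<..<z})"
      unfolding 2 .
    then show ?thesis
      using x x' eqv_mono[OF x(3) ts] unfolding 1 by auto
  qed
  have A: "eqv c t (B \<inter> {r n<..}) (D \<inter> {r n<..<z})" if "t \<le> s" for t n
    using that
  proof (induction t arbitrary: n)
    case (Suc t)
    have IH: "eqv c t (B \<inter> {r n<..}) (D \<inter> {r n<..<z})" for n
      using Suc.IH Suc.prems by simp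
    show ?case
    proof (rule eqv_SucI)
      fix v assume v: "v \<in> B \<inter> {r n<..}"
      then obtain m where m: "n < m" "v < r m" using esc[of v n] by auto
      have "eqv c (Suc t) (B \<inter> {r n<..<r m}) (D \<inter> {r n<..<r m})"
        using reductD(2)[OF seg[OF m(1)]] Suc.prems by (rule eqv_mono)
      moreover have "v \<in> B \<inter> {r n<..<r m}" using v m by auto
      ultimately obtain u where u: "u \<in> D \<inter> {r n<..<r m}" "c v = c u"
        "eqv c t (B \<inter> {r n<..<r m} \<inter> {..<v}) (D \<inter> {r n<..<r m} \<inter> {..<u})"
        "eqv c t (B \<inter> {r n<..<r m} \<inter> {v<..}) (D \<inter> {r n<..<r m} \<inter> {u<..})"
        by (rule eqv_forthE)
      have uz: "u < r m" "u < z" "r n < u" using u(1) r(2)[of m] by (auto intro: less_trans)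
      have "B \<inter> {r n<..<r m} \<inter> {..<v} = B \<inter> {r n<..} \<inter> {..<v}"
        "D \<inter> {r n<..<r m} \<inter> {..<u} = D \<inter> {r n<..<z} \<inter> {..<u}"
        using uz m by (auto intro: less_trans)
      moreover have "eqv c t (B \<inter> {r n<..} \<inter> {v<..}) (D \<inter> {r n<..<z} \<inter> {u<..})"
      proof (rule eqv_insert)
        show "eqv c t (B \<inter> {r n<..<r m} \<inter> {v<..}) (D \<inter> {r n<..<r m} \<inter> {u<..})" by (rule u(4))
        show "eqv c t (B \<inter> {r m<..}) (D \<inter> {r m<..<z})" by (rule IH)
        show "B \<inter> {r n<..} \<inter> {v<..} = insert (r m) (B \<inter> {r n<..<r m} \<inter> {v<..} \<union> B \<inter> {r m<..})"
          using rB(1)[of m] m rless[OF m(1)] by (auto intro: less_trans)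
        show "D \<inter> {r n<..<z} \<inter> {u<..} = insert (r m) (D \<inter> {r n<..<r m} \<inter> {u<..} \<union> D \<inter> {r m<..<z})"
          using rB(2)[of m] m rless[OF m(1)] uz r(2)[of m] by (auto intro: less_trans)
      qed auto
      ultimately show "\<exists>u\<in>D \<inter> {r n<..<z}. c v = c u \<and> eqv c t (B \<inter> {r n<..} \<inter> {..<v}) (D \<inter> {r n<..<z} \<inter> {..<u}) \<and>
          eqv c t (B \<inter> {r n<..} \<inter> {v<..}) (D \<inter> {r n<..<z} \<inter> {u<..})"
        using u uz by (intro bexI[of _ u]) auto
    next
      fix u assume u: "u \<in> D \<inter> {r n<..<z}"
      obtain x where x: "x \<in> B \<inter> {r n<..}" "c x = c u" "eqv c t (B \<inter> {r n<..<x}) (D \<inter> {r n<..<u})"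
        "eqv c t (B \<inter> {x<..}) (D \<inter> {u<..<z})"
        using fwd[OF IH _ u] Suc.prems by auto
      have "B \<inter> {r n<..} \<inter> {..<x} = B \<inter> {r n<..<x}" "B \<inter> {r n<..} \<inter> {x<..} = B \<inter> {x<..}"
        "D \<inter> {r n<..<z} \<inter> {..<u} = D \<inter> {r n<..<u}" "D \<inter> {r n<..<z} \<inter> {u<..} = D \<inter> {u<..<z}"
        using x(1) u by (auto intro: less_trans)
      then show "\<exists>x\<in>B \<inter> {r n<..}. c u = c x \<and> eqv c t (D \<inter> {r n<..<z} \<inter> {..<u}) (B \<inter> {r n<..} \<inter> {..<x}) \<and>
          eqv c t (D \<inter> {r n<..<z} \<inter> {u<..}) (B \<inter> {r n<..} \<inter> {x<..})"
        using x eqv_sym by (intro bexI[of _ x]) auto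
    qed
  qed simp
  note A' = A[OF le_refl]
  \<comment> \<open>A point up to \<open>r n\<close> is answered by itself. This spends the extra
    round, so the rank \<open>s\<close> equivalence of the tails suffices. A point of
    \<open>B\<close> above \<open>r n\<close> uses the context clause of a finite piece.\<close>
  have left: "eqv c (Suc s) (D \<inter> {..r n} \<union> B \<inter> {r n<..}) (D \<inter> {..<z})" for n
  proof (rule eqv_SucI)
    fix v assume "v \<in> D \<inter> {..r n} \<union> B \<inter> {r n<..}"
    then consider "v \<in> D" "v \<le> r n" | "v \<in> B" "r n < v" by auto
    then show "\<exists>u\<in>D \<inter> {..<z}. c v = c u \<and> eqv c s ((D \<inter> {..r n} \<union> B \<inter> {r n<..}) \<inter> {..<v}) (D \<inter> {..<z} \<inter> {..<u}) \<and>
        eqv c s ((D \<inter> {..r n} \<union> B \<inter> {r n<..}) \<inter> {v<..}) (D \<inter> {..<z} \<inter> {u<..})"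
    proof cases
      case 1
      have vz: "v < z" using 1(2) r(2) by (rule le_less_trans)
      have "(D \<inter> {..r n} \<union> B \<inter> {r n<..}) \<inter> {..<v} = D \<inter> {..<z} \<inter> {..<v}"
        using 1 vz by (auto dest: less_trans)
      moreover have "eqv c s ((D \<inter> {..r n} \<union> B \<inter> {r n<..}) \<inter> {v<..}) (D \<inter> {..<z} \<inter> {v<..})"
        by (rule eqv_Un_at[of _ _ "D \<inter> {v<..r n}" "D \<inter> {v<..r n}", OF eqv_refl A'[of n]])
          (use 1 vz r(2)[of n] in \<open>auto intro: le_less_trans less_trans\<close>)
      ultimately show ?thesis using 1 vz by (intro bexI[of _ v]) auto
    next
      case 2
      then obtain m where m: "n < m" "v < r m" using esc[of v n] by auto
      note G = reductD(3)[OF seg[OF m(1)]]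
      have "v \<in> D \<inter> {..r n} \<union> B \<inter> {r n<..<r m}" using 2 m by auto
      with G obtain u where u: "u \<in> D \<inter> {..<r m}" "c v = c u"
        "eqv c s ((D \<inter> {..r n} \<union> B \<inter> {r n<..<r m}) \<inter> {..<v}) (D \<inter> {..<r m} \<inter> {..<u})"
        "eqv c s ((D \<inter> {..r n} \<union> B \<inter> {r n<..<r m}) \<inter> {v<..}) (D \<inter> {..<r m} \<inter> {u<..})"
        by (rule eqv_forthE)
      have uz: "u < r m" "u < z" using u(1) r(2)[of m] by (auto intro: less_trans)
      have "(D \<inter> {..r n} \<union> B \<inter> {r n<..<r m}) \<inter> {..<v} = (D \<inter> {..r n} \<union> B \<inter> {r n<..}) \<inter> {..<v}"
        "D \<inter> {..<r m} \<inter> {..<u} = D \<inter> {..<z} \<inter> {..<u}"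
        using uz m by (auto intro: less_trans)
      moreover have "eqv c s ((D \<inter> {..r n} \<union> B \<inter> {r n<..}) \<inter> {v<..}) (D \<inter> {..<z} \<inter> {u<..})"
      proof (rule eqv_insert)
        show "eqv c s ((D \<inter> {..r n} \<union> B \<inter> {r n<..<r m}) \<inter> {v<..}) (D \<inter> {..<r m} \<inter> {u<..})" by (rule u(4))
        show "eqv c s (B \<inter> {r m<..}) (D \<inter> {r m<..<z})" by (rule A')
        show "(D \<inter> {..r n} \<union> B \<inter> {r n<..}) \<inter> {v<..} =
            insert (r m) ((D \<inter> {..r n} \<union> B \<inter> {r n<..<r m}) \<inter> {v<..} \<union> B \<inter> {r m<..})"
          using rB(1)[of m] m rless[OF m(1)] 2 by (auto intro: less_trans)
        show "D \<inter> {..<z} \<inter> {u<..} = insert (r m) (D \<inter> {..<r m} \<inter> {u<..} \<union> D \<inter> {r m<..<z})"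
          using rB(2)[of m] m uz r(2)[of m] by (auto intro: less_trans)
      qed (use rless[OF m(1)] in \<open>auto intro: le_less_trans\<close>)
      ultimately show ?thesis
        using u uz by (intro bexI[of _ u]) auto
    qed
  next
    fix u assume "u \<in> D \<inter> {..<z}"
    then consider "u \<in> D" "u \<le> r n" "u < z" | "u \<in> D \<inter> {r n<..<z}" by force
    then show "\<exists>v\<in>D \<inter> {..r n} \<union> B \<inter> {r n<..}. c u = c v \<and>
        eqv c s (D \<inter> {..<z} \<inter> {..<u}) ((D \<inter> {..r n} \<union> B \<inter> {r n<..}) \<inter> {..<v}) \<and>
        eqv c s (D \<inter> {..<z} \<inter> {u<..}) ((D \<inter> {..r n} \<union> B \<inter> {r n<..}) \<inter> {v<..})"
    proof cases
      case 1
      have "(D \<inter> {..r n} \<union> B \<inter> {r n<..}) \<inter> {..<u} = D \<inter> {..<z} \<inter> {..<u}"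
        using 1 by (auto dest: less_trans)
      moreover have "eqv c s (D \<inter> {..<z} \<inter> {u<..}) ((D \<inter> {..r n} \<union> B \<inter> {r n<..}) \<inter> {u<..})"
        by (rule eqv_sym, rule eqv_Un_at[of _ _ "D \<inter> {u<..r n}" "D \<inter> {u<..r n}", OF eqv_refl A'[of n]])
          (use 1 r(2)[of n] in \<open>auto intro: le_less_trans less_trans\<close>)
      ultimately show ?thesis using 1 by (intro bexI[of _ u]) auto
    next
      case 2
      obtain x where x: "x \<in> B \<inter> {r n<..}" "c x = c u" "eqv c s (B \<inter> {r n<..<x}) (D \<inter> {r n<..<u})"
        "eqv c s (B \<inter> {x<..}) (D \<inter> {u<..<z})"
        using fwd[OF A' le_refl 2] by auto
      have "(D \<inter> {..r n} \<union> B \<inter> {r n<..}) \<inter> {x<..} = B \<inter> {x<..}" "D \<inter> {..<z} \<inter> {u<..} = D \<inter> {u<..<z}"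
        using x(1) by (auto intro: less_trans)
      moreover have "eqv c s ((D \<inter> {..r n} \<union> B \<inter> {r n<..}) \<inter> {..<x}) (D \<inter> {..<z} \<inter> {..<u})"
        by (rule eqv_Un_at[of _ _ "D \<inter> {..r n}" "D \<inter> {..r n}", OF eqv_refl x(3)])
          (use x(1) 2 in \<open>auto intro: le_less_trans less_trans\<close>)
      ultimately show ?thesis
        using x eqv_sym by (intro bexI[of _ x]) auto
    qed
  qed
  have right: "eqv c (Suc s) (B \<inter> {r n<..} \<union> D \<inter> {z..}) (D \<inter> {r n<..})" for n
  proof (rule eqv_SucI)
    fix v assume "v \<in> B \<inter> {r n<..} \<union> D \<inter> {z..}"
    then consider "v \<in> D" "z \<le> v" | "v \<in> B" "r n < v" by auto
    then show "\<exists>u\<in>D \<inter> {r n<..}. c v = c u \<and> eqv c s ((B \<inter> {r n<..} \<union> D \<inter> {z..}) \<inter> {..<v}) (D \<inter> {r n<..} \<inter> {..<u}) \<and>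
        eqv c s ((B \<inter> {r n<..} \<union> D \<inter> {z..}) \<inter> {v<..}) (D \<inter> {r n<..} \<inter> {u<..})"
    proof cases
      case 1
      have vz: "r n < v" using r(2) 1(2) by (rule less_le_trans)
      have "(B \<inter> {r n<..} \<union> D \<inter> {z..}) \<inter> {v<..} = D \<inter> {r n<..} \<inter> {v<..}"
        using 1 vz BD by (auto dest: less_trans)
      moreover have "eqv c s ((B \<inter> {r n<..} \<union> D \<inter> {z..}) \<inter> {..<v}) (D \<inter> {r n<..} \<inter> {..<v})"
        by (rule eqv_Un_before[of _ _ "B \<inter> {r n<..}" "D \<inter> {r n<..<z}" "D \<inter> {z..<v}" "D \<inter> {z..<v}", OF A'[of n] eqv_refl])
          (use 1 vz r(2)[of n] BD in \<open>auto intro: less_le_trans less_trans\<close>)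
      ultimately show ?thesis using 1 vz by (intro bexI[of _ v]) auto
    next
      case 2
      then obtain m where m: "n < m" "v < r m" using esc[of v n] by auto
      note G = reductD(4)[OF seg[OF m(1)]]
      have "v \<in> B \<inter> {r n<..<r m} \<union> D \<inter> {r m..}" using 2 m by auto
      with G obtain u where u: "u \<in> D \<inter> {r n<..}" "c v = c u"
        "eqv c s ((B \<inter> {r n<..<r m} \<union> D \<inter> {r m..}) \<inter> {..<v}) (D \<inter> {r n<..} \<inter> {..<u})"
        "eqv c s ((B \<inter> {r n<..<r m} \<union> D \<inter> {r m..}) \<inter> {v<..}) (D \<inter> {r n<..} \<inter> {u<..})"
        by (rule eqv_forthE)
      have "(B \<inter> {r n<..<r m} \<union> D \<inter> {r m..}) \<inter> {..<v} = (B \<inter> {r n<..} \<union> D \<inter> {z..}) \<inter> {..<v}"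
        using m r(2)[of m] by (auto intro: less_trans)
      moreover have "eqv c s ((B \<inter> {r n<..} \<union> D \<inter> {z..}) \<inter> {v<..}) ((B \<inter> {r n<..<r m} \<union> D \<inter> {r m..}) \<inter> {v<..})"
      proof (rule eqv_insert)
        show "eqv c s (B \<inter> {v<..<r m}) (B \<inter> {v<..<r m})" by (rule eqv_refl)
        show "eqv c s (B \<inter> {r m<..} \<union> D \<inter> {z..}) (D \<inter> {r m<..})"
          by (rule eqv_Un_before[of _ _ "B \<inter> {r m<..}" "D \<inter> {r m<..<z}" "D \<inter> {z..}" "D \<inter> {z..}" _ _ z z, OF A'[of m] eqv_refl])
            (use r(2)[of m] BD in \<open>auto intro: less_le_trans\<close>)
        show "(B \<inter> {r n<..} \<union> D \<inter> {z..}) \<inter> {v<..} = insert (r m) (B \<inter> {v<..<r m} \<union> (B \<inter> {r m<..} \<union> D \<inter> {z..}))"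
          using rB(1)[of m] m rless[OF m(1)] 2 r(2)[of m] by (auto intro: less_trans less_le_trans)
        show "(B \<inter> {r n<..<r m} \<union> D \<inter> {r m..}) \<inter> {v<..} = insert (r m) (B \<inter> {v<..<r m} \<union> D \<inter> {r m<..})"
          using rB(2)[of m] m 2 by (auto intro: less_trans less_le_trans)
      qed (use r(2)[of m] in \<open>auto intro: less_le_trans\<close>)
      ultimately show ?thesis
        using u eqv_trans by (intro bexI[of _ u]) auto
    qed
  next
    fix u assume "u \<in> D \<inter> {r n<..}"
    then consider "u \<in> D" "z \<le> u" "r n < u" | "u \<in> D \<inter> {r n<..<z}" by force
    then show "\<exists>v\<in>B \<inter> {r n<..} \<union> D \<inter> {z..}. c u = c v \<and>
        eqv c s (D \<inter> {r n<..} \<inter> {..<u}) ((B \<inter> {r n<..} \<union> D \<inter> {z..}) \<inter> {..<v}) \<and>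
        eqv c s (D \<inter> {r n<..} \<inter> {u<..}) ((B \<inter> {r n<..} \<union> D \<inter> {z..}) \<inter> {v<..})"
    proof cases
      case 1
      have "(B \<inter> {r n<..} \<union> D \<inter> {z..}) \<inter> {u<..} = D \<inter> {r n<..} \<inter> {u<..}"
        using 1 BD by (auto dest: less_trans)
      moreover have "eqv c s ((B \<inter> {r n<..} \<union> D \<inter> {z..}) \<inter> {..<u}) (D \<inter> {r n<..} \<inter> {..<u})"
        by (rule eqv_Un_before[of _ _ "B \<inter> {r n<..}" "D \<inter> {r n<..<z}" "D \<inter> {z..<u}" "D \<inter> {z..<u}", OF A'[of n] eqv_refl])
          (use 1 r(2)[of n] BD in \<open>auto intro: less_le_trans less_trans\<close>)
      ultimately show ?thesis using 1 eqv_sym by (intro bexI[of _ u]) auto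
    next
      case 2
      obtain x where x: "x \<in> B \<inter> {r n<..}" "c x = c u" "eqv c s (B \<inter> {r n<..<x}) (D \<inter> {r n<..<u})"
        "eqv c s (B \<inter> {x<..}) (D \<inter> {u<..<z})"
        using fwd[OF A' le_refl 2] by auto
      have xz: "x < z" using x(1) BD by auto
      have "(B \<inter> {r n<..} \<union> D \<inter> {z..}) \<inter> {..<x} = B \<inter> {r n<..<x}" "D \<inter> {r n<..} \<inter> {..<u} = D \<inter> {r n<..<u}"
        using xz by (auto intro: less_trans)
      moreover have "eqv c s ((B \<inter> {r n<..} \<union> D \<inter> {z..}) \<inter> {x<..}) (D \<inter> {r n<..} \<inter> {u<..})"
        by (rule eqv_Un_before[of _ _ "B \<inter> {x<..}" "D \<inter> {u<..<z}" "D \<inter> {z..}" "D \<inter> {z..}", OF x(4) eqv_refl])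
          (use x(1) 2 BD xz in \<open>auto intro: less_le_trans less_trans\<close>)
      ultimately show ?thesis
        using x eqv_sym by (intro bexI[of _ x]) auto
    qed
  qed
  have B0: "B \<inter> {r 0<..} = B" using BD by auto
  \<comment> \<open>The point \<open>v\<close> lies in a finite piece, for which all clauses are
    known; on the right of \<open>v\<close>, the tail of \<open>D\<close> from \<open>r m\<close> on
    is then exchanged by means of \<open>right\<close>.\<close>
  have c3: "eqv c (Suc s) (D \<inter> {..r 0} \<union> B \<inter> {..<v}) (D \<inter> {..<v}) \<and>
      eqv c (Suc s) (B \<inter> {v<..} \<union> D \<inter> {z..}) (D \<inter> {v<..}) \<and> reduced_at c D s (r 0) B v" if v: "v \<in> B" for v
  proof -
    obtain m where m: "0 < m" "v < r m" using esc[of v 0] BD[OF v] v by auto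
    note a = reductD[OF seg[OF m(1)]]
    have vG: "v \<in> B \<inter> {r 0<..<r m}" using v m BD by auto
    have "B \<inter> {r 0<..<r m} \<inter> {..<v} = B \<inter> {..<v}" using BD m by (auto intro: less_trans)
    then have 1: "eqv c (Suc s) (D \<inter> {..r 0} \<union> B \<inter> {..<v}) (D \<inter> {..<v})"
      using a(5)[OF vG] by simp
    have "eqv c (Suc s) (B \<inter> {v<..} \<union> D \<inter> {z..}) (B \<inter> {r 0<..<r m} \<inter> {v<..} \<union> D \<inter> {r m..})"
    proof (rule eqv_insert)
      show "eqv c (Suc s) (B \<inter> {v<..<r m}) (B \<inter> {v<..<r m})" by (rule eqv_refl)
      show "eqv c (Suc s) (B \<inter> {r m<..} \<union> D \<inter> {z..}) (D \<inter> {r m<..})" by (rule right)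
      show "B \<inter> {v<..} \<union> D \<inter> {z..} = insert (r m) (B \<inter> {v<..<r m} \<union> (B \<inter> {r m<..} \<union> D \<inter> {z..}))"
        unfolding Tsplit[OF m(2,1)] by auto
      show "B \<inter> {r 0<..<r m} \<inter> {v<..} \<union> D \<inter> {r m..} = insert (r m) (B \<inter> {v<..<r m} \<union> D \<inter> {r m<..})"
        using rB(2)[OF m(1)] BD vG by (auto intro: less_trans)
    qed (use r(2)[of m] in \<open>auto intro: less_le_trans\<close>)
    then have 2: "eqv c (Suc s) (B \<inter> {v<..} \<union> D \<inter> {z..}) (D \<inter> {v<..})"
      using a(6)[OF vG] by (rule eqv_trans)
    obtain w where w: "w \<in> insert (r 0) (B \<inter> {r 0<..<r m})" "w < v"
      "\<forall>u\<in>B \<inter> {r 0<..<r m}. w < u \<longrightarrow> u < v \<longrightarrow> \<not> same_char c D s u v"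
      using a(7)[of v] vG unfolding reduced_at_def by blast
    have "u \<in> B \<inter> {r 0<..<r m}" if "u \<in> B" "u < v" for u
      using that BD m(2) by (auto intro: less_trans)
    then have "reduced_at c D s (r 0) B v"
      unfolding reduced_at_def using w by blast
    with 1 2 show ?thesis by blast
  qed
  have "reduced_at c D s (r 0) B z"
    unfolding reduced_at_def using rB(1)[of 1] r(2)[of 1] BD nosim by (intro bexI[of _ "r 1"]) auto
  moreover have "B \<subseteq> D \<inter> {r 0<..<z}" using BD by auto
  ultimately have "reduct c D s (r 0) z B"
    unfolding reduct_def using A'[of 0] left[of 0] right[of 0] c3 unfolding B0 by blast
  then show ?thesis unfolding B_def .
qed

text \<open>Well-founded induction on the right end. An interval with a last point \<open>m\<close>
  is reduced below \<open>m\<close>. If points with the character of \<open>z\<close> are cofinal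
  below \<open>z\<close>, the interval is cut back to one of them. Only the remaining limits need an
  omega-sequence of blocks.\<close>

lemma ex_reduct:
  assumes finite_colors: "finite (range c)"
    and convex: "\<And>x z w. x \<in> D \<Longrightarrow> z \<in> D \<Longrightarrow> x < w \<Longrightarrow> w < z \<Longrightarrow> w \<in> D"
    and "y < z"
  shows "\<exists>V. reduct c D s y z V"
  using assms(3)
proof (induction z arbitrary: y rule: less_induct)
  case (less z)
  let ?S = "D \<inter> {y<..<z}"
  consider (empty) "?S = {}" | (mx) m where "m \<in> ?S" "\<forall>x\<in>?S. x \<le> m"
    | (cof) "\<forall>w. w < z \<longrightarrow> (\<exists>x. w < x \<and> x < z \<and> same_char c D s x z)"
    | (lim) w where "?S \<noteq> {}" "\<forall>m\<in>?S. \<exists>x\<in>?S. m < x" "w < z" "\<forall>x. w < x \<longrightarrow> x < z \<longrightarrow> \<not> same_char c D s x z"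
    by (meson not_le)
  then show ?case
  proof cases
    case empty
    then show ?thesis using reduct_empty less.prems by blast
  next
    case mx
    then have m: "m \<in> D" "y < m" "m < z" by auto
    obtain V where V: "reduct c D s y m V" using less.IH m by blast
    have "x \<le> m" if "x \<in> D" "x < z" for x
      using mx(2) m that less_trans[of y m x] by (cases "m < x") auto
    then have "D \<inter> {m<..<z} = {}"
      using leD by auto
    then have "reduct c D s m z {}" by (rule reduct_empty[OF m(3)])
    then show ?thesis using reduct_comp[OF V m(1) _ m(2,3)] by blast
  next
    case cof
    then obtain x where x: "y < x" "x < z" "same_char c D s x z" "eqv c s (D \<inter> {y<..<x}) (D \<inter> {y<..<z})"
      using cofinal_same_char_cut[OF finite_colors, of z D s y] less.prems by blast
    then obtain V where "reduct c D s y x V" using less.IH by blast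
    then show ?thesis using reduct_cut x by blast
  next
    case lim
    \<comment> \<open>One block: it contains a witness for every rank \<open>s\<close> character of
      \<open>(a, z)\<close>, and its right end \<open>a'\<close> lies beyond all points with the
      character of \<open>z\<close>. Since \<open>a' < z\<close>, the induction hypothesis reduces
      it.\<close>
    have step: "\<exists>a' V. a' \<in> ?S \<and> a < a' \<and> (\<forall>x\<in>D. a' < x \<longrightarrow> x < z \<longrightarrow> \<not> same_char c D s x z) \<and> reduct c D s a a' V \<and>
        (\<forall>u\<in>D \<inter> {a<..<z}. \<exists>x\<in>V. c x = c u \<and> eqv c s (V \<inter> {..<x}) (D \<inter> {a<..<u}) \<and>
          eqv c s (V \<inter> {x<..} \<union> D \<inter> {a'..<z}) (D \<inter> {u<..<z}))"
      if a: "a \<in> insert y ?S" for a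
    proof -
      have az: "y \<le> a" "a < z" using a less.prems by auto
      let ?f = "\<lambda>u. (c u, eqv_class c s (D \<inter> {a<..<u}), eqv_class c s (D \<inter> {u<..<z}))"
      have "finite (?f ` (D \<inter> {a<..<z}))"
        by (rule finite_subset[of _ "range c \<times> range (eqv_class c s) \<times> range (eqv_class c s)"])
          (auto intro: finite_colors finite_range_eqv_class)
      then obtain W where W: "finite W" "W \<subseteq> D \<inter> {a<..<z}"
        "\<And>u. u \<in> D \<inter> {a<..<z} \<Longrightarrow> \<exists>w\<in>W. ?f w = ?f u"
        by (rule finite_witnesses) blast
      have Wge: "u \<le> Max (insert a W)" if "u \<in> insert a W" for u
        using W(1) that by (intro Max_ge) auto
      have "D \<inter> {a<..<z} \<subseteq> ?S" using az(1) by auto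
      then have "W \<subseteq> ?S" using W(2) by (rule subset_trans[rotated])
      then have "insert a W \<subseteq> insert y ?S" using a by blast
      moreover have "Max (insert a W) \<in> insert a W" using W(1) by (intro Max_in) auto
      ultimately have "Max (insert a W) \<in> insert y ?S" by (rule subsetD)
      moreover have "\<exists>t\<in>?S. M < t" if "M \<in> insert y ?S" for M
      proof (cases "M = y")
        case True
        then show ?thesis using lim(1) by auto
      next
        case False
        then show ?thesis using that lim(2) by blast
      qed
      ultimately obtain t where t: "t \<in> ?S" "Max (insert a W) < t"
        by (meson bexE)
      obtain a' where a': "a' \<in> ?S" "t \<le> a'" "\<forall>x\<in>D. a' < x \<longrightarrow> x < z \<longrightarrow> \<not> same_char c D s x z"
      proof (cases "\<exists>b\<in>?S. w < b")
        case True
        then obtain b where b: "b \<in> ?S" "w < b" by blast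
        show thesis
        proof (rule that)
          show "max t b \<in> ?S" using t(1) b(1) by (simp add: max_def)
          show "\<forall>x\<in>D. max t b < x \<longrightarrow> x < z \<longrightarrow> \<not> same_char c D s x z"
            using lim(4) b(2) by (metis less_trans max_less_iff_conj)
        qed simp
      next
        case False
        show thesis
        \<comment> \<open>No point of the interval exceeds \<open>w\<close>, for instance when
          \<open>z\<close> is an end point far above \<open>D\<close>. A point \<open>x\<close> with
          the character of \<open>z\<close> would put \<open>z\<close> into \<open>D\<close>, hence
          \<open>w\<close> as well by convexity; then \<open>w\<close> would be a last point of the
          interval.\<close>
        proof (rule that[OF t(1)])
          show "\<forall>x\<in>D. t < x \<longrightarrow> x < z \<longrightarrow> \<not> same_char c D s x z"
          proof (intro ballI impI notI)
            fix x assume x: "x \<in> D" "t < x" "x < z" "same_char c D s x z"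
            have xS: "x \<in> ?S" using x t(1) by (auto intro: less_trans)
            then obtain x' where x': "x' \<in> ?S" "x < x'" using lim(2) by blast
            have "x' \<le> w" using False x'(1) by (meson not_le)
            then have "x < w" using x'(2) by simp
            then have "w \<in> D" using convex[of x z w] x lim(3) unfolding same_char_def by blast
            then have "w \<in> ?S" using \<open>x < w\<close> xS lim(3) by (auto intro: less_trans)
            then show False using lim(2) False by blast
          qed
        qed simp
      qed
      have lt: "u < a'" if "u \<in> insert a W" for u
        using Wge[OF that] t(2) a'(2) by (meson le_less_trans less_le_trans)
      have a'z: "a' < z" "a' \<in> D" using a'(1) by auto
      have "W \<subseteq> D \<inter> {a<..<a'}"
      proof
        fix x assume "x \<in> W"
        then show "x \<in> D \<inter> {a<..<a'}" using subsetD[OF W(2), of x] lt[of x] by auto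
      qed
      moreover have "\<exists>V. reduct c D s y' z' V" if "y' < z'" "z' \<le> a'" for y' z'
        using less.IH[OF le_less_trans[OF that(2) a'z(1)] that(1)] .
      ultimately obtain V where V: "reduct c D s a a' V" "W \<subseteq> V"
        "\<And>w. w \<in> W \<Longrightarrow> eqv c s (V \<inter> {..<w}) (D \<inter> {a<..<w})"
        "\<And>w. w \<in> W \<Longrightarrow> eqv c s (V \<inter> {w<..}) (D \<inter> {w<..<a'})"
        using reduct_marked[OF W(1), of D a a' c s] lt[of a] by blast
      have "\<exists>x\<in>V. c x = c u \<and> eqv c s (V \<inter> {..<x}) (D \<inter> {a<..<u}) \<and>
          eqv c s (V \<inter> {x<..} \<union> D \<inter> {a'..<z}) (D \<inter> {u<..<z})" if u: "u \<in> D \<inter> {a<..<z}" for u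
      proof -
        obtain x where x: "x \<in> W" "c x = c u" "eqv c s (D \<inter> {a<..<x}) (D \<inter> {a<..<u})"
          "eqv c s (D \<inter> {x<..<z}) (D \<inter> {u<..<z})"
          using W(3)[OF u] by (auto simp: eqv_class_eq_iff)
        have xa: "x < a'" using lt x(1) by blast
        have "eqv c s (V \<inter> {x<..} \<union> D \<inter> {a'..<z}) (D \<inter> {x<..<z})"
          by (rule eqv_Un_before[OF V(4)[OF x(1)] eqv_refl refl, of _ _ a' a'])
            (use xa a'z reductD(1)[OF V(1)] in \<open>auto intro: less_trans less_le_trans\<close>)
        then show ?thesis
          using x V(2) eqv_trans[OF V(3)[OF x(1)] x(3)] eqv_trans by blast
      qed
      then show ?thesis using a' V(1) lt by blast
    qed
    define P where "P a a' V \<longleftrightarrow> a' \<in> ?S \<and> a < a' \<and> (\<forall>x\<in>D. a' < x \<longrightarrow> x < z \<longrightarrow> \<not> same_char c D s x z) \<and> reduct c D s a a' V \<and>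
        (\<forall>u\<in>D \<inter> {a<..<z}. \<exists>x\<in>V. c x = c u \<and> eqv c s (V \<inter> {..<x}) (D \<inter> {a<..<u}) \<and>
          eqv c s (V \<inter> {x<..} \<union> D \<inter> {a'..<z}) (D \<inter> {u<..<z}))" for a a' V
    have "\<forall>a\<in>insert y ?S. \<exists>a' V. P a a' V"
      unfolding P_def by (rule ballI) (rule step)
    then have "\<forall>a\<in>insert y ?S. \<exists>p. P a (fst p) (snd p)"
      by (simp only: split_paired_Ex fst_conv snd_conv)
    from bchoice[OF this] obtain f where f': "\<forall>a\<in>insert y ?S. P a (fst (f a)) (snd (f a))"
      by (rule exE)
    note f = bspec[OF f']
    define r where "r n = ((\<lambda>a. fst (f a)) ^^ n) y" for n
    have rSuc: "r (Suc n) = fst (f (r n))" for n unfolding r_def by simp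
    have r0: "r 0 = y" unfolding r_def by simp
    have rS: "r n \<in> insert y ?S" for n
    proof (induction n)
      case (Suc n)
      then show ?case using f[OF Suc] unfolding rSuc P_def by blast
    qed (simp add: r0)
    have Pr: "P (r n) (r (Suc n)) (snd (f (r n)))" for n
      unfolding rSuc using f[OF rS] .
    have "reduct c D s (r 0) z (\<Union>n. insert (r (Suc n)) (snd (f (r n))))"
    proof (rule reduct_omega)
      show "r n < r (Suc n)" "reduct c D s (r n) (r (Suc n)) (snd (f (r n)))" "r (Suc n) \<in> D" for n
        using Pr[of n] unfolding P_def by auto
      show "r n < z" for n using rS[of n] less.prems by auto
      show "\<exists>x\<in>snd (f (r n)). c x = c u \<and>
          eqv c s (snd (f (r n)) \<inter> {..<x}) (D \<inter> {r n<..<u}) \<and>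
          eqv c s (snd (f (r n)) \<inter> {x<..} \<union> D \<inter> {r (Suc n)..<z}) (D \<inter> {u<..<z})"
        if "u \<in> D \<inter> {r n<..<z}" for n u
        using Pr[of n] that unfolding P_def by blast
      show "\<not> same_char c D s x z" if "x \<in> D" "r 1 < x" "x < z" for x
        using Pr[of 0] that unfolding P_def One_nat_def by blast
    qed
    then show ?thesis unfolding r0 by blast
  qed
qed

text \<open>All of \<open>D\<close> is treated as the interval between \<open>bt\<close> and
  \<open>tp\<close>. Outside it \<open>D\<close> is empty, so the context clauses say that points of
  \<open>B\<close> keep their characters. The marked points realize every character, which raises
  the equivalence by one rank.\<close>

lemma ex_reduced:
  assumes finite_colors: "finite (range c)"
    and convex: "\<And>x z w. x \<in> D \<Longrightarrow> z \<in> D \<Longrightarrow> x < w \<Longrightarrow> w < z \<Longrightarrow> w \<in> D"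
    and bnd: "D \<subseteq> {bt<..<tp}" "bt < tp"
  shows "\<exists>B\<subseteq>D. eqv c (Suc (Suc s)) B D \<and> (\<forall>v\<in>B. reduced_at c D s bt B v)"
proof -
  let ?f = "\<lambda>x. (c x, eqv_class c (Suc s) (D \<inter> {..<x}), eqv_class c (Suc s) (D \<inter> {x<..}))"
  have "finite (?f ` D)"
    by (rule finite_subset[of _ "range c \<times> range (eqv_class c (Suc s)) \<times> range (eqv_class c (Suc s))"])
      (auto intro: finite_colors finite_range_eqv_class)
  then obtain W where W: "finite W" "W \<subseteq> D" "\<And>u. u \<in> D \<Longrightarrow> \<exists>w\<in>W. ?f w = ?f u"
    by (rule finite_witnesses) blast
  have "W \<subseteq> D \<inter> {bt<..<tp}" using W(2) bnd(1) by blast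
  moreover have "\<exists>V. reduct c D s y' z' V" if "y' < z'" "z' \<le> tp" for y' z'
    using finite_colors convex that(1) by (rule ex_reduct)
  ultimately have "\<exists>V. reduct c D s bt tp V \<and> W \<subseteq> V \<and>
      (\<forall>w\<in>W. eqv c s (V \<inter> {..<w}) (D \<inter> {bt<..<w}) \<and> eqv c s (V \<inter> {w<..}) (D \<inter> {w<..<tp}))"
    using bnd(2) by (intro reduct_marked[OF W(1)])
  then obtain B where B: "reduct c D s bt tp B" "W \<subseteq> B"
    by (elim exE conjE)
  note a = reductD[OF B(1)]
  have "x \<notin> {..bt}" "x \<notin> {tp..}" if "x \<in> D" for x
    using subsetD[OF bnd(1) that] by auto
  then have out: "D \<inter> {..bt} = {}" "D \<inter> {tp..} = {}"
    by blast+
  have BD: "B \<subseteq> D" using a(1) by blast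
  have BB: "eqv c (Suc s) (B \<inter> {..<v}) (D \<inter> {..<v}) \<and> eqv c (Suc s) (B \<inter> {v<..}) (D \<inter> {v<..})" if "v \<in> B" for v
    using a(5,6)[OF that] unfolding out by simp
  have "eqv c (Suc (Suc s)) B D"
  proof (rule eqv_SucI)
    fix v assume "v \<in> B"
    then show "\<exists>u\<in>D. c v = c u \<and> eqv c (Suc s) (B \<inter> {..<v}) (D \<inter> {..<u}) \<and> eqv c (Suc s) (B \<inter> {v<..}) (D \<inter> {u<..})"
      using BB BD by blast
  next
    fix u assume "u \<in> D"
    then obtain w where w: "w \<in> W" "c w = c u" "eqv c (Suc s) (D \<inter> {..<w}) (D \<inter> {..<u})"
      "eqv c (Suc s) (D \<inter> {w<..}) (D \<inter> {u<..})"
      using W(3)[of u] by (auto simp: eqv_class_eq_iff)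
    then have "w \<in> B" using B(2) by blast
    then show "\<exists>v\<in>B. c u = c v \<and> eqv c (Suc s) (D \<inter> {..<u}) (B \<inter> {..<v}) \<and> eqv c (Suc s) (D \<inter> {u<..}) (B \<inter> {v<..})"
      using w BB[of w] eqv_sym eqv_trans by (intro bexI[of _ w]) metis+
  qed
  then show ?thesis
    using BD a(7) by blast
qed

section \<open>Counting characters\<close>

text \<open>
  \<open>bt\<close> is a point below \<open>B\<close>; it makes \<open>limit_rank bt B (Suc n) z\<close> imply that \<open>B\<close> has points below \<open>z\<close>.
\<close>

primrec limit_rank :: "'a \<Rightarrow> 'a set \<Rightarrow> nat \<Rightarrow> 'a \<Rightarrow> bool" where
  "limit_rank bt B 0 z \<longleftrightarrow> True"
| "limit_rank bt B (Suc n) z \<longleftrightarrow> (\<forall>y\<in>insert bt B. y < z \<longrightarrow> (\<exists>x\<in>B. y < x \<and> x < z \<and> limit_rank bt B n x))"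

text \<open>Above the bound \<open>w\<close> provided by \<open>reduced_at\<close>, no point of
  \<open>B\<close> below \<open>z\<close> has the character of \<open>z\<close>. A point of rank
  \<open>n\<close> is therefore chosen above both \<open>w\<close> and \<open>y\<close>, and its own
  chain is kept above them too.\<close>

lemma limit_rank_chain:
  assumes "\<forall>v\<in>B. reduced_at c D s bt B v" "limit_rank bt B n z" "z \<in> B" "y \<in> insert bt B" "y < z"
  shows "\<exists>E\<subseteq>B \<inter> {y<..z}. finite E \<and> card E = Suc n \<and> pairwise (\<lambda>x x'. \<not> same_char c D s x x') E"
  using assms(2-)
proof (induction n arbitrary: z y)
  case 0
  then have "{z} \<subseteq> B \<inter> {y<..z}" by simp
  then show ?case by (intro exI[of _ "{z}"]) simp
next
  case (Suc n)
  obtain w where w': "w \<in> insert bt B" "w < z" "\<forall>x\<in>B. w < x \<longrightarrow> x < z \<longrightarrow> \<not> same_char c D s x z"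
    using bspec[OF assms(1) Suc.prems(2)] unfolding reduced_at_def by (elim bexE conjE)
  then have w: "w \<in> insert bt B" "w < z" "x \<in> B \<Longrightarrow> w < x \<Longrightarrow> x < z \<Longrightarrow> \<not> same_char c D s x z" for x
    by simp_all
  define m where "m = max y w"
  have m: "m \<in> insert bt B" "m < z" "y \<le> m" "w \<le> m"
    unfolding m_def using w(1,2) Suc.prems(3,4) by (auto simp: max_def[of y w] not_le)
  obtain x where x: "x \<in> B" "m < x" "x < z" "limit_rank bt B n x"
    using mp[OF bspec[OF Suc.prems(1)[unfolded limit_rank.simps] m(1)] m(2)] by (elim bexE conjE)
  obtain E where E: "E \<subseteq> B \<inter> {m<..x}" "finite E" "card E = Suc n" "pairwise (\<lambda>x x'. \<not> same_char c D s x x') E"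
    using Suc.IH[OF x(4,1) m(1) x(2)] by (elim exE conjE)
  have e: "u \<in> B \<and> y < u \<and> w < u \<and> u < z" if "u \<in> E" for u
  proof -
    have "u \<in> B" "m < u" "u \<le> x" using subsetD[OF E(1) that] by auto
    then show ?thesis using m x(3) by auto
  qed
  have "z \<notin> E" using e less_irrefl by blast
  then have "card (insert z E) = Suc (Suc n)"
    using E(2,3) by simp
  moreover have "pairwise (\<lambda>x x'. \<not> same_char c D s x x') (insert z E)"
  proof -
    have "\<not> same_char c D s z u \<and> \<not> same_char c D s u z" if "u \<in> E" for u
      using w(3)[of u] e[OF that] same_char_sym[of c D s z u] by blast
    then show ?thesis
      using E(4) by (simp add: pairwise_insert)
  qed
  moreover have "insert z E \<subseteq> B \<inter> {y<..z}"
    using e Suc.prems(2,4) less_imp_le by auto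
  ultimately show ?case
    using E(2) by (intro exI[of _ "insert z E"]) simp
qed

text \<open>Supplies the lower end \<open>y\<close> for a chain: all points above \<open>y\<close>
  then have at least \<open>N\<close> predecessors.\<close>

lemma limit_rank_many_below:
  assumes "limit_rank bt B (Suc n) z" "bt < z"
  shows "\<exists>y\<in>insert bt B. y < z \<and> (\<exists>F\<subseteq>B \<inter> {..y}. finite F \<and> card F = N)"
proof (induction N)
  case 0
  then show ?case using assms(2) by (intro bexI[of _ bt] conjI exI[of _ "{}"]) simp_all
next
  case (Suc N)
  obtain y F where y: "y \<in> insert bt B" "y < z" and F: "F \<subseteq> B \<inter> {..y}" "finite F" "card F = N"
    using Suc.IH by (elim bexE conjE exE)
  obtain x where x: "x \<in> B" "y < x" "x < z"
    using mp[OF bspec[OF assms(1)[unfolded limit_rank.simps] y(1)] y(2)] by (elim bexE conjE)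
  have lt: "u \<in> B \<and> u < x" if "u \<in> F" for u
    using subsetD[OF F(1) that] x(2) by auto
  have "insert x F \<subseteq> B \<inter> {..x}"
    using lt x(1) less_imp_le by auto
  moreover have "x \<notin> F"
    using lt less_irrefl by blast
  ultimately show ?case
    using x(1,3) F(2,3) by (intro bexI[of _ x] conjI exI[of _ "insert x F"]) simp_all
qed

text \<open>The set \<open>F\<close> only guarantees that \<open>D\<close> is large enough; the
  points themselves are obtained by repeatedly adding the least point not yet taken.\<close>

lemma first_elements:
  assumes "F \<subseteq> D" "finite F" "card F = N"
  shows "\<exists>P\<subseteq>D. finite P \<and> card P = N \<and> (\<forall>x\<in>P. finite (D \<inter> {..<x}) \<and> card (D \<inter> {..<x}) < N)"
  using assms
proof (induction N arbitrary: F)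
  case 0
  then show ?case by (intro exI[of _ "{}"]) auto
next
  case (Suc N)
  then obtain f where "f \<in> F" by fastforce
  then have "F - {f} \<subseteq> D" "finite (F - {f})" "card (F - {f}) = N"
    using Suc.prems by auto
  from Suc.IH[OF this] obtain P where P: "P \<subseteq> D" "finite P" "card P = N"
    "\<forall>x\<in>P. finite (D \<inter> {..<x}) \<and> card (D \<inter> {..<x}) < N"
    by (elim exE conjE)
  have "\<not> D \<subseteq> P"
    using Suc.prems P card_mono[of P F] by (metis Suc_n_not_le_n subset_trans)
  then obtain x0 where x0: "x0 \<in> D - P" by blast
  define x where "x = (LEAST x. x \<in> D - P)"
  have x: "x \<in> D" "x \<notin> P" using LeastI[of "\<lambda>x. x \<in> D - P", OF x0] unfolding x_def by auto
  have "D \<inter> {..<x} \<subseteq> P"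
    using not_less_Least[of _ "\<lambda>x. x \<in> D - P"] unfolding x_def by blast
  then have "finite (D \<inter> {..<x})" "card (D \<inter> {..<x}) \<le> N"
    using P(2,3) finite_subset card_mono by blast+
  then have "\<forall>x'\<in>insert x P. finite (D \<inter> {..<x'}) \<and> card (D \<inter> {..<x'}) < Suc N"
    using P(4) less_SucI le_imp_less_Suc by blast
  then show ?case
    using P(1-3) x by (intro exI[of _ "insert x P"]) simp
qed

text \<open>The left type of rank \<open>Suc s\<close> fixes the number of predecessors when this is
  below \<open>2 ^ Suc s - 1\<close>, and in a linear order a finite number of predecessors fixes
  the point.\<close>

lemma same_char_first_elements:
  assumes "same_char c D s x y" "finite (D \<inter> {..<x})" "card (D \<inter> {..<x}) < 2 ^ Suc s - 1"
  shows "x = y"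
proof -
  have no: False if "same_char c D s x y" "finite (D \<inter> {..<x})" "card (D \<inter> {..<x}) < 2 ^ Suc s - 1" "x < y" for x y
  proof -
    have sub: "insert x (D \<inter> {..<x}) \<subseteq> D \<inter> {..<y}"
      using that(1,4) less_trans[OF _ that(4)] unfolding same_char_def by auto
    have fin: "finite (insert x (D \<inter> {..<x}))"
      using that(2) by simp
    have card: "card (insert x (D \<inter> {..<x})) = Suc (card (D \<inter> {..<x}))"
      using that(2) by (intro card_insert_disjoint) auto
    have lt: "Suc (card (D \<inter> {..<x})) < 2 ^ Suc s"
      using that(3) by linarith
    have "eqv c (Suc s) (D \<inter> {..<x}) (D \<inter> {..<y})"
      using that(1) unfolding same_char_def by simp
    from eqv_card_ge[OF this lt sub fin card]
    obtain E where E: "E \<subseteq> D \<inter> {..<x}" "card E = Suc (card (D \<inter> {..<x}))"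
      by (elim exE conjE)
    show False
      using card_mono[OF that(2) E(1)] E(2) by simp
  qed
  have "\<not> x < y"
    using no[OF assms] by blast
  moreover have "\<not> y < x"
  proof
    assume yx: "y < x"
    have "D \<inter> {..<y} \<subseteq> D \<inter> {..<x}" using less_trans[OF _ yx] by auto
    then have "finite (D \<inter> {..<y})" "card (D \<inter> {..<y}) \<le> card (D \<inter> {..<x})"
      using assms(2) finite_subset card_mono by blast+
    then show False
      using no[OF same_char_sym[OF assms(1)] _ _ yx] assms(3) by linarith
  qed
  ultimately show ?thesis by (meson linorder_cases)
qed

text \<open>The initial points have characters that occur only once; the chain is placed above
  \<open>N\<close> points and so avoids them. A chain for rank \<open>Suc n\<close> has
  \<open>Suc (Suc n)\<close> members, counting \<open>z\<close> itself.\<close>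

lemma many_characters:
  assumes rd: "\<forall>v\<in>B. reduced_at c D s bt B v" and "B \<subseteq> D" and bt: "D \<subseteq> {bt<..}"
    and rz: "limit_rank bt B (Suc n) z" and z: "z \<in> B"
  shows "\<exists>Q\<subseteq>D. finite Q \<and> card Q = 2 ^ Suc s - 1 + Suc (Suc n) \<and> pairwise (\<lambda>x x'. \<not> same_char c D s x x') Q"
proof -
  define N :: nat where "N = 2 ^ Suc s - 1"
  have "bt < z" using z assms(2) bt by blast
  then obtain y F where y: "y \<in> insert bt B" "y < z" "F \<subseteq> B \<inter> {..y}" "finite F" "card F = N"
    using limit_rank_many_below[OF rz] by blast
  obtain E where E: "E \<subseteq> B \<inter> {y<..z}" "finite E" "card E = Suc (Suc n)" "pairwise (\<lambda>x x'. \<not> same_char c D s x x') E"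
    using limit_rank_chain[OF rd rz z y(1,2)] by blast
  obtain P where P: "P \<subseteq> D" "finite P" "card P = N"
    "\<And>x. x \<in> P \<Longrightarrow> finite (D \<inter> {..<x}) \<and> card (D \<inter> {..<x}) < N"
    using first_elements[of F D N] y assms(2) by blast
  have uniq: "x = x'" if "x \<in> P" "same_char c D s x x'" for x x'
    using same_char_first_elements[OF that(2)] P(4)[OF that(1)] unfolding N_def by blast
  have "x \<notin> P" if "x \<in> E" for x
  proof
    assume x: "x \<in> P"
    have "y < x" using that E(1) by auto
    then have "F \<subseteq> D \<inter> {..<x}" using y(3) assms(2) by (auto intro: le_less_trans)
    then have "N \<le> card (D \<inter> {..<x})" using P(4)[OF x] card_mono y(5) by blast
    then show False using P(4)[OF x] by simp
  qed
  then have disj: "P \<inter> E = {}" by blast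
  have "pairwise (\<lambda>x x'. \<not> same_char c D s x x') (P \<union> E)"
    using E(4) uniq same_char_sym unfolding pairwise_def by blast
  moreover have "card (P \<union> E) = N + Suc (Suc n)"
    using card_Un_disjoint[OF P(2) E(2) disj] P(3) E(3) by simp
  moreover have "P \<union> E \<subseteq> D" using P(1) E(1) assms(2) by blast
  ultimately show ?thesis
    unfolding N_def[symmetric] using P(2) E(2) by blast
qed

section \<open>Splitting equivalence and first-order equivalence\<close>

text \<open>
  \<open>P\<close> is the set of pairs of points chosen so far, together with the two end points \<open>bt\<close> and \<open>tp\<close>.
\<close>

definition game :: "('a \<Rightarrow> nat) \<Rightarrow> 'a \<Rightarrow> 'a \<Rightarrow> 'a set \<Rightarrow> 'a set \<Rightarrow> nat \<Rightarrow> ('a \<times> 'a) set \<Rightarrow> bool" where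
  "game c bt tp X Y r P \<longleftrightarrow> finite P \<and>
     (\<forall>(a, b)\<in>P. (a \<in> X \<longleftrightarrow> b \<in> Y) \<and> (a \<in> X \<longrightarrow> c a = c b)) \<and>
     (\<forall>(a, b)\<in>P. \<forall>(a', b')\<in>P. (a < a' \<longleftrightarrow> b < b') \<and> eqv c r (X \<inter> {a<..<a'}) (Y \<inter> {b<..<b'})) \<and>
     (bt, bt) \<in> P \<and> (tp, tp) \<in> P \<and> X \<subseteq> {bt<..<tp} \<and> Y \<subseteq> {bt<..<tp}"

lemma gameD:
  assumes "game c bt tp X Y r P" "(a, b) \<in> P"
  shows "a \<in> X \<longleftrightarrow> b \<in> Y" "a \<in> X \<Longrightarrow> c a = c b"
    "(a', b') \<in> P \<Longrightarrow> a < a' \<longleftrightarrow> b < b'" "(a', b') \<in> P \<Longrightarrow> a = a' \<longleftrightarrow> b = b'"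
    "(a', b') \<in> P \<Longrightarrow> eqv c r (X \<inter> {a<..<a'}) (Y \<inter> {b<..<b'})"
proof -
  show "a \<in> X \<longleftrightarrow> b \<in> Y" "a \<in> X \<Longrightarrow> c a = c b"
    "(a', b') \<in> P \<Longrightarrow> eqv c r (X \<inter> {a<..<a'}) (Y \<inter> {b<..<b'})"
    using assms unfolding game_def by fast+
  have o: "a < a' \<longleftrightarrow> b < b'" if "(a, b) \<in> P" "(a', b') \<in> P" for a b a' b'
    using assms(1) that unfolding game_def by fast
  then show "(a', b') \<in> P \<Longrightarrow> a < a' \<longleftrightarrow> b < b'"
    using assms(2) .
  show "(a', b') \<in> P \<Longrightarrow> a = a' \<longleftrightarrow> b = b'"
    using o[OF assms(2), of a' b'] o[OF _ assms(2), of a' b'] by (metis less_irrefl neq_iff)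
qed

text \<open>The new point falls into the gap between its nearest chosen neighbours \<open>a0\<close>
  and \<open>a1\<close>, and the answer is taken from the corresponding gap. Intervals reaching
  further are glued from a part of this gap and an old interval.\<close>

lemma game_extend:
  assumes G: "game c bt tp X Y (Suc r) P" and s: "s \<in> X"
  shows "\<exists>t\<in>Y. game c bt tp X Y r (insert (s, t) P)"
proof -
  have D5: "eqv c r (X \<inter> {a<..<a'}) (Y \<inter> {b<..<b'})" if "(a, b) \<in> P" "(a', b') \<in> P" for a b a' b'
    using eqv_Suc_D[OF gameD(5)[OF G that]] .
  show ?thesis
  proof (cases "\<exists>b. (s, b) \<in> P")
    case True
    then obtain b where b: "(s, b) \<in> P" by blast
    have "game c bt tp X Y r P"
      using G gameD(3)[OF G] D5 unfolding game_def by auto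
    then show ?thesis
      using gameD(1)[OF G b] s b by (metis insert_absorb)
  next
    case False
    note D = gameD[OF G]
    have fin: "finite P" using G unfolding game_def by simp
    have b_t: "bt < s" "s < tp" "(bt, bt) \<in> P" "(tp, tp) \<in> P"
      using G s unfolding game_def by auto
    have "finite {a \<in> fst ` P. a < s}" "{a \<in> fst ` P. a < s} \<noteq> {}"
      using fin b_t by force+
    note lo = Max_in[OF this] Max_ge[OF this(1)]
    have "finite {a \<in> fst ` P. s < a}" "{a \<in> fst ` P. s < a} \<noteq> {}"
      using fin b_t by force+
    note hi = Min_in[OF this] Min_le[OF this(1)]
    obtain a0 b0 where 0: "(a0, b0) \<in> P" "a0 < s" "\<And>a b. (a, b) \<in> P \<Longrightarrow> a < s \<Longrightarrow> a \<le> a0"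
      using lo by force
    obtain a1 b1 where 1: "(a1, b1) \<in> P" "s < a1" "\<And>a b. (a, b) \<in> P \<Longrightarrow> s < a \<Longrightarrow> a1 \<le> a"
      using hi by force
    have "s \<in> X \<inter> {a0<..<a1}" using s 0 1 by simp
    with D(5)[OF 0(1) 1(1)] obtain t where t: "t \<in> Y \<inter> {b0<..<b1}" "c s = c t"
      "eqv c r (X \<inter> {a0<..<a1} \<inter> {..<s}) (Y \<inter> {b0<..<b1} \<inter> {..<t})"
      "eqv c r (X \<inter> {a0<..<a1} \<inter> {s<..}) (Y \<inter> {b0<..<b1} \<inter> {t<..})"
      by (rule eqv_forthE)
    have t': "t \<in> Y" "b0 < t" "t < b1" using t(1) by auto
    have sets: "X \<inter> {a0<..<a1} \<inter> {..<s} = X \<inter> {a0<..<s}" "X \<inter> {a0<..<a1} \<inter> {s<..} = X \<inter> {s<..<a1}"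
      "Y \<inter> {b0<..<b1} \<inter> {..<t} = Y \<inter> {b0<..<t}" "Y \<inter> {b0<..<b1} \<inter> {t<..} = Y \<inter> {t<..<b1}"
      using 0 1 t' by auto
    note e = t(3,4)[unfolded sets]
    have below: "b \<le> b0" "b < t" if "(a, b) \<in> P" "a < s" for a b
    proof -
      have "a < a0 \<or> a = a0" using 0(3)[OF that] by auto
      then show "b \<le> b0" using D(3,4)[OF that(1) 0(1)] by auto
      then show "b < t" using t'(2) by (rule le_less_trans)
    qed
    have above: "b1 \<le> b" "t < b" if "(a, b) \<in> P" "s < a" for a b
    proof -
      have "a1 < a \<or> a1 = a" using 1(3)[OF that] by auto
      then show "b1 \<le> b" using D(3,4)[OF 1(1) that(1)] by auto
      with t'(3) show "t < b" by (rule less_le_trans)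
    qed
    have cmp: "a < s \<or> s < a" if "(a, b) \<in> P" for a b
      using that False by (metis neq_iff)
    have eb: "eqv c r (X \<inter> {a<..<s}) (Y \<inter> {b<..<t})" if ab: "(a, b) \<in> P" for a b
    proof (cases "a < s")
      case True
      show ?thesis
      proof (cases "a = a0")
        case True
        then show ?thesis using e(1) D(4)[OF ab 0(1)] by simp
      next
        case False
        then have lt: "a < a0" "b < b0" using 0(3)[OF ab True] D(3)[OF ab 0(1)] by auto
        have "eqv c r (X \<inter> {a0..<s}) (Y \<inter> {b0..<t})"
        proof (cases "a0 \<in> X")
          case True
          show ?thesis
            by (rule eqv_insert[OF eqv_refl[of _ _ "{}"] e(1) D(2)[OF 0(1) True]])
              (use True D(1)[OF 0(1)] 0 t' in auto)
        next
          case False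
          then have "X \<inter> {a0..<s} = X \<inter> {a0<..<s}" "Y \<inter> {b0..<t} = Y \<inter> {b0<..<t}"
            using D(1)[OF 0(1)] by (auto simp: less_le)
          then show ?thesis using e(1) by simp
        qed
        then show ?thesis
          by (rule eqv_Un_before[OF eqv_Suc_D[OF D(5)[OF ab 0(1)]]]) (use lt 0 t' in auto)
      qed
    next
      case F: False
      then have "s < a" using cmp[OF ab] by blast
      then have "X \<inter> {a<..<s} = {}" "Y \<inter> {b<..<t} = {}"
        using above[OF ab] by auto
      then show ?thesis by simp
    qed
    have ea: "eqv c r (X \<inter> {s<..<a}) (Y \<inter> {t<..<b})" if ab: "(a, b) \<in> P" for a b
    proof (cases "s < a")
      case True
      show ?thesis
      proof (cases "a1 = a")
        case True
        then show ?thesis using e(2) D(4)[OF 1(1) ab] by simp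
      next
        case False
        then have lt: "a1 < a" "b1 < b" using 1(3)[OF ab True] D(3)[OF 1(1) ab] by auto
        have "eqv c r (X \<inter> {s<..a1}) (Y \<inter> {t<..b1})"
        proof (cases "a1 \<in> X")
          case True
          show ?thesis
            by (rule eqv_insert[OF e(2) eqv_refl[of _ _ "{}"] D(2)[OF 1(1) True]])
              (use True D(1)[OF 1(1)] 1 t' in auto)
        next
          case False
          then have "X \<inter> {s<..a1} = X \<inter> {s<..<a1}" "Y \<inter> {t<..b1} = Y \<inter> {t<..<b1}"
            using D(1)[OF 1(1)] by (auto simp: less_le)
          then show ?thesis using e(2) by simp
        qed
        then show ?thesis
          by (rule eqv_Un_at[OF _ eqv_Suc_D[OF D(5)[OF 1(1) ab]]]) (use lt 1 t' in auto)
      qed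
    next
      case F: False
      then have "a < s" using cmp[OF ab] by blast
      then have "X \<inter> {s<..<a} = {}" "Y \<inter> {t<..<b} = {}"
        using below[OF ab] by auto
      then show ?thesis by simp
    qed
    have ord: "(a < s \<longleftrightarrow> b < t) \<and> (s < a \<longleftrightarrow> t < b)" if "(a, b) \<in> P" for a b
      using below[OF that] above[OF that] cmp[OF that] by auto
    have "game c bt tp X Y r (insert (s, t) P)"
      unfolding game_def
    proof (intro conjI)
      show "\<forall>(a, b)\<in>insert (s, t) P. (a \<in> X \<longleftrightarrow> b \<in> Y) \<and> (a \<in> X \<longrightarrow> c a = c b)"
        using D(1,2) s t' t(2) by auto
      show "\<forall>(a, b)\<in>insert (s, t) P. \<forall>(a', b')\<in>insert (s, t) P.
          (a < a' \<longleftrightarrow> b < b') \<and> eqv c r (X \<inter> {a<..<a'}) (Y \<inter> {b<..<b'})"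
        using ord ea eb D(3) D5 by auto
      show "X \<subseteq> {bt<..<tp}" "Y \<subseteq> {bt<..<tp}"
        using G unfolding game_def by simp_all
    qed (use fin b_t in simp_all)
    then show ?thesis using t'(1) by blast
  qed
qed

text \<open>A color-preserving order embedding into the ambient well-order. It lets structures on
  different types be compared as subsets of one order.\<close>

definition represents :: "nat \<Rightarrow> ('a \<Rightarrow> nat) \<Rightarrow> ('b \<Rightarrow> 'a) \<Rightarrow> 'b cstruct \<Rightarrow> bool" where
  "represents d c g M \<longleftrightarrow>
     (\<forall>x\<in>dom_of M. \<forall>y\<in>dom_of M. ((x, y) \<in> le M \<and> x \<noteq> y \<longleftrightarrow> g x < g y) \<and> (x = y \<longleftrightarrow> g x = g y)) \<and>
     (\<forall>x\<in>dom_of M. \<forall>i<d. x \<in> clr M i \<longleftrightarrow> c (g x) = i) \<and> (\<forall>x\<in>dom_of M. c (g x) < d)"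

lemma representsD:
  assumes "represents d c g M" "x \<in> dom_of M"
  shows "y \<in> dom_of M \<Longrightarrow> (x, y) \<in> le M \<and> x \<noteq> y \<longleftrightarrow> g x < g y" "y \<in> dom_of M \<Longrightarrow> x = y \<longleftrightarrow> g x = g y"
    "i < d \<Longrightarrow> x \<in> clr M i \<longleftrightarrow> c (g x) = i" "c (g x) < d"
  using assms unfolding represents_def by blast+

lemma game_sym:
  assumes "game c bt tp X Y r P"
  shows "game c bt tp Y X r (prod.swap ` P)"
proof -
  have "(b \<in> Y \<longleftrightarrow> a \<in> X) \<and> (b \<in> Y \<longrightarrow> c b = c a)" if "(a, b) \<in> P" for a b
    using gameD(1,2)[OF assms that] by auto
  moreover have "(b < b' \<longleftrightarrow> a < a') \<and> eqv c r (Y \<inter> {b<..<b'}) (X \<inter> {a<..<a'})"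
    if "(a, b) \<in> P" "(a', b') \<in> P" for a b a' b'
    using gameD(3,5)[OF assms that] eqv_sym by auto
  moreover have "finite P" "(bt, bt) \<in> prod.swap ` P" "(tp, tp) \<in> prod.swap ` P" "X \<subseteq> {bt<..<tp}" "Y \<subseteq> {bt<..<tp}"
    using assms unfolding game_def by (simp, force, force, simp, simp)
  ultimately show ?thesis
    unfolding game_def by (simp add: split_beta)
qed

text \<open>Each quantifier spends one round. Only values at free variables are tied to the game, so
  sentences are covered also in empty structures.\<close>

lemma sat_game:
  fixes M :: "'b cstruct" and N :: "'c cstruct" and g :: "'b \<Rightarrow> 'a" and h :: "'c \<Rightarrow> 'a"
  assumes M: "represents d c g M" and N: "represents d c h N"
    and G: "game c bt tp (g ` dom_of M) (h ` dom_of N) r P"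
    and \<phi>: "qr \<phi> \<le> r" "colors_in \<phi> \<subseteq> {..<d}"
    and vw: "\<And>x. x \<in> fv \<phi> \<Longrightarrow> v x \<in> dom_of M \<and> w x \<in> dom_of N \<and> (g (v x), h (w x)) \<in> P"
  shows "sat M v \<phi> \<longleftrightarrow> sat N w \<phi>"
  using G \<phi> vw
proof (induction \<phi> arbitrary: r P v w)
  case (Eq x y)
  have "v x \<in> dom_of M" "v y \<in> dom_of M" "w x \<in> dom_of N" "w y \<in> dom_of N"
    "(g (v x), h (w x)) \<in> P" "(g (v y), h (w y)) \<in> P"
    using Eq.prems(4) by auto
  then show ?case
    using gameD(4)[OF Eq.prems(1)] representsD(2)[OF M] representsD(2)[OF N] by simp
next
  case (Less x y)
  have "v x \<in> dom_of M" "v y \<in> dom_of M" "w x \<in> dom_of N" "w y \<in> dom_of N"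
    "(g (v x), h (w x)) \<in> P" "(g (v y), h (w y)) \<in> P"
    using Less.prems(4) by auto
  then show ?case
    using gameD(3)[OF Less.prems(1)] representsD(1)[OF M] representsD(1)[OF N] by simp
next
  case (Col i x)
  have *: "v x \<in> dom_of M" "w x \<in> dom_of N" "(g (v x), h (w x)) \<in> P" "i < d"
    using Col.prems(3,4) by auto
  then have "c (g (v x)) = c (h (w x))"
    using gameD(2)[OF Col.prems(1)] by blast
  then show ?case
    using * representsD(3)[OF M] representsD(3)[OF N] by simp
next
  case (Neg \<phi>)
  then show ?case by simp
next
  case (And \<phi> \<psi>)
  have "sat M v \<phi> \<longleftrightarrow> sat N w \<phi>"
    by (rule And.IH(1)[OF And.prems(1)]) (use And.prems in auto)
  moreover have "sat M v \<psi> \<longleftrightarrow> sat N w \<psi>"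
    by (rule And.IH(2)[OF And.prems(1)]) (use And.prems in auto)
  ultimately show ?case by simp
next
  case (Ex x \<phi>)
  then obtain r' where r': "r = Suc r'" by (cases r) auto
  have step: "sat M (v(x := a)) \<phi> \<longleftrightarrow> sat N (w(x := b)) \<phi>"
    if "a \<in> dom_of M" "b \<in> dom_of N" "game c bt tp (g ` dom_of M) (h ` dom_of N) r' (insert (g a, h b) P)" for a b
    by (rule Ex.IH[OF that(3)]) (use that Ex.prems r' in auto)
  have 1: "\<exists>b\<in>dom_of N. game c bt tp (g ` dom_of M) (h ` dom_of N) r' (insert (g a, h b) P)" if "a \<in> dom_of M" for a
    using game_extend[OF Ex.prems(1)[unfolded r'], of "g a"] that by auto
  have 2: "\<exists>a\<in>dom_of M. game c bt tp (g ` dom_of M) (h ` dom_of N) r' (insert (g a, h b) P)" if "b \<in> dom_of N" for b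
  proof -
    have "game c bt tp (h ` dom_of N) (g ` dom_of M) (Suc r') (prod.swap ` P)"
      using game_sym[OF Ex.prems(1)[unfolded r']] .
    from game_extend[OF this imageI[OF that]]
    obtain a where a: "a \<in> dom_of M" "game c bt tp (h ` dom_of N) (g ` dom_of M) r' (insert (h b, g a) (prod.swap ` P))"
      by (elim bexE imageE) simp
    have "game c bt tp (g ` dom_of M) (h ` dom_of N) r' (prod.swap ` insert (h b, g a) (prod.swap ` P))"
      by (rule game_sym[OF a(2)])
    moreover have "prod.swap ` insert (h b, g a) (prod.swap ` P) = insert (g a, h b) P"
      by (simp add: image_image)
    ultimately show ?thesis using a(1) by auto
  qed
  show ?case
    unfolding sat.simps using step 1 2 by blast
qed auto

lemma eqv_imp_equiv_q:
  fixes M :: "'b cstruct" and N :: "'c cstruct" and g :: "'b \<Rightarrow> 'a" and h :: "'c \<Rightarrow> 'a"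
  assumes "represents d c g M" "represents d c h N"
    and bd: "g ` dom_of M \<subseteq> {bt<..<tp}" "h ` dom_of N \<subseteq> {bt<..<tp}" "bt < tp"
    and e: "eqv c r (g ` dom_of M) (h ` dom_of N)"
  shows "equiv_q d r M N"
proof -
  have "g ` dom_of M \<inter> {bt<..<tp} = g ` dom_of M" "h ` dom_of N \<inter> {bt<..<tp} = h ` dom_of N"
    using bd by blast+
  moreover have "g ` dom_of M \<inter> {tp<..<bt} = {}" "h ` dom_of N \<inter> {tp<..<bt} = {}"
    using bd(3) by auto
  moreover have "bt \<notin> g ` dom_of M" "tp \<notin> g ` dom_of M" "bt \<notin> h ` dom_of N" "tp \<notin> h ` dom_of N"
    using bd by auto
  ultimately have G: "game c bt tp (g ` dom_of M) (h ` dom_of N) r {(bt, bt), (tp, tp)}"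
    unfolding game_def using e bd by simp
  have "models M \<phi> \<longleftrightarrow> models N \<phi>" if "sentence d \<phi>" "qr \<phi> \<le> r" for \<phi>
  proof -
    have "sat M (\<lambda>_. undefined) \<phi> \<longleftrightarrow> sat N (\<lambda>_. undefined) \<phi>"
      by (rule sat_game[OF assms(1,2) G]) (use that in \<open>auto simp: sentence_def\<close>)
    then show ?thesis
      using that models_sentence unfolding sentence_def by metis
  qed
  then show ?thesis unfolding equiv_q_def by blast
qed

text \<open>The characteristic formula of rank \<open>Suc r\<close> gives each new point a partner
  for which the rank \<open>r\<close> formula of the extended tuple holds. The claim concerns
  intervals between any two named points or end points, because a move splits one such interval into
  two.\<close>

lemma charfm_imp_eqv:
  fixes M :: "'b cstruct" and N :: "'c cstruct" and g :: "'b \<Rightarrow> 'a" and h :: "'c \<Rightarrow> 'a"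
  assumes M: "represents d c g M" and N: "represents d c h N"
    and bd: "g ` dom_of M \<subseteq> {bt<..<tp}" "h ` dom_of N \<subseteq> {bt<..<tp}"
    and "sat N w (charfm d M r n v)" "v ` {..<n} \<subseteq> dom_of M" "w ` {..<n} \<subseteq> dom_of N"
    and "(a, b) \<in> insert (bt, bt) (insert (tp, tp) ((\<lambda>i. (g (v i), h (w i))) ` {..<n}))"
    and "(a', b') \<in> insert (bt, bt) (insert (tp, tp) ((\<lambda>i. (g (v i), h (w i))) ` {..<n}))"
  shows "eqv c r (g ` dom_of M \<inter> {a<..<a'}) (h ` dom_of N \<inter> {b<..<b'})"
  using assms(5-)
proof (induction r arbitrary: n v w a b a' b')
  case (Suc r)
  let ?P = "\<lambda>(n::nat) v w. insert (bt, bt) (insert (tp, tp) ((\<lambda>i. (g (v i), h (w i))) ` {..<n}))"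
  let ?c = "\<lambda>x. charfm d M r (Suc n) (v(n := x))"
  note fin = finite_charfm_image[of d M r "Suc n" "\<lambda>x. v(n := x)" "dom_of M"]
  have forth: "\<exists>y\<in>dom_of N. sat N (w(n := y)) (?c x)" if "x \<in> dom_of M" for x
    using Suc.prems(1) that fin by (auto simp: Let_def sat_Conjs)
  have backw: "\<exists>x\<in>dom_of M. sat N (w(n := y)) (?c x)" if "y \<in> dom_of N" for y
    using Suc.prems(1) that fin by (auto simp: Let_def sat_Disjs)
  \<comment> \<open>The partner falls into the corresponding interval because its order relative to
    the earlier points is expressed by formulas \<open>Less\<close> of rank 0.\<close>
  have ord: "(g x < p \<longleftrightarrow> h y < p') \<and> (p < g x \<longleftrightarrow> p' < h y)"
    if xy: "x \<in> dom_of M" "y \<in> dom_of N" "sat N (w(n := y)) (?c x)" and p: "(p, p') \<in> ?P n v w" for x y p p'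
  proof -
    have gx: "bt < g x" "g x < tp" "bt < h y" "h y < tp"
      using subsetD[OF bd(1) imageI[OF xy(1)]] subsetD[OF bd(2) imageI[OF xy(2)]] by simp_all
    consider "p = bt" "p' = bt" | "p = tp" "p' = tp" | i where "i < n" "p = g (v i)" "p' = h (w i)"
      using p by (elim insertE imageE) simp_all
    then show ?thesis
    proof cases
      case 1
      then show ?thesis using gx by auto
    next
      case 2
      then show ?thesis using gx by auto
    next
      case (3 i)
      have vi: "v i \<in> dom_of M" "w i \<in> dom_of N" using Suc.prems(2,3) 3(1) by auto
      have sub: "(v(n := x)) ` {..<Suc n} \<subseteq> dom_of M"
        using Suc.prems(2) xy(1) by (auto simp: less_Suc_eq)
      have "sat M (v(n := x)) (Less i n) \<longleftrightarrow> sat N (w(n := y)) (Less i n)"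
        "sat M (v(n := x)) (Less n i) \<longleftrightarrow> sat N (w(n := y)) (Less n i)"
        using sat_charfm_imp[OF xy(3) sub, of "Less i n" id] sat_charfm_imp[OF xy(3) sub, of "Less n i" id] 3(1)
        by auto
      then have "(v i, x) \<in> le M \<and> v i \<noteq> x \<longleftrightarrow> (w i, y) \<in> le N \<and> w i \<noteq> y"
        "(x, v i) \<in> le M \<and> x \<noteq> v i \<longleftrightarrow> (y, w i) \<in> le N \<and> y \<noteq> w i"
        using 3(1) by simp_all
      then show ?thesis
        unfolding 3(2,3)
        using representsD(1)[OF M vi(1) xy(1)] representsD(1)[OF N vi(2) xy(2)]
          representsD(1)[OF M xy(1) vi(1)] representsD(1)[OF N xy(2) vi(2)] by simp
    qed
  qed
  have step: "c (g x) = c (h y) \<and>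
      eqv c r (g ` dom_of M \<inter> {a<..<a'} \<inter> {..<g x}) (h ` dom_of N \<inter> {b<..<b'} \<inter> {..<h y}) \<and>
      eqv c r (g ` dom_of M \<inter> {a<..<a'} \<inter> {g x<..}) (h ` dom_of N \<inter> {b<..<b'} \<inter> {h y<..})"
    if xy: "x \<in> dom_of M" "y \<in> dom_of N" "sat N (w(n := y)) (?c x)"
      and i: "a < g x" "g x < a'" "b < h y" "h y < b'" for x y
  proof -
    have sub: "(v(n := x)) ` {..<Suc n} \<subseteq> dom_of M" "(w(n := y)) ` {..<Suc n} \<subseteq> dom_of N"
      using Suc.prems(2,3) xy by (auto simp: less_Suc_eq)
    have P: "?P (Suc n) (v(n := x)) (w(n := y)) = insert (g x, h y) (?P n v w)"
      by (auto simp: less_Suc_eq)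
    have cd: "c (g x) < d" using representsD(4)[OF M xy(1)] .
    have "sat M (v(n := x)) (Col (c (g x)) n) \<longleftrightarrow> sat N (w(n := y)) (Col (c (g x)) n)"
      using sat_charfm_imp[OF xy(3) sub(1), of "Col (c (g x)) n" id] cd by auto
    then have "x \<in> clr M (c (g x)) \<longleftrightarrow> y \<in> clr N (c (g x))" by simp
    then have "c (g x) = c (h y)"
      using representsD(3)[OF M xy(1) cd] representsD(3)[OF N xy(2) cd] by simp
    moreover have "eqv c r (g ` dom_of M \<inter> {a<..<g x}) (h ` dom_of N \<inter> {b<..<h y})"
      by (rule Suc.IH[OF xy(3) sub]; unfold P; rule insertI1 insertI2[OF Suc.prems(4)])
    moreover have "eqv c r (g ` dom_of M \<inter> {g x<..<a'}) (h ` dom_of N \<inter> {h y<..<b'})"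
      by (rule Suc.IH[OF xy(3) sub]; unfold P; rule insertI1 insertI2[OF Suc.prems(5)])
    moreover have "g ` dom_of M \<inter> {a<..<a'} \<inter> {..<g x} = g ` dom_of M \<inter> {a<..<g x}"
      "g ` dom_of M \<inter> {a<..<a'} \<inter> {g x<..} = g ` dom_of M \<inter> {g x<..<a'}"
      "h ` dom_of N \<inter> {b<..<b'} \<inter> {..<h y} = h ` dom_of N \<inter> {b<..<h y}"
      "h ` dom_of N \<inter> {b<..<b'} \<inter> {h y<..} = h ` dom_of N \<inter> {h y<..<b'}"
      using i by auto
    ultimately show ?thesis by simp
  qed
  show ?case
  proof (rule eqv_SucI)
    fix u assume "u \<in> g ` dom_of M \<inter> {a<..<a'}"
    then obtain x where x: "x \<in> dom_of M" "u = g x" "a < g x" "g x < a'" by auto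
    obtain y where y: "y \<in> dom_of N" "sat N (w(n := y)) (?c x)" using forth[OF x(1)] by blast
    have i: "b < h y" "h y < b'"
      using ord[OF x(1) y Suc.prems(4)] ord[OF x(1) y Suc.prems(5)] x(3,4) by auto
    show "\<exists>t\<in>h ` dom_of N \<inter> {b<..<b'}. c u = c t \<and>
        eqv c r (g ` dom_of M \<inter> {a<..<a'} \<inter> {..<u}) (h ` dom_of N \<inter> {b<..<b'} \<inter> {..<t}) \<and>
        eqv c r (g ` dom_of M \<inter> {a<..<a'} \<inter> {u<..}) (h ` dom_of N \<inter> {b<..<b'} \<inter> {t<..})"
      unfolding x(2) using step[OF x(1) y x(3,4) i] i y(1) by (intro bexI[of _ "h y"]) simp_all
  next
    fix u assume "u \<in> h ` dom_of N \<inter> {b<..<b'}"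
    then obtain y where y: "y \<in> dom_of N" "u = h y" "b < h y" "h y < b'" by auto
    obtain x where x: "x \<in> dom_of M" "sat N (w(n := y)) (?c x)" using backw[OF y(1)] by blast
    have i: "a < g x" "g x < a'"
      using ord[OF x(1) y(1) x(2) Suc.prems(4)] ord[OF x(1) y(1) x(2) Suc.prems(5)] y(3,4) by auto
    show "\<exists>t\<in>g ` dom_of M \<inter> {a<..<a'}. c u = c t \<and>
        eqv c r (h ` dom_of N \<inter> {b<..<b'} \<inter> {..<u}) (g ` dom_of M \<inter> {a<..<a'} \<inter> {..<t}) \<and>
        eqv c r (h ` dom_of N \<inter> {b<..<b'} \<inter> {u<..}) (g ` dom_of M \<inter> {a<..<a'} \<inter> {t<..})"
      unfolding y(2) using step[OF x(1) y(1) x(2) i y(3,4)] i x(1) eqv_sym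
      by (intro bexI[of _ "g x"]) simp_all
  qed
qed simp

lemma charsent_eq_imp_eqv:
  fixes M :: "'b cstruct" and N :: "'c cstruct" and g :: "'b \<Rightarrow> 'a" and h :: "'c \<Rightarrow> 'a"
  assumes "represents d c g M" "represents d c h N"
    and bd: "g ` dom_of M \<subseteq> {bt<..<tp}" "h ` dom_of N \<subseteq> {bt<..<tp}"
    and e: "charsent d r M = charsent d r N"
  shows "eqv c r (g ` dom_of M) (h ` dom_of N)"
proof -
  let ?u = "\<lambda>_. undefined"
  have "sat N ?u (charfm d M r 0 ?u)"
    using e charfm_props[of d N r 0 ?u] by (simp add: charsent_def)
  from charfm_imp_eqv[OF assms(1,2) bd this, of bt bt tp tp]
  have "eqv c r (g ` dom_of M \<inter> {bt<..<tp}) (h ` dom_of N \<inter> {bt<..<tp})"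
    by simp
  moreover have "g ` dom_of M \<inter> {bt<..<tp} = g ` dom_of M" "h ` dom_of N \<inter> {bt<..<tp} = h ` dom_of N"
    using bd by blast+
  ultimately show ?thesis by simp
qed

section \<open>Characters of a colored ordinal\<close>

text \<open>A Cantor normal form whose last nonzero digit is followed by \<open>n\<close> zeros is a
  multiple of \<open>omega ^ n\<close>, hence a limit of rank \<open>n\<close>; the point
  \<open>z\<close> itself sits at position \<open>omega ^ m\<close>.\<close>

lemma limit_rank_omega_pow:
  fixes h :: "nat list \<Rightarrow> 'a"
  assumes bt: "\<And>x. x \<in> B \<Longrightarrow> bt < x" and m: "0 < m"
    and hB: "\<And>xs. length xs = m \<Longrightarrow> h xs \<in> B \<and> h xs < z"
    and h: "\<And>xs ys. length xs = m \<Longrightarrow> length ys = m \<Longrightarrow> h xs < h ys \<longleftrightarrow> (xs, ys) \<in> lexn less_than m"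
    and onto: "\<And>b. b \<in> B \<Longrightarrow> b < z \<Longrightarrow> \<exists>xs. length xs = m \<and> b = h xs"
  shows "limit_rank bt B m z"
proof -
  have claim: "limit_rank bt B n (h (ps @ Suc p # replicate n 0))" if "length ps + Suc n = m" for n ps p
    using that
  proof (induction n arbitrary: ps p)
    case (Suc n)
    let ?w = "ps @ Suc p # replicate (Suc n) 0"
    have lw: "length ?w = m" using Suc.prems by simp
    have new: "\<exists>x\<in>B. x < h ?w \<and> limit_rank bt B n x \<and> x = h (ps @ p # Suc e # replicate n 0)" for e
    proof -
      have "length (ps @ p # Suc e # replicate n 0) = m" using Suc.prems by simp
      moreover have "(ps @ p # Suc e # replicate n 0, ?w) \<in> lexn less_than m"
        unfolding lexn_conv using Suc.prems by fastforce
      ultimately show ?thesis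
        using h lw hB Suc.IH[of "ps @ [p]" e] Suc.prems by auto
    qed
    show ?case
      unfolding limit_rank.simps
    proof (intro ballI impI)
      fix y assume y: "y \<in> insert bt B" "y < h ?w"
      show "\<exists>x\<in>B. y < x \<and> x < h ?w \<and> limit_rank bt B n x"
      proof (cases "y \<in> B")
        case False
        then have "y = bt" using y(1) by simp
        then show ?thesis using new[of 0] bt by blast
      next
        case True
        have "y < z" using y(2) hB[OF lw] less_trans by blast
        then obtain ys where ys: "length ys = m" "y = h ys" using onto True by blast
        then have "(ys, ?w) \<in> lexn less_than m" using h lw y(2) by blast
        then obtain pre x x' xs' ys' where l: "ys = pre @ x # xs'" "?w = pre @ x' # ys'" "x < x'"
          unfolding lexn_conv by auto
        \<comment> \<open>Lowering the digit \<open>Suc p\<close> to \<open>p\<close> allows the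
          next digit to be as large as desired. The value \<open>Suc e\<close> beats the digit of
          \<open>ys\<close> there, and being nonzero it gives a point of rank
          \<open>n\<close>.\<close>
        define e where "e = ys ! Suc (length ps)"
        have len: "length (ps @ p # Suc e # replicate n 0) = m" using Suc.prems by simp
        have nth: "?w ! length pre = x'" using l(2) by simp
        \<comment> \<open>The first difference cannot lie among the trailing zeros of
          \<open>?w\<close>, since there no digit is smaller.\<close>
        have "length pre \<le> length ps"
        proof (rule ccontr)
          assume "\<not> length pre \<le> length ps"
          then obtain j where j: "length pre = Suc (length ps) + j"
            by (metis add_Suc less_imp_Suc_add linorder_class.not_le)
          moreover have "length pre < length ?w" using l(2) by simp
          ultimately have "?w ! length pre = replicate (Suc n) 0 ! j" "j < Suc n"
            by (simp_all add: nth_append)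
          then have "?w ! length pre = 0" by (simp only: nth_replicate)
          then show False using nth l(3) by simp
        qed
        then consider "length pre < length ps" | "length pre = length ps" by linarith
        then have "(ys, ps @ p # Suc e # replicate n 0) \<in> lexn less_than m"
        proof cases
          case 1
          define u where "u = drop (Suc (length pre)) ps"
          have "take (length pre) ps = pre"
            using arg_cong[OF l(2), of "take (length pre)"] 1 by simp
          moreover have "ps ! length pre = x'"
            using nth 1 by (simp add: nth_append)
          ultimately have "ps = pre @ x' # u"
            unfolding u_def using id_take_nth_drop[OF 1] by simp
          then have "ps @ p # Suc e # replicate n 0 = pre @ x' # (u @ p # Suc e # replicate n 0)"
            by simp
          then show ?thesis
            unfolding lexn_conv using l(1) less_than_iff[of x x'] l(3) ys(1) len by blast
        next
          case 2
          then have p: "pre = ps" "x' = Suc p" using l(2) by auto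
          show ?thesis
          proof (cases "x = p")
            case True
            have "length xs' = Suc n" using l(1) p(1) ys(1) Suc.prems by simp
            then obtain e' xs'' where "xs' = e' # xs''" by (cases xs') auto
            moreover from this have "e = e'" unfolding e_def l(1) p(1) by (simp add: nth_append)
            ultimately have "ys = (ps @ [p]) @ e # xs''" using l(1) p(1) True by simp
            moreover have "ps @ p # Suc e # replicate n 0 = (ps @ [p]) @ Suc e # replicate n 0" by simp
            ultimately show ?thesis
              unfolding lexn_conv using ys(1) len less_than_iff[of e "Suc e"] lessI[of e] by blast
          next
            case False
            then have "(x, p) \<in> less_than" using l(3) p(2) by simp
            then show ?thesis
              unfolding lexn_conv using l(1)[unfolded p(1)] ys(1) len by blast
          qed
        qed
        then have "y < h (ps @ p # Suc e # replicate n 0)"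
          using h ys len by simp
        then show ?thesis using new[of e] by blast
      qed
    qed
  qed simp
  obtain n where n: "m = Suc n" using m by (cases m) auto
  show ?thesis
    unfolding n limit_rank.simps
  proof (intro ballI impI)
    fix y assume y: "y \<in> insert bt B" "y < z"
    \<comment> \<open>The positions \<open>omega ^ n\<close> times \<open>Suc e\<close> are cofinal
      in \<open>omega ^ m\<close>; again \<open>e\<close> will be the leading digit of the point to
      be exceeded.\<close>
    have new: "h (Suc e # replicate n 0) \<in> B \<and> h (Suc e # replicate n 0) < z \<and> limit_rank bt B n (h (Suc e # replicate n 0))" for e
      using hB[of "Suc e # replicate n 0"] claim[of "[]" n e] n by simp
    show "\<exists>x\<in>B. y < x \<and> x < z \<and> limit_rank bt B n x"
    proof (cases "y \<in> B")
      case False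
      then have "y = bt" using y(1) by simp
      then show ?thesis using new[of 0] bt by blast
    next
      case True
      then obtain ys where ys: "length ys = m" "y = h ys" using onto y(2) by blast
      then obtain e ys' where e: "ys = e # ys'" using n by (cases ys) auto
      have "(ys, Suc e # replicate n 0) \<in> lexn less_than m"
        unfolding lexn_conv using e ys(1) n by (auto intro!: exI[of _ "[]"])
      then have "y < h (Suc e # replicate n 0)" using h ys n by simp
      then show ?thesis using new[of e] by blast
    qed
  qed
qed

text \<open>The setting in which the results on the ambient order are read back for
  \<open>A\<close>. Convexity of the image is what the existence of reducts requires, and
  \<open>bt\<close> and \<open>tp\<close> are its end points.\<close>

context
  fixes d s :: nat and A :: "'b cstruct" and g :: "'b \<Rightarrow> 'a" and bt tp :: 'a and c :: "'a \<Rightarrow> nat"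
  assumes co: "colored_ordinal d A"
    and g: "\<And>x y. x \<in> dom_of A \<Longrightarrow> y \<in> dom_of A \<Longrightarrow> g x < g y \<longleftrightarrow> (x, y) \<in> le A \<and> x \<noteq> y"
    and bnd: "bt < tp" "\<And>x. x \<in> dom_of A \<Longrightarrow> bt < g x \<and> g x < tp"
    and conv: "\<And>x z w. x \<in> dom_of A \<Longrightarrow> z \<in> dom_of A \<Longrightarrow> g x < w \<Longrightarrow> w < g z \<Longrightarrow> w \<in> g ` dom_of A"
    and col: "\<And>x. x \<in> dom_of A \<Longrightarrow> c (g x) = color_of d A x" and fin: "finite (range c)"
begin

abbreviation gdom :: "'a set" where "gdom \<equiv> g ` dom_of A"

lemma Well_order_le: "Well_order (le A)"
  using co unfolding colored_ordinal_def by blast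

lemma g_eq: "x \<in> dom_of A \<Longrightarrow> y \<in> dom_of A \<Longrightarrow> g x = g y \<longleftrightarrow> x = y"
proof -
  assume "x \<in> dom_of A" "y \<in> dom_of A"
  moreover from this have "x \<noteq> y \<Longrightarrow> (x, y) \<in> le A \<or> (y, x) \<in> le A"
    using Well_order_le unfolding well_order_on_def linear_order_on_def total_on_def by blast
  ultimately show ?thesis using g less_irrefl by metis
qed

lemma inj_g: "inj_on g (dom_of A)"
  using g_eq by (auto intro: inj_onI)

lemma color_of_dom:
  assumes x: "x \<in> dom_of A"
  shows "color_of d A x < d" "i < d \<Longrightarrow> x \<in> clr A i \<longleftrightarrow> color_of d A x = i"
proof -
  have "x \<in> (\<Union>i<d. clr A i)"
    using x co unfolding colored_ordinal_def by simp
  then obtain j where j: "j < d" "x \<in> clr A j"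
    by (elim UN_E) simp
  have u: "i = j" if i: "i < d" "x \<in> clr A i" for i
  proof (rule ccontr)
    assume "i \<noteq> j"
    then have "clr A i \<inter> clr A j = {}"
      using co i(1) j(1) unfolding colored_ordinal_def disjoint_family_on_def by simp
    then show False using i(2) j(2) by blast
  qed
  have eq: "color_of d A x = j"
    unfolding color_of_def by (rule the_equality) (use j u in blast)+
  show "color_of d A x < d"
    using eq j(1) by simp
  show "x \<in> clr A i \<longleftrightarrow> color_of d A x = i" if "i < d"
    using eq j(2) u[OF that] by auto
qed

lemma dom_substr: "S \<subseteq> dom_of A \<Longrightarrow> dom_of (substr A S) = S"
  using Well_order_le unfolding substr_def by (simp add: Refl_Field_Restr2 well_order_on_def linear_order_on_def
      partial_order_on_def preorder_on_def)

lemma represents_self: "represents d c g A"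
  unfolding represents_def using g g_eq color_of_dom col by simp

lemma represents_substr:
  assumes "S \<subseteq> dom_of A"
  shows "represents d c g (substr A S)"
proof -
  have "\<And>x y. x \<in> S \<Longrightarrow> y \<in> S \<Longrightarrow> (x, y) \<in> le (substr A S) \<longleftrightarrow> (x, y) \<in> le A"
    "\<And>x i. x \<in> S \<Longrightarrow> x \<in> clr (substr A S) i \<longleftrightarrow> x \<in> clr A i"
    unfolding substr_def by simp_all
  then show ?thesis
    unfolding represents_def dom_substr[OF assms] using assms g g_eq color_of_dom col by (simp add: subset_iff)
qed

lemma colored_ordinal_substr:
  assumes "S \<subseteq> dom_of A"
  shows "colored_ordinal d (substr A S)"
proof -
  have "Well_order (le (substr A S))"
    unfolding substr_def using Well_order_Restr[OF Well_order_le] by simp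
  moreover have "disjoint_family_on (clr (substr A S)) {..<d}"
    using co unfolding colored_ordinal_def substr_def disjoint_family_on_def by auto
  moreover have "(\<Union>i<d. clr (substr A S) i) = dom_of (substr A S)"
    unfolding dom_substr[OF assms] using co assms unfolding colored_ordinal_def substr_def by auto
  ultimately show ?thesis unfolding colored_ordinal_def by blast
qed

lemma g_underS:
  assumes "x \<in> dom_of A"
  shows "g ` underS (le A) x = gdom \<inter> {..<g x}" "g ` aboveS (le A) x = gdom \<inter> {g x<..}"
    "underS (le A) x \<subseteq> dom_of A" "aboveS (le A) x \<subseteq> dom_of A"
proof -
  show sub: "underS (le A) x \<subseteq> dom_of A" "aboveS (le A) x \<subseteq> dom_of A"
    unfolding underS_def aboveS_def by (auto intro: FieldI1 FieldI2)
  have "y \<in> underS (le A) x \<longleftrightarrow> g y < g x" "y \<in> aboveS (le A) x \<longleftrightarrow> g x < g y" if "y \<in> dom_of A" for y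
    using g[OF that assms] g[OF assms that] unfolding underS_def aboveS_def by auto
  then show "g ` underS (le A) x = gdom \<inter> {..<g x}" "g ` aboveS (le A) x = gdom \<inter> {g x<..}"
    using sub by auto
qed

text \<open>Read contrapositively: points that the splitting game tells apart are counted separately
  in \<open>qchars\<close>.\<close>

lemma qchar_eq_imp_same_char:
  assumes x: "x \<in> dom_of A" and y: "y \<in> dom_of A" and e: "qchar d (Suc s) A x = qchar d (Suc s) A y"
  shows "same_char c gdom s (g x) (g y)"
proof -
  have *: "eqv c (Suc s) (g ` S) (g ` T)"
    if "S \<subseteq> dom_of A" "T \<subseteq> dom_of A" "charsent d (Suc s) (substr A S) = charsent d (Suc s) (substr A T)" for S T
  proof -
    have "eqv c (Suc s) (g ` dom_of (substr A S)) (g ` dom_of (substr A T))"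
      by (rule charsent_eq_imp_eqv[OF represents_substr[OF that(1)] represents_substr[OF that(2)] _ _ that(3), where bt = bt and tp = tp])
        (use that bnd dom_substr in auto)
    then show ?thesis using dom_substr that by simp
  qed
  show ?thesis
    unfolding same_char_def
    using x y e col *[OF g_underS(3)[OF x] g_underS(3)[OF y]] *[OF g_underS(4)[OF x] g_underS(4)[OF y]]
    by (simp add: qchar_def g_underS)
qed

lemma card_distinct_chars_le:
  assumes "Q \<subseteq> gdom" "pairwise (\<lambda>x y. \<not> same_char c gdom s x y) Q"
  shows "card Q \<le> card (qchars d (Suc s) A)"
proof -
  obtain Q' where Q': "Q' \<subseteq> dom_of A" "Q = g ` Q'"
    using assms(1) by (meson subset_imageE)
  have "inj_on (qchar d (Suc s) A) Q'"
  proof (rule inj_onI)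
    fix x y assume xy: "x \<in> Q'" "y \<in> Q'" "qchar d (Suc s) A x = qchar d (Suc s) A y"
    then have "same_char c gdom s (g x) (g y)"
      using qchar_eq_imp_same_char Q'(1) by blast
    then have "g x = g y"
      using assms(2) xy unfolding Q'(2) pairwise_def by blast
    then show "x = y" using g_eq xy Q'(1) by blast
  qed
  then have "card Q' = card (qchar d (Suc s) A ` Q')"
    by (simp add: card_image)
  also have "\<dots> \<le> card (qchars d (Suc s) A)"
    unfolding qchars_def using Q'(1) finite_qchars[OF co, of "Suc s"]
    by (intro card_mono) (auto simp: qchars_def)
  also have "card Q' = card Q"
    unfolding Q'(2) using inj_on_subset[OF inj_g Q'(1)] by (simp add: card_image)
  finally show ?thesis .
qed

text \<open>With more than \<open>N\<close> points, the first \<open>N\<close> and any further one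
  would give \<open>N + 1\<close> characters. So there are at most \<open>N\<close> points, each
  with fewer than \<open>N\<close> predecessors, and each is determined by its character.\<close>

lemma few_characters:
  assumes k: "card (qchars d (Suc s) A) \<le> 2 ^ Suc s - 1"
  shows "finite (dom_of A) \<and> card (dom_of A) = card (qchars d (Suc s) A)"
proof -
  define N :: nat where "N = 2 ^ Suc s - 1"
  have uniq: "x = y" if "finite (gdom \<inter> {..<x})" "card (gdom \<inter> {..<x}) < N" "same_char c gdom s x y" for x y
    using same_char_first_elements[OF that(3,1)] that(2) unfolding N_def by blast
  have no: False if F: "F \<subseteq> gdom" "finite F" "card F = Suc N" for F
  proof -
    obtain f where f: "f \<in> F" using F(3) by fastforce
    have "F - {f} \<subseteq> gdom" "finite (F - {f})" "card (F - {f}) = N"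
      using F f by auto
    from first_elements[OF this]
    obtain P where P: "P \<subseteq> gdom" "finite P" "card P = N"
      "\<forall>x\<in>P. finite (gdom \<inter> {..<x}) \<and> card (gdom \<inter> {..<x}) < N"
      by (elim exE conjE)
    have "\<not> F \<subseteq> P"
      using card_mono[OF P(2), of F] P(3) F(3) by auto
    then obtain e where e: "e \<in> F" "e \<notin> P" by blast
    have "pairwise (\<lambda>x y. \<not> same_char c gdom s x y) (insert e P)"
      unfolding pairwise_insert
    proof (intro conjI allI impI)
      show "pairwise (\<lambda>x y. \<not> same_char c gdom s x y) P"
        unfolding pairwise_def using uniq P(4) by blast
      fix x assume x: "x \<in> P \<and> x \<noteq> e"
      show "\<not> same_char c gdom s x e"
        using uniq[of x e] P(4) x by blast
      show "\<not> same_char c gdom s e x"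
        using uniq[of x e] P(4) x same_char_sym[of c gdom s e x] by blast
    qed
    then have "card (insert e P) \<le> card (qchars d (Suc s) A)"
      by (intro card_distinct_chars_le) (use e F(1) P(1) in auto)
    moreover have "card (insert e P) = Suc N"
      using e(2) P(2,3) by simp
    ultimately show False
      using k unfolding N_def[symmetric] by linarith
  qed
  have finD: "finite gdom"
    using no infinite_arbitrarily_large[of gdom "Suc N"] by blast
  have cardD: "card gdom \<le> N"
  proof (rule ccontr)
    assume "\<not> card gdom \<le> N"
    then have "Suc N \<le> card gdom" by simp
    then obtain F where "F \<subseteq> gdom" "card F = Suc N" "finite F"
      by (rule obtain_subset_with_card_n)
    then show False using no by blast
  qed
  have "pairwise (\<lambda>x y. \<not> same_char c gdom s x y) gdom"
    unfolding pairwise_def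
  proof (intro ballI impI notI)
    fix x y assume xy: "x \<in> gdom" "y \<in> gdom" "x \<noteq> y" "same_char c gdom s x y"
    have "gdom \<inter> {..<x} \<subset> gdom" using xy(1) by auto
    then have "card (gdom \<inter> {..<x}) < card gdom"
      by (rule psubset_card_mono[OF finD])
    then have "card (gdom \<inter> {..<x}) < N"
      using cardD by linarith
    then show False using uniq finD xy by blast
  qed
  then have "card gdom \<le> card (qchars d (Suc s) A)"
    by (intro card_distinct_chars_le) auto
  moreover have "card gdom = card (dom_of A)"
    using inj_g by (rule card_image)
  moreover have finA: "finite (dom_of A)"
    using finD inj_g by (simp add: finite_image_iff)
  moreover have "card (qchars d (Suc s) A) \<le> card (dom_of A)"
    unfolding qchars_def using finA by (rule card_image_le)
  ultimately show ?thesis by simp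
qed

text \<open>If the order type of the reduced set exceeded \<open>omega ^ m\<close>, there would be a
  point at position \<open>omega ^ m\<close>. Its limit rank \<open>m\<close> would force
  \<open>2 ^ Suc s + m\<close> characters, one more than there are.\<close>

lemma many_characters_bound:
  assumes k: "card (qchars d (Suc s) A) = 2 ^ Suc s - 1 + m" and m: "0 < m"
  shows "\<exists>S\<subseteq>dom_of A. equiv_q d (Suc (Suc s)) A (substr A S) \<and> le (substr A S) \<le>o omega_pow m"
proof -
  have cv: "w \<in> gdom" if "x \<in> gdom" "z \<in> gdom" "x < w" "w < z" for x z w
    using conv that by blast
  have DDb: "gdom \<subseteq> {bt<..<tp}" using bnd(2) by auto
  have "\<exists>B\<subseteq>gdom. eqv c (Suc (Suc s)) B gdom \<and> (\<forall>v\<in>B. reduced_at c gdom s bt B v)"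
    by (rule ex_reduced[OF fin _ DDb bnd(1)]) (rule cv)
  then obtain B where B: "B \<subseteq> gdom" "eqv c (Suc (Suc s)) B gdom" "\<forall>v\<in>B. reduced_at c gdom s bt B v"
    by (elim exE conjE)
  define S where "S = {x \<in> dom_of A. g x \<in> B}"
  have S: "S \<subseteq> dom_of A" "g ` S = B"
    unfolding S_def using B(1) by auto
  have "equiv_q d (Suc (Suc s)) A (substr A S)"
    by (rule eqv_imp_equiv_q[OF represents_self represents_substr[OF S(1)], where bt = bt and tp = tp])
      (use DDb S B(1) bnd(1) eqv_sym[OF B(2)] dom_substr[OF S(1)] in auto)
  moreover have "le (substr A S) \<le>o omega_pow m"
  proof (rule ccontr)
    assume "\<not> le (substr A S) \<le>o omega_pow m"
    moreover have woS: "Well_order (le (substr A S))"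
      using colored_ordinal_substr[OF S(1)] unfolding colored_ordinal_def by blast
    ultimately have "omega_pow m <o le (substr A S)"
      using not_ordLeq_iff_ordLess[OF Well_order_omega_pow] by blast
    then obtain a where a: "a \<in> S" "omega_pow m =o Restr (le (substr A S)) (underS (le (substr A S)) a)"
      using ordLess_iff_ordIso_Restr[OF woS Well_order_omega_pow] dom_substr[OF S(1)] by auto
    define U where "U = underS (le (substr A S)) a"
    have le: "(x, y) \<in> le (substr A S) \<longleftrightarrow> x \<in> S \<and> y \<in> S \<and> (x, y) \<in> le A" for x y
      unfolding substr_def by auto
    have U: "x \<in> U \<longleftrightarrow> x \<in> S \<and> g x < g a" for x
      unfolding U_def underS_def using le a(1) g[of x a] S(1) by auto
    have FU: "Field (Restr (le (substr A S)) U) = U"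
      using woS dom_substr[OF S(1)] U
      by (intro Refl_Field_Restr2) (auto simp: well_order_on_def linear_order_on_def partial_order_on_def preorder_on_def)
    obtain f where f: "iso (omega_pow m) (Restr (le (substr A S)) U) f"
      using a(2) unfolding ordIso_def U_def by blast
    have bij: "bij_betw f {xs. length xs = m} U"
      and ord: "\<And>xs ys. length xs = m \<Longrightarrow> length ys = m \<Longrightarrow>
        (xs, ys) \<in> omega_pow m \<longleftrightarrow> (f xs, f ys) \<in> Restr (le (substr A S)) U"
      using f unfolding iso_iff2 FU Field_omega_pow by auto
    have fU: "f xs \<in> U" if "length xs = m" for xs
      using bij that unfolding bij_betw_def by auto
    have irr: "(xs, xs) \<notin> lexn less_than m" for xs :: "nat list"
      using wf_lexn[of less_than m] by (meson wf_less_than wf_not_refl)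
    have "limit_rank bt B m (g a)"
    proof (rule limit_rank_omega_pow[where h = "\<lambda>xs. g (f xs)"])
      show "bt < x" if "x \<in> B" for x using subsetD[OF DDb subsetD[OF B(1) that]] by simp
      show "0 < m" by (rule m)
      show "g (f xs) \<in> B \<and> g (f xs) < g a" if "length xs = m" for xs
        using fU[OF that] U S(2) by auto
      show "g (f xs) < g (f ys) \<longleftrightarrow> (xs, ys) \<in> lexn less_than m" if l: "length xs = m" "length ys = m" for xs ys
      proof -
        have fs: "f xs \<in> S" "f ys \<in> S" "f xs \<in> U" "f ys \<in> U" using fU l U by auto
        have "f xs = f ys \<longleftrightarrow> xs = ys"
          using bij l unfolding bij_betw_def inj_on_def by auto
        moreover have "g (f xs) < g (f ys) \<longleftrightarrow> (f xs, f ys) \<in> le A \<and> f xs \<noteq> f ys"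
          using g fs S(1) by blast
        moreover have "(f xs, f ys) \<in> le A \<longleftrightarrow> (xs, ys) \<in> omega_pow m"
          using ord[OF l] fs le by auto
        ultimately show ?thesis
          using l irr unfolding omega_pow_def by auto
      qed
      show "\<exists>xs. length xs = m \<and> b = g (f xs)" if b: "b \<in> B" "b < g a" for b
      proof -
        obtain x where x: "x \<in> S" "b = g x" using b(1) S(2) by blast
        then have "x \<in> U" using U b(2) by simp
        then show ?thesis using bij x(2) unfolding bij_betw_def by auto
      qed
    qed
    moreover obtain n where n: "m = Suc n" using m by (cases m) auto
    ultimately have rz: "limit_rank bt B (Suc n) (g a)" by simp
    have "gdom \<subseteq> {bt<..}" using DDb by auto
    from many_characters[OF B(3) B(1) this rz]
    obtain Q where Q: "Q \<subseteq> gdom" "card Q = 2 ^ Suc s - 1 + Suc (Suc n)" "pairwise (\<lambda>x x'. \<not> same_char c gdom s x x') Q"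
      using a(1) S(2) by auto
    show False
      using card_distinct_chars_le[OF Q(1,3)] Q(2) k n by simp
  qed
  ultimately show ?thesis using S(1) by blast
qed

end

end

section \<open>Transfer to a well-ordered type\<close>

lemma wellorder_of_wf:
  fixes L :: "'a rel"
  assumes "wf L" "trans L" "total L"
  shows "class.wellorder (\<lambda>a b. a = b \<or> (a, b) \<in> L) (\<lambda>a b. (a, b) \<in> L)"
proof -
  have irr: "(a, a) \<notin> L" for a
    using assms(1) by (rule wf_not_refl)
  have asym: "(b, a) \<notin> L" if "(a, b) \<in> L" for a b
    using assms(1) that by (rule wf_not_sym)
  show ?thesis
  proof unfold_locales
    fix a b c :: 'a
    show "(a, b) \<in> L \<longleftrightarrow> (a = b \<or> (a, b) \<in> L) \<and> \<not> (b = a \<or> (b, a) \<in> L)"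
      using irr asym by auto
    show "a = b \<or> (a, b) \<in> L \<Longrightarrow> b = c \<or> (b, c) \<in> L \<Longrightarrow> a = c \<or> (a, c) \<in> L"
      using transD[OF assms(2)] by auto
    show "a = b \<or> (a, b) \<in> L \<Longrightarrow> b = a \<or> (b, a) \<in> L \<Longrightarrow> a = b"
      using asym by auto
    show "(a = b \<or> (a, b) \<in> L) \<or> (b = a \<or> (b, a) \<in> L)"
      using assms(3) unfolding total_on_def by auto
  next
    fix P and a :: 'a
    assume step: "\<And>x. (\<And>y. (y, x) \<in> L \<Longrightarrow> P y) \<Longrightarrow> P x"
    show "P a"
      using assms(1) by (induction a rule: wf_induct_rule) (rule step)
  qed simp
qed

text \<open>
  The two extra points of \<open>'a option option\<close> serve as end points of the open interval \<open>Field r\<close>.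
\<close>

lemma wellorder_extension:
  fixes r :: "'a rel"
  assumes "Well_order r"
  obtains L :: "'a option option rel"
  where "class.wellorder (\<lambda>a b. a = b \<or> (a, b) \<in> L) (\<lambda>a b. (a, b) \<in> L)"
    and "\<And>x y. x \<in> Field r \<Longrightarrow> y \<in> Field r \<Longrightarrow> (Some (Some x), Some (Some y)) \<in> L \<longleftrightarrow> (x, y) \<in> r \<and> x \<noteq> y"
    and "\<And>x. x \<in> Field r \<Longrightarrow> (None, Some (Some x)) \<in> L \<and> (Some (Some x), Some None) \<in> L"
    and "(None, Some None) \<in> L"
    and "\<And>x z w. x \<in> Field r \<Longrightarrow> z \<in> Field r \<Longrightarrow> (Some (Some x), w) \<in> L \<Longrightarrow> (w, Some (Some z)) \<in> L \<Longrightarrow>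
      w \<in> (\<lambda>x. Some (Some x)) ` Field r"
proof -
  let ?g = "\<lambda>x. Some (Some x) :: 'a option option"
  let ?F = "?g ` Field r"
  obtain W :: "'a option option rel" where W: "well_order_on UNIV W"
    using well_order_on by blast
  \<comment> \<open>Three levels: \<open>None\<close> at the bottom, the field in the middle,
    everything else on top. Elements outside the field are thereby kept from interrupting it, so its
    image is convex.\<close>
  define lev :: "'a option option \<Rightarrow> nat" where "lev a = (if a = None then 0 else if a \<in> ?F then 1 else 2)" for a
  define Q1 where "Q1 = {(?g x, ?g y) | x y. (x, y) \<in> r - Id}"
  define Q2 where "Q2 = {(a, b). a \<notin> ?F \<and> b \<notin> ?F \<and> (a, b) \<in> W - Id}"
  define L where "L = inv_image (less_than <*lex*> (Q1 \<union> Q2)) (\<lambda>a. (lev a, a))"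
  have LI: "(a, b) \<in> L \<longleftrightarrow> lev a < lev b \<or> lev a = lev b \<and> (a, b) \<in> Q1 \<union> Q2" for a b
    unfolding L_def by auto
  have r: "wf (r - Id)" "trans r" "antisym r" "total_on (Field r) r"
    using assms unfolding well_order_on_def linear_order_on_def partial_order_on_def preorder_on_def by auto
  have w: "wf (W - Id)" "trans W" "antisym W" "total_on UNIV W"
    using W unfolding well_order_on_def linear_order_on_def partial_order_on_def preorder_on_def by auto
  have rF: "x \<in> Field r" "y \<in> Field r" if "(x, y) \<in> r" for x y
    using that by (auto intro: FieldI1 FieldI2)
  have Q1F: "a \<in> ?F \<and> b \<in> ?F" if "(a, b) \<in> Q1" for a b
    using that rF unfolding Q1_def by blast
  have Q1: "(?g x, ?g y) \<in> Q1 \<longleftrightarrow> (x, y) \<in> r \<and> x \<noteq> y" for x y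
    unfolding Q1_def by auto
  have Q2: "(a, b) \<in> Q2 \<longleftrightarrow> a \<notin> ?F \<and> b \<notin> ?F \<and> (a, b) \<in> W \<and> a \<noteq> b" for a b
    unfolding Q2_def by auto
  have "wf Q1"
  proof (rule wf_subset)
    show "wf (inv_image (r - Id) (\<lambda>a. the (the a)))" using r(1) by (rule wf_inv_image)
    show "Q1 \<subseteq> inv_image (r - Id) (\<lambda>a. the (the a))" unfolding Q1_def by auto
  qed
  moreover have "wf Q2"
    by (rule wf_subset[OF w(1)]) (auto simp: Q2_def)
  moreover have "Domain Q1 \<inter> Range Q2 = {}"
    using Q1F unfolding Q2_def by blast
  ultimately have "wf (Q1 \<union> Q2)" by (rule wf_Un)
  then have "wf L"
    unfolding L_def by (intro wf_inv_image wf_lex_prod wf_less_than)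
  moreover have "trans L"
  proof (rule transI)
    fix a b c assume ab: "(a, b) \<in> L" and bc: "(b, c) \<in> L"
    show "(a, c) \<in> L"
    proof (cases "lev a = lev b \<and> lev b = lev c")
      case False
      then show ?thesis using ab bc unfolding LI by linarith
    next
      case True
      then have "(a, b) \<in> Q1 \<union> Q2" "(b, c) \<in> Q1 \<union> Q2" using ab bc unfolding LI by auto
      then consider "(a, b) \<in> Q1" "(b, c) \<in> Q1" | "(a, b) \<in> Q2" "(b, c) \<in> Q2"
        using Q1F Q2 by blast
      then have "(a, c) \<in> Q1 \<union> Q2"
      proof cases
        case 1
        then obtain x y z where xyz: "a = ?g x" "b = ?g y" "c = ?g z" "(x, y) \<in> r" "(y, z) \<in> r" "x \<noteq> y" "y \<noteq> z"
          unfolding Q1_def by auto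
        then show ?thesis
          using transD[OF r(2)] antisymD[OF r(3)] by (auto simp: Q1)
      next
        case 2
        then show ?thesis
          using transD[OF w(2)] antisymD[OF w(3)] unfolding Q2 Un_iff by metis
      qed
      then show ?thesis using True unfolding LI by simp
    qed
  qed
  moreover have "total L"
    unfolding total_on_def
  proof (intro ballI impI)
    fix a b :: "'a option option" assume ab: "a \<noteq> b"
    show "(a, b) \<in> L \<or> (b, a) \<in> L"
    proof (cases "lev a = lev b")
      case True
      then have iff: "a \<in> ?F \<longleftrightarrow> b \<in> ?F"
        using ab unfolding lev_def by (auto split: if_splits)
      have "(a, b) \<in> Q1 \<union> Q2 \<or> (b, a) \<in> Q1 \<union> Q2"
      proof (cases "a \<in> ?F")
        case True
        then obtain x y where "a = ?g x" "b = ?g y" "x \<in> Field r" "y \<in> Field r" using iff by auto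
        then show ?thesis
          using r(4) ab unfolding total_on_def by (auto simp: Q1)
      next
        case False
        then show ?thesis
          using iff w(4) ab unfolding total_on_def by (auto simp: Q2)
      qed
      then show ?thesis using True unfolding LI by auto
    next
      case False
      then show ?thesis unfolding LI by linarith
    qed
  qed
  ultimately have "class.wellorder (\<lambda>a b. a = b \<or> (a, b) \<in> L) (\<lambda>a b. (a, b) \<in> L)"
    by (rule wellorder_of_wf)
  moreover have lev: "lev (?g x) = 1" if "x \<in> Field r" for x
    using that unfolding lev_def by auto
  moreover have levN: "lev None = 0" "lev (Some None) = 2"
    unfolding lev_def by auto
  moreover have "(?g x, ?g y) \<in> L \<longleftrightarrow> (x, y) \<in> r \<and> x \<noteq> y" if "x \<in> Field r" "y \<in> Field r" for x y
    using that lev unfolding LI Un_iff Q1 Q2 by auto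
  moreover have "w \<in> ?F" if "x \<in> Field r" "z \<in> Field r" "(?g x, w) \<in> L" "(w, ?g z) \<in> L" for x z w
  proof -
    have "lev w = 1"
      using that(3,4) lev[OF that(1)] lev[OF that(2)] unfolding LI by linarith
    then show ?thesis
      unfolding lev_def by (auto split: if_splits)
  qed
  ultimately show thesis
    by (intro that[of L]) (auto simp: LI)
qed

lemma finite_ordLess_card:
  assumes "r <o r'" "finite (Field r')"
  shows "card (Field r) < card (Field r')"
proof -
  have wo: "Well_order r" "Well_order r'"
    using assms(1) unfolding ordLess_def by auto
  then obtain a where a: "a \<in> Field r'" "r =o Restr r' (underS r' a)"
    using assms(1) ordLess_iff_ordIso_Restr by blast
  then obtain f where "iso r (Restr r' (underS r' a)) f"
    unfolding ordIso_def by blast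
  then have "bij_betw f (Field r) (Field (Restr r' (underS r' a)))"
    unfolding iso_def by blast
  then have "card (Field r) = card (Field (Restr r' (underS r' a)))"
    by (rule bij_betw_same_card)
  also have "Field (Restr r' (underS r' a)) \<subseteq> Field r' - {a}"
    unfolding Field_def underS_def by auto
  then have "card (Field (Restr r' (underS r' a))) < card (Field r')"
    using a(1) assms(2) by (intro psubset_card_mono) auto
  finally show ?thesis .
qed

text \<open>Well-orders are comparable, and a strict comparison in either direction would make the
  equal finite cardinalities differ.\<close>

lemma finite_Well_order_natLeq_on:
  assumes "Well_order r" "finite (Field r)"
  shows "r =o natLeq_on (card (Field r))"
proof -
  let ?n = "natLeq_on (card (Field r))"
  have F: "finite (Field ?n)" "card (Field ?n) = card (Field r)"
    unfolding Field_natLeq_on by simp_all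
  have "\<not> r <o ?n" "\<not> ?n <o r"
    using finite_ordLess_card[of r ?n] finite_ordLess_card[of ?n r] F assms(2) by auto
  then show ?thesis
    using assms(1) natLeq_on_Well_order ordLess_or_ordLeq ordLeq_iff_ordLess_or_ordIso by blast
qed

theorem corollary1:
  fixes d q k :: nat and A :: "'a cstruct"
  assumes "d \<ge> 1" and "q \<ge> 2"
    and "least_otp d q A"
    and "k = card (qchars d (q - 1) A)"
  shows "(k \<le> 2 ^ (q - 1) - 1 \<longrightarrow> le A =o natLeq_on k) \<and>
         (k > 2 ^ (q - 1) - 1 \<longrightarrow> le A \<le>o omega_pow (k - 2 ^ (q - 1) + 1))"
proof -
  define s where "s = q - 2"
  have s: "q = Suc (Suc s)"
    unfolding s_def using assms(2) by simp
  have co: "colored_ordinal d A"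
    using assms(3) unfolding least_otp_def by blast
  then have wo: "Well_order (le A)"
    unfolding colored_ordinal_def by blast
  let ?g = "\<lambda>x. Some (Some x) :: 'a option option"
  obtain L :: "'a option option rel" where
    L: "class.wellorder (\<lambda>a b. a = b \<or> (a, b) \<in> L) (\<lambda>a b. (a, b) \<in> L)"
    and Lg: "\<And>x y. x \<in> dom_of A \<Longrightarrow> y \<in> dom_of A \<Longrightarrow> (?g x, ?g y) \<in> L \<longleftrightarrow> (x, y) \<in> le A \<and> x \<noteq> y"
    and Lb: "\<And>x. x \<in> dom_of A \<Longrightarrow> (None, ?g x) \<in> L \<and> (?g x, Some None) \<in> L"
    and Lt: "(None, Some None) \<in> L"
    and Lc: "\<And>x z w. x \<in> dom_of A \<Longrightarrow> z \<in> dom_of A \<Longrightarrow> (?g x, w) \<in> L \<Longrightarrow> (w, ?g z) \<in> L \<Longrightarrow> w \<in> ?g ` dom_of A"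
    by (rule wellorder_extension[OF wo]) (rule that; assumption)
  \<comment> \<open>The default 0 off the image of the domain adds at most one value to the range,
    which has to be finite.\<close>
  define c where "c a = (case a of Some (Some x) \<Rightarrow> if x \<in> dom_of A then color_of d A x else 0 | _ \<Rightarrow> 0)"
    for a :: "'a option option"
  have cg: "c (?g x) = color_of d A x" if "x \<in> dom_of A" for x
    using that unfolding c_def by simp
  have fin: "finite (range c)"
  proof (rule finite_subset)
    show "range c \<subseteq> insert 0 (color_of d A ` dom_of A)"
      unfolding c_def by (auto split: option.splits)
    \<comment> \<open>Colors are the first components of characters, so finiteness of the set of
      rank 0 characters bounds them.\<close>
    have "color_of d A ` dom_of A = fst ` qchars d 0 A"
      unfolding qchars_def qchar_def by (simp add: image_image)
    then show "finite (insert 0 (color_of d A ` dom_of A))"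
      using finite_qchars[OF co, of 0] by simp
  qed
  note inst = Lg Lt Lb Lc cg fin
  have few: "finite (dom_of A) \<and> card (dom_of A) = card (qchars d (Suc s) A)"
    if "card (qchars d (Suc s) A) \<le> 2 ^ Suc s - 1"
    by (rule wellorder.few_characters[where g = ?g and bt = None and tp = "Some None" and c = c, OF L co])
      (fact inst that)+
  have many: "\<exists>S\<subseteq>dom_of A. equiv_q d (Suc (Suc s)) A (substr A S) \<and> le (substr A S) \<le>o omega_pow m"
    if "card (qchars d (Suc s) A) = 2 ^ Suc s - 1 + m" "0 < m" for m
    by (rule wellorder.many_characters_bound[where g = ?g and bt = None and tp = "Some None" and c = c, OF L co])
      (fact inst that)+
  have sub: "colored_ordinal d (substr A S)" if "S \<subseteq> dom_of A" for S
    by (rule wellorder.colored_ordinal_substr[where g = ?g and bt = None and tp = "Some None" and c = c, OF L co])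
      (fact inst that)+
  show ?thesis
  proof (intro conjI impI)
    assume "k \<le> 2 ^ (q - 1) - 1"
    then have "finite (dom_of A) \<and> card (dom_of A) = k"
      using few assms(4) unfolding s by simp
    then show "le A =o natLeq_on k"
      using finite_Well_order_natLeq_on[OF wo] by simp
  next
    assume k: "k > 2 ^ (q - 1) - 1"
    \<comment> \<open>Here \<open>k \<ge> 2 ^ (q - 1)\<close>, so the truncated subtraction is exact
      and \<open>k = 2 ^ (q - 1) - 1 + m\<close> with \<open>m\<close> positive.\<close>
    define m where "m = k - 2 ^ (q - 1) + 1"
    have "(1::nat) \<le> 2 ^ (q - 1)" by simp
    then have m: "0 < m" "card (qchars d (Suc s) A) = 2 ^ Suc s - 1 + m"
      using k assms(4) unfolding m_def s by auto
    obtain S where S: "S \<subseteq> dom_of A" "equiv_q d q A (substr A S)" "le (substr A S) \<le>o omega_pow m"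
      using many[OF m(2,1)] unfolding s by (elim exE conjE)
    have "colored_ordinal d (substr A S)"
      using S(1) by (rule sub)
    then have "le A \<le>o le (substr A S)"
      using least_otp_le[OF assms(3)] S(2) by blast
    then show "le A \<le>o omega_pow (k - 2 ^ (q - 1) + 1)"
      using S(3) unfolding m_def by (rule ordLeq_transitive)
  qed
qed

end
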